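(* Let $M$ be a complete metric space in which balls are totally bounded. Assuming the axiom of dependent choices, every quasilocated subset $L$ of $M$ that is the zero set of a uniformly continuous function on $M$ is located.
   Context: Reasoning is constructive. For a set $T$ of reals, $\inf T$ is a lower bound $m$ such that whenever $m<s$ there is $t\in T$ with $t<s$, and $\operatorname{glb} T$ is the largest lower bound. For $L\subseteq M$, $x\in M$: $d(x,L)=\inf_{y\in L}d(x,y)$ and $\delta(x,L)=\operatorname{glb}_{y\in L}d(x,y)$. $L$ is located if $d(x,L)$ exists for every $x\in M$, and quasilocated if $\delta(x,L)$ exists for every $x\in M$. *)

theory Defs
  imports Main
begin

text \<open>
  The theorem asserts provability in constructive mathematics; read in the classical logic of HOL
  it would say almost nothing, because there \<open>inf\<close> and \<open>glb\<close> agree.  Constructive reasoning is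
  therefore represented by derivability in intuitionistic higher-order logic: many-sorted
  intuitionistic natural deduction over simple types, with comprehension and extensionality,
  Peano's axioms, and the constructive axioms of the real line.
\<close>

datatype ty =
    TNat ("\<^bold>N")
  | TReal ("\<^bold>R")
  | TBase nat
  | TProd ty ty (infixr "\<^bold>\<times>" 80)
  | TFun ty ty (infixr "\<^bold>\<rightarrow>" 75)
  | TPow ty

text \<open>
  \<open>V\<close> is used for bound variables only.  Free (generic) individuals are the typed parameters
  \<open>Par\<close>, so that substitution of a closed term can never capture.
\<close>

datatype tm =
    V string
  | Par ty nat
  | Zero ("\<^bold>0\<^sub>N")
  | Succ tm
  | RZero ("\<^bold>0")
  | ROne ("\<^bold>1")
  | RAdd tm tm (infixl "\<^bold>+" 65)
  | RNeg tm
  | RMul tm tm (infixl "\<^bold>*" 70)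
  | OfNat tm
  | Pr tm tm ("\<langle>_,/ _\<rangle>")
  | Proj1 tm
  | Proj2 tm
  | App tm tm (infixl "\<^bold>\<cdot>" 90)

datatype fm =
    Bot ("\<^bold>\<bottom>")
  | Eq tm tm (infix "\<^bold>=" 50)
  | Less tm tm (infix "\<^bold><" 50)
  | LessN tm tm (infix "\<^bold><\<^sub>N" 50)
  | Mem tm tm (infix "\<^bold>\<in>" 50)
  | And fm fm (infixr "\<^bold>\<and>" 35)
  | Or fm fm (infixr "\<^bold>\<or>" 30)
  | Imp fm fm (infixr "\<^bold>\<longrightarrow>" 25)
  | All string ty fm ("(3\<^bold>\<forall>_ \<^bold>: _./ _)" [100, 75, 10] 10)
  | Ex string ty fm ("(3\<^bold>\<exists>_ \<^bold>: _./ _)" [100, 75, 10] 10)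

abbreviation Neg :: "fm \<Rightarrow> fm" ("\<^bold>\<not> _" [40] 40) where
  "\<^bold>\<not> p \<equiv> p \<^bold>\<longrightarrow> \<^bold>\<bottom>"

abbreviation Iff :: "fm \<Rightarrow> fm \<Rightarrow> fm" (infixr "\<^bold>\<longleftrightarrow>" 25) where
  "p \<^bold>\<longleftrightarrow> q \<equiv> (p \<^bold>\<longrightarrow> q) \<^bold>\<and> (q \<^bold>\<longrightarrow> p)"

abbreviation Leq :: "tm \<Rightarrow> tm \<Rightarrow> fm" (infix "\<^bold>\<le>" 50) where
  "a \<^bold>\<le> b \<equiv> \<^bold>\<not> (b \<^bold>< a)"

text \<open>There is no rule for \<open>V\<close>: a typable term is closed.\<close>

inductive has_ty :: "tm \<Rightarrow> ty \<Rightarrow> bool" where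
  "has_ty (Par \<sigma> n) \<sigma>"
| "has_ty \<^bold>0\<^sub>N \<^bold>N"
| "has_ty t \<^bold>N \<Longrightarrow> has_ty (Succ t) \<^bold>N"
| "has_ty \<^bold>0 \<^bold>R"
| "has_ty \<^bold>1 \<^bold>R"
| "has_ty s \<^bold>R \<Longrightarrow> has_ty t \<^bold>R \<Longrightarrow> has_ty (s \<^bold>+ t) \<^bold>R"
| "has_ty t \<^bold>R \<Longrightarrow> has_ty (RNeg t) \<^bold>R"
| "has_ty s \<^bold>R \<Longrightarrow> has_ty t \<^bold>R \<Longrightarrow> has_ty (s \<^bold>* t) \<^bold>R"
| "has_ty t \<^bold>N \<Longrightarrow> has_ty (OfNat t) \<^bold>R"
| "has_ty s \<sigma> \<Longrightarrow> has_ty t \<tau> \<Longrightarrow> has_ty \<langle>s, t\<rangle> (\<sigma> \<^bold>\<times> \<tau>)"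
| "has_ty t (\<sigma> \<^bold>\<times> \<tau>) \<Longrightarrow> has_ty (Proj1 t) \<sigma>"
| "has_ty t (\<sigma> \<^bold>\<times> \<tau>) \<Longrightarrow> has_ty (Proj2 t) \<tau>"
| "has_ty s (\<sigma> \<^bold>\<rightarrow> \<tau>) \<Longrightarrow> has_ty t \<sigma> \<Longrightarrow> has_ty (s \<^bold>\<cdot> t) \<tau>"

primrec subst_tm :: "string \<Rightarrow> tm \<Rightarrow> tm \<Rightarrow> tm" where
  "subst_tm x u (V y) = (if y = x then u else V y)"
| "subst_tm x u (Par \<sigma> n) = Par \<sigma> n"
| "subst_tm x u \<^bold>0\<^sub>N = \<^bold>0\<^sub>N"
| "subst_tm x u (Succ t) = Succ (subst_tm x u t)"
| "subst_tm x u \<^bold>0 = \<^bold>0"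
| "subst_tm x u \<^bold>1 = \<^bold>1"
| "subst_tm x u (s \<^bold>+ t) = subst_tm x u s \<^bold>+ subst_tm x u t"
| "subst_tm x u (RNeg t) = RNeg (subst_tm x u t)"
| "subst_tm x u (s \<^bold>* t) = subst_tm x u s \<^bold>* subst_tm x u t"
| "subst_tm x u (OfNat t) = OfNat (subst_tm x u t)"
| "subst_tm x u \<langle>s, t\<rangle> = \<langle>subst_tm x u s, subst_tm x u t\<rangle>"
| "subst_tm x u (Proj1 t) = Proj1 (subst_tm x u t)"
| "subst_tm x u (Proj2 t) = Proj2 (subst_tm x u t)"
| "subst_tm x u (s \<^bold>\<cdot> t) = subst_tm x u s \<^bold>\<cdot> subst_tm x u t"

primrec subst :: "string \<Rightarrow> tm \<Rightarrow> fm \<Rightarrow> fm" where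
  "subst x u \<^bold>\<bottom> = \<^bold>\<bottom>"
| "subst x u (s \<^bold>= t) = (subst_tm x u s \<^bold>= subst_tm x u t)"
| "subst x u (s \<^bold>< t) = (subst_tm x u s \<^bold>< subst_tm x u t)"
| "subst x u (s \<^bold><\<^sub>N t) = (subst_tm x u s \<^bold><\<^sub>N subst_tm x u t)"
| "subst x u (s \<^bold>\<in> t) = (subst_tm x u s \<^bold>\<in> subst_tm x u t)"
| "subst x u (p \<^bold>\<and> q) = (subst x u p \<^bold>\<and> subst x u q)"
| "subst x u (p \<^bold>\<or> q) = (subst x u p \<^bold>\<or> subst x u q)"
| "subst x u (p \<^bold>\<longrightarrow> q) = (subst x u p \<^bold>\<longrightarrow> subst x u q)"
| "subst x u (\<^bold>\<forall>y \<^bold>: \<sigma>. p) = (\<^bold>\<forall>y \<^bold>: \<sigma>. (if y = x then p else subst x u p))"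
| "subst x u (\<^bold>\<exists>y \<^bold>: \<sigma>. p) = (\<^bold>\<exists>y \<^bold>: \<sigma>. (if y = x then p else subst x u p))"

primrec vars_tm :: "tm \<Rightarrow> string set" where
  "vars_tm (V y) = {y}"
| "vars_tm (Par \<sigma> n) = {}"
| "vars_tm \<^bold>0\<^sub>N = {}"
| "vars_tm (Succ t) = vars_tm t"
| "vars_tm \<^bold>0 = {}"
| "vars_tm \<^bold>1 = {}"
| "vars_tm (s \<^bold>+ t) = vars_tm s \<union> vars_tm t"
| "vars_tm (RNeg t) = vars_tm t"
| "vars_tm (s \<^bold>* t) = vars_tm s \<union> vars_tm t"
| "vars_tm (OfNat t) = vars_tm t"
| "vars_tm \<langle>s, t\<rangle> = vars_tm s \<union> vars_tm t"
| "vars_tm (Proj1 t) = vars_tm t"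
| "vars_tm (Proj2 t) = vars_tm t"
| "vars_tm (s \<^bold>\<cdot> t) = vars_tm s \<union> vars_tm t"

primrec vars :: "fm \<Rightarrow> string set" where
  "vars \<^bold>\<bottom> = {}"
| "vars (s \<^bold>= t) = vars_tm s \<union> vars_tm t"
| "vars (s \<^bold>< t) = vars_tm s \<union> vars_tm t"
| "vars (s \<^bold><\<^sub>N t) = vars_tm s \<union> vars_tm t"
| "vars (s \<^bold>\<in> t) = vars_tm s \<union> vars_tm t"
| "vars (p \<^bold>\<and> q) = vars p \<union> vars q"
| "vars (p \<^bold>\<or> q) = vars p \<union> vars q"
| "vars (p \<^bold>\<longrightarrow> q) = vars p \<union> vars q"
| "vars (\<^bold>\<forall>y \<^bold>: \<sigma>. p) = vars p - {y}"
| "vars (\<^bold>\<exists>y \<^bold>: \<sigma>. p) = vars p - {y}"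

primrec params_tm :: "tm \<Rightarrow> (ty \<times> nat) set" where
  "params_tm (V y) = {}"
| "params_tm (Par \<sigma> n) = {(\<sigma>, n)}"
| "params_tm \<^bold>0\<^sub>N = {}"
| "params_tm (Succ t) = params_tm t"
| "params_tm \<^bold>0 = {}"
| "params_tm \<^bold>1 = {}"
| "params_tm (s \<^bold>+ t) = params_tm s \<union> params_tm t"
| "params_tm (RNeg t) = params_tm t"
| "params_tm (s \<^bold>* t) = params_tm s \<union> params_tm t"
| "params_tm (OfNat t) = params_tm t"
| "params_tm \<langle>s, t\<rangle> = params_tm s \<union> params_tm t"
| "params_tm (Proj1 t) = params_tm t"
| "params_tm (Proj2 t) = params_tm t"
| "params_tm (s \<^bold>\<cdot> t) = params_tm s \<union> params_tm t"

primrec params :: "fm \<Rightarrow> (ty \<times> nat) set" where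
  "params \<^bold>\<bottom> = {}"
| "params (s \<^bold>= t) = params_tm s \<union> params_tm t"
| "params (s \<^bold>< t) = params_tm s \<union> params_tm t"
| "params (s \<^bold><\<^sub>N t) = params_tm s \<union> params_tm t"
| "params (s \<^bold>\<in> t) = params_tm s \<union> params_tm t"
| "params (p \<^bold>\<and> q) = params p \<union> params q"
| "params (p \<^bold>\<or> q) = params p \<union> params q"
| "params (p \<^bold>\<longrightarrow> q) = params p \<union> params q"
| "params (\<^bold>\<forall>y \<^bold>: \<sigma>. p) = params p"
| "params (\<^bold>\<exists>y \<^bold>: \<sigma>. p) = params p"

text \<open>
  Intuitionistic natural deduction with equality.  \<open>T\<close> is a set of axioms, \<open>\<Gamma>\<close> the set of open
  assumptions.  Axioms may contain parameters, which are then read universally; accordingly the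
  eigenvariable conditions only concern \<open>\<Gamma>\<close> and the formulas involved.
\<close>

inductive derives :: "fm set \<Rightarrow> fm set \<Rightarrow> fm \<Rightarrow> bool" ("_; _ \<turnstile> _" [50, 50, 50] 49)
  for T :: "fm set" where
  Axiom: "p \<in> T \<Longrightarrow> T; \<Gamma> \<turnstile> p"
| Assume: "p \<in> \<Gamma> \<Longrightarrow> T; \<Gamma> \<turnstile> p"
| Weaken: "T; \<Gamma> \<turnstile> p \<Longrightarrow> \<Gamma> \<subseteq> \<Delta> \<Longrightarrow> T; \<Delta> \<turnstile> p"
| BotE: "T; \<Gamma> \<turnstile> \<^bold>\<bottom> \<Longrightarrow> T; \<Gamma> \<turnstile> p"
| AndI: "T; \<Gamma> \<turnstile> p \<Longrightarrow> T; \<Gamma> \<turnstile> q \<Longrightarrow> T; \<Gamma> \<turnstile> (p \<^bold>\<and> q)"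
| AndE1: "T; \<Gamma> \<turnstile> (p \<^bold>\<and> q) \<Longrightarrow> T; \<Gamma> \<turnstile> p"
| AndE2: "T; \<Gamma> \<turnstile> (p \<^bold>\<and> q) \<Longrightarrow> T; \<Gamma> \<turnstile> q"
| OrI1: "T; \<Gamma> \<turnstile> p \<Longrightarrow> T; \<Gamma> \<turnstile> (p \<^bold>\<or> q)"
| OrI2: "T; \<Gamma> \<turnstile> q \<Longrightarrow> T; \<Gamma> \<turnstile> (p \<^bold>\<or> q)"
| OrE: "T; \<Gamma> \<turnstile> (p \<^bold>\<or> q) \<Longrightarrow> T; insert p \<Gamma> \<turnstile> r \<Longrightarrow> T; insert q \<Gamma> \<turnstile> r \<Longrightarrow> T; \<Gamma> \<turnstile> r"
| ImpI: "T; insert p \<Gamma> \<turnstile> q \<Longrightarrow> T; \<Gamma> \<turnstile> (p \<^bold>\<longrightarrow> q)"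
| ImpE: "T; \<Gamma> \<turnstile> (p \<^bold>\<longrightarrow> q) \<Longrightarrow> T; \<Gamma> \<turnstile> p \<Longrightarrow> T; \<Gamma> \<turnstile> q"
| AllI: "T; \<Gamma> \<turnstile> subst x (Par \<sigma> c) p \<Longrightarrow> (\<sigma>, c) \<notin> params p \<Longrightarrow> \<forall>q\<in>\<Gamma>. (\<sigma>, c) \<notin> params q
    \<Longrightarrow> T; \<Gamma> \<turnstile> (\<^bold>\<forall>x \<^bold>: \<sigma>. p)"
| AllE: "T; \<Gamma> \<turnstile> (\<^bold>\<forall>x \<^bold>: \<sigma>. p) \<Longrightarrow> has_ty t \<sigma> \<Longrightarrow> T; \<Gamma> \<turnstile> subst x t p"
| ExI: "T; \<Gamma> \<turnstile> subst x t p \<Longrightarrow> has_ty t \<sigma> \<Longrightarrow> T; \<Gamma> \<turnstile> (\<^bold>\<exists>x \<^bold>: \<sigma>. p)"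
| ExE: "T; \<Gamma> \<turnstile> (\<^bold>\<exists>x \<^bold>: \<sigma>. p) \<Longrightarrow> T; insert (subst x (Par \<sigma> c) p) \<Gamma> \<turnstile> r
    \<Longrightarrow> (\<sigma>, c) \<notin> params p \<Longrightarrow> (\<sigma>, c) \<notin> params r \<Longrightarrow> \<forall>q\<in>\<Gamma>. (\<sigma>, c) \<notin> params q
    \<Longrightarrow> T; \<Gamma> \<turnstile> r"
| EqI: "has_ty t \<sigma> \<Longrightarrow> T; \<Gamma> \<turnstile> (t \<^bold>= t)"
| EqE: "T; \<Gamma> \<turnstile> (s \<^bold>= t) \<Longrightarrow> T; \<Gamma> \<turnstile> subst x s p \<Longrightarrow> has_ty s \<sigma> \<Longrightarrow> has_ty t \<sigma>
    \<Longrightarrow> T; \<Gamma> \<turnstile> subst x t p"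

inductive_set set_axioms :: "fm set" where
  comprehension: "vars p \<subseteq> {x} \<Longrightarrow> x \<noteq> ''A'' \<Longrightarrow>
    (\<^bold>\<exists>''A'' \<^bold>: TPow \<sigma>. \<^bold>\<forall>x \<^bold>: \<sigma>. (V x \<^bold>\<in> V ''A'' \<^bold>\<longleftrightarrow> p)) \<in> set_axioms"
| set_ext:
    "(\<^bold>\<forall>''A'' \<^bold>: TPow \<sigma>. \<^bold>\<forall>''B'' \<^bold>: TPow \<sigma>.
        (\<^bold>\<forall>''x'' \<^bold>: \<sigma>. (V ''x'' \<^bold>\<in> V ''A'' \<^bold>\<longleftrightarrow> V ''x'' \<^bold>\<in> V ''B'')) \<^bold>\<longrightarrow> V ''A'' \<^bold>= V ''B'') \<in> set_axioms"
| fun_ext: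
    "(\<^bold>\<forall>''f'' \<^bold>: \<sigma> \<^bold>\<rightarrow> \<tau>. \<^bold>\<forall>''g'' \<^bold>: \<sigma> \<^bold>\<rightarrow> \<tau>.
        (\<^bold>\<forall>''x'' \<^bold>: \<sigma>. V ''f'' \<^bold>\<cdot> V ''x'' \<^bold>= V ''g'' \<^bold>\<cdot> V ''x'') \<^bold>\<longrightarrow> V ''f'' \<^bold>= V ''g'') \<in> set_axioms"
| function_of_graph:
    "(\<^bold>\<forall>''G'' \<^bold>: TPow (\<sigma> \<^bold>\<times> \<tau>).
        (\<^bold>\<forall>''x'' \<^bold>: \<sigma>. \<^bold>\<exists>''y'' \<^bold>: \<tau>. \<langle>V ''x'', V ''y''\<rangle> \<^bold>\<in> V ''G'' \<^bold>\<and>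
            (\<^bold>\<forall>''z'' \<^bold>: \<tau>. \<langle>V ''x'', V ''z''\<rangle> \<^bold>\<in> V ''G'' \<^bold>\<longrightarrow> V ''z'' \<^bold>= V ''y'')) \<^bold>\<longrightarrow>
        (\<^bold>\<exists>''f'' \<^bold>: \<sigma> \<^bold>\<rightarrow> \<tau>. \<^bold>\<forall>''x'' \<^bold>: \<sigma>. \<langle>V ''x'', V ''f'' \<^bold>\<cdot> V ''x''\<rangle> \<^bold>\<in> V ''G'')) \<in> set_axioms"
| proj1: "(\<^bold>\<forall>''x'' \<^bold>: \<sigma>. \<^bold>\<forall>''y'' \<^bold>: \<tau>. Proj1 \<langle>V ''x'', V ''y''\<rangle> \<^bold>= V ''x'') \<in> set_axioms"
| proj2: "(\<^bold>\<forall>''x'' \<^bold>: \<sigma>. \<^bold>\<forall>''y'' \<^bold>: \<tau>. Proj2 \<langle>V ''x'', V ''y''\<rangle> \<^bold>= V ''y'') \<in> set_axioms"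
| surj_pair: "(\<^bold>\<forall>''z'' \<^bold>: \<sigma> \<^bold>\<times> \<tau>. \<langle>Proj1 (V ''z''), Proj2 (V ''z'')\<rangle> \<^bold>= V ''z'') \<in> set_axioms"

definition nat_axioms :: "fm set" where
  "nat_axioms = {
    (\<^bold>\<forall>''n'' \<^bold>: \<^bold>N. \<^bold>\<not> (Succ (V ''n'') \<^bold>= \<^bold>0\<^sub>N)),
    (\<^bold>\<forall>''m'' \<^bold>: \<^bold>N. \<^bold>\<forall>''n'' \<^bold>: \<^bold>N. Succ (V ''m'') \<^bold>= Succ (V ''n'') \<^bold>\<longrightarrow> V ''m'' \<^bold>= V ''n''),
    (\<^bold>\<forall>''A'' \<^bold>: TPow \<^bold>N. \<^bold>0\<^sub>N \<^bold>\<in> V ''A'' \<^bold>\<and>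
        (\<^bold>\<forall>''n'' \<^bold>: \<^bold>N. V ''n'' \<^bold>\<in> V ''A'' \<^bold>\<longrightarrow> Succ (V ''n'') \<^bold>\<in> V ''A'') \<^bold>\<longrightarrow>
        (\<^bold>\<forall>''n'' \<^bold>: \<^bold>N. V ''n'' \<^bold>\<in> V ''A'')),
    (\<^bold>\<forall>''k'' \<^bold>: \<^bold>N. \<^bold>\<not> (V ''k'' \<^bold><\<^sub>N \<^bold>0\<^sub>N)),
    (\<^bold>\<forall>''k'' \<^bold>: \<^bold>N. \<^bold>\<forall>''n'' \<^bold>: \<^bold>N.
        (V ''k'' \<^bold><\<^sub>N Succ (V ''n'') \<^bold>\<longleftrightarrow> V ''k'' \<^bold><\<^sub>N V ''n'' \<^bold>\<or> V ''k'' \<^bold>= V ''n''))}"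

text \<open>
  The real line as an Archimedean Heyting field in which every inhabited, bounded above and
  order located set has a supremum (Bridges' constructive axioms).  Up to isomorphism, these
  determine the Dedekind reals.
\<close>

definition real_axioms :: "fm set" where
  "real_axioms = {
    (\<^bold>\<forall>''x'' \<^bold>: \<^bold>R. \<^bold>\<forall>''y'' \<^bold>: \<^bold>R. \<^bold>\<forall>''z'' \<^bold>: \<^bold>R.
        (V ''x'' \<^bold>+ V ''y'') \<^bold>+ V ''z'' \<^bold>= V ''x'' \<^bold>+ (V ''y'' \<^bold>+ V ''z'')),
    (\<^bold>\<forall>''x'' \<^bold>: \<^bold>R. \<^bold>\<forall>''y'' \<^bold>: \<^bold>R. V ''x'' \<^bold>+ V ''y'' \<^bold>= V ''y'' \<^bold>+ V ''x''),
    (\<^bold>\<forall>''x'' \<^bold>: \<^bold>R. V ''x'' \<^bold>+ \<^bold>0 \<^bold>= V ''x''),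
    (\<^bold>\<forall>''x'' \<^bold>: \<^bold>R. V ''x'' \<^bold>+ RNeg (V ''x'') \<^bold>= \<^bold>0),
    (\<^bold>\<forall>''x'' \<^bold>: \<^bold>R. \<^bold>\<forall>''y'' \<^bold>: \<^bold>R. \<^bold>\<forall>''z'' \<^bold>: \<^bold>R.
        (V ''x'' \<^bold>* V ''y'') \<^bold>* V ''z'' \<^bold>= V ''x'' \<^bold>* (V ''y'' \<^bold>* V ''z'')),
    (\<^bold>\<forall>''x'' \<^bold>: \<^bold>R. \<^bold>\<forall>''y'' \<^bold>: \<^bold>R. V ''x'' \<^bold>* V ''y'' \<^bold>= V ''y'' \<^bold>* V ''x''),
    (\<^bold>\<forall>''x'' \<^bold>: \<^bold>R. V ''x'' \<^bold>* \<^bold>1 \<^bold>= V ''x''),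
    (\<^bold>\<forall>''x'' \<^bold>: \<^bold>R. \<^bold>\<forall>''y'' \<^bold>: \<^bold>R. \<^bold>\<forall>''z'' \<^bold>: \<^bold>R.
        V ''x'' \<^bold>* (V ''y'' \<^bold>+ V ''z'') \<^bold>= V ''x'' \<^bold>* V ''y'' \<^bold>+ V ''x'' \<^bold>* V ''z''),
    (\<^bold>\<forall>''x'' \<^bold>: \<^bold>R. V ''x'' \<^bold>< \<^bold>0 \<^bold>\<or> \<^bold>0 \<^bold>< V ''x'' \<^bold>\<longrightarrow> (\<^bold>\<exists>''y'' \<^bold>: \<^bold>R. V ''x'' \<^bold>* V ''y'' \<^bold>= \<^bold>1)),
    (\<^bold>0 \<^bold>< \<^bold>1),
    (\<^bold>\<forall>''x'' \<^bold>: \<^bold>R. \<^bold>\<forall>''y'' \<^bold>: \<^bold>R. \<^bold>\<not> (V ''x'' \<^bold>< V ''y'' \<^bold>\<and> V ''y'' \<^bold>< V ''x'')),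
    (\<^bold>\<forall>''x'' \<^bold>: \<^bold>R. \<^bold>\<forall>''y'' \<^bold>: \<^bold>R. V ''x'' \<^bold>< V ''y'' \<^bold>\<longrightarrow>
        (\<^bold>\<forall>''z'' \<^bold>: \<^bold>R. V ''x'' \<^bold>< V ''z'' \<^bold>\<or> V ''z'' \<^bold>< V ''y'')),
    (\<^bold>\<forall>''x'' \<^bold>: \<^bold>R. \<^bold>\<forall>''y'' \<^bold>: \<^bold>R. V ''x'' \<^bold>\<le> V ''y'' \<^bold>\<and> V ''y'' \<^bold>\<le> V ''x'' \<^bold>\<longrightarrow> V ''x'' \<^bold>= V ''y''),
    (\<^bold>\<forall>''x'' \<^bold>: \<^bold>R. \<^bold>\<forall>''y'' \<^bold>: \<^bold>R. V ''x'' \<^bold>< V ''y'' \<^bold>\<longrightarrow>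
        (\<^bold>\<forall>''z'' \<^bold>: \<^bold>R. V ''x'' \<^bold>+ V ''z'' \<^bold>< V ''y'' \<^bold>+ V ''z'')),
    (\<^bold>\<forall>''x'' \<^bold>: \<^bold>R. \<^bold>\<forall>''y'' \<^bold>: \<^bold>R. \<^bold>0 \<^bold>< V ''x'' \<^bold>\<and> \<^bold>0 \<^bold>< V ''y'' \<^bold>\<longrightarrow> \<^bold>0 \<^bold>< V ''x'' \<^bold>* V ''y''),
    (OfNat \<^bold>0\<^sub>N \<^bold>= \<^bold>0),
    (\<^bold>\<forall>''n'' \<^bold>: \<^bold>N. OfNat (Succ (V ''n'')) \<^bold>= OfNat (V ''n'') \<^bold>+ \<^bold>1),
    (\<^bold>\<forall>''x'' \<^bold>: \<^bold>R. \<^bold>\<exists>''n'' \<^bold>: \<^bold>N. V ''x'' \<^bold>< OfNat (V ''n'')),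
    (\<^bold>\<forall>''A'' \<^bold>: TPow \<^bold>R.
        (\<^bold>\<exists>''x'' \<^bold>: \<^bold>R. V ''x'' \<^bold>\<in> V ''A'') \<^bold>\<and>
        (\<^bold>\<exists>''b'' \<^bold>: \<^bold>R. \<^bold>\<forall>''x'' \<^bold>: \<^bold>R. V ''x'' \<^bold>\<in> V ''A'' \<^bold>\<longrightarrow> V ''x'' \<^bold>\<le> V ''b'') \<^bold>\<and>
        (\<^bold>\<forall>''a'' \<^bold>: \<^bold>R. \<^bold>\<forall>''b'' \<^bold>: \<^bold>R. V ''a'' \<^bold>< V ''b'' \<^bold>\<longrightarrow>
            (\<^bold>\<forall>''x'' \<^bold>: \<^bold>R. V ''x'' \<^bold>\<in> V ''A'' \<^bold>\<longrightarrow> V ''x'' \<^bold>\<le> V ''b'') \<^bold>\<or>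
            (\<^bold>\<exists>''x'' \<^bold>: \<^bold>R. V ''x'' \<^bold>\<in> V ''A'' \<^bold>\<and> V ''a'' \<^bold>< V ''x'')) \<^bold>\<longrightarrow>
        (\<^bold>\<exists>''s'' \<^bold>: \<^bold>R.
            (\<^bold>\<forall>''x'' \<^bold>: \<^bold>R. V ''x'' \<^bold>\<in> V ''A'' \<^bold>\<longrightarrow> V ''x'' \<^bold>\<le> V ''s'') \<^bold>\<and>
            (\<^bold>\<forall>''a'' \<^bold>: \<^bold>R. V ''a'' \<^bold>< V ''s'' \<^bold>\<longrightarrow>
                (\<^bold>\<exists>''x'' \<^bold>: \<^bold>R. V ''x'' \<^bold>\<in> V ''A'' \<^bold>\<and> V ''a'' \<^bold>< V ''x''))))}"

definition IHOL :: "fm set" where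
  "IHOL = set_axioms \<union> nat_axioms \<union> real_axioms"

definition dependent_choice :: "ty \<Rightarrow> fm" where
  "dependent_choice \<sigma> =
    (\<^bold>\<forall>''A'' \<^bold>: TPow \<sigma>. \<^bold>\<forall>''Q'' \<^bold>: TPow (\<sigma> \<^bold>\<times> \<sigma>).
        (\<^bold>\<forall>''x'' \<^bold>: \<sigma>. V ''x'' \<^bold>\<in> V ''A'' \<^bold>\<longrightarrow>
            (\<^bold>\<exists>''y'' \<^bold>: \<sigma>. V ''y'' \<^bold>\<in> V ''A'' \<^bold>\<and> \<langle>V ''x'', V ''y''\<rangle> \<^bold>\<in> V ''Q'')) \<^bold>\<longrightarrow>
        (\<^bold>\<forall>''a'' \<^bold>: \<sigma>. V ''a'' \<^bold>\<in> V ''A'' \<^bold>\<longrightarrow>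
            (\<^bold>\<exists>''s'' \<^bold>: \<^bold>N \<^bold>\<rightarrow> \<sigma>. V ''s'' \<^bold>\<cdot> \<^bold>0\<^sub>N \<^bold>= V ''a'' \<^bold>\<and>
                (\<^bold>\<forall>''n'' \<^bold>: \<^bold>N. V ''s'' \<^bold>\<cdot> V ''n'' \<^bold>\<in> V ''A'' \<^bold>\<and>
                    \<langle>V ''s'' \<^bold>\<cdot> V ''n'', V ''s'' \<^bold>\<cdot> Succ (V ''n'')\<rangle> \<^bold>\<in> V ''Q''))))"

definition DC :: "fm set" where
  "DC = range dependent_choice"

text \<open>
  In the formulas below the term arguments are placed under named binders, so they must be closed
  or variables whose names are not bound in the definition concerned: \<open>d\<close> (metric), \<open>L\<close>, \<open>B\<close>
  (subsets of the space), \<open>f\<close>, \<open>T\<close> (set of reals) and \<open>m\<close> stand for variables of those names.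
\<close>

definition metric :: "ty \<Rightarrow> tm \<Rightarrow> fm" where
  "metric \<sigma> d =
    ((\<^bold>\<forall>''x'' \<^bold>: \<sigma>. \<^bold>\<forall>''y'' \<^bold>: \<sigma>. \<^bold>0 \<^bold>\<le> d \<^bold>\<cdot> \<langle>V ''x'', V ''y''\<rangle>) \<^bold>\<and>
     (\<^bold>\<forall>''x'' \<^bold>: \<sigma>. \<^bold>\<forall>''y'' \<^bold>: \<sigma>. (d \<^bold>\<cdot> \<langle>V ''x'', V ''y''\<rangle> \<^bold>= \<^bold>0 \<^bold>\<longleftrightarrow> V ''x'' \<^bold>= V ''y'')) \<^bold>\<and>
     (\<^bold>\<forall>''x'' \<^bold>: \<sigma>. \<^bold>\<forall>''y'' \<^bold>: \<sigma>. d \<^bold>\<cdot> \<langle>V ''x'', V ''y''\<rangle> \<^bold>= d \<^bold>\<cdot> \<langle>V ''y'', V ''x''\<rangle>) \<^bold>\<and>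
     (\<^bold>\<forall>''x'' \<^bold>: \<sigma>. \<^bold>\<forall>''y'' \<^bold>: \<sigma>. \<^bold>\<forall>''z'' \<^bold>: \<sigma>.
        d \<^bold>\<cdot> \<langle>V ''x'', V ''z''\<rangle> \<^bold>\<le> d \<^bold>\<cdot> \<langle>V ''x'', V ''y''\<rangle> \<^bold>+ d \<^bold>\<cdot> \<langle>V ''y'', V ''z''\<rangle>))"

definition complete :: "ty \<Rightarrow> tm \<Rightarrow> fm" where
  "complete \<sigma> d =
    (\<^bold>\<forall>''s'' \<^bold>: \<^bold>N \<^bold>\<rightarrow> \<sigma>.
        (\<^bold>\<forall>''e'' \<^bold>: \<^bold>R. \<^bold>0 \<^bold>< V ''e'' \<^bold>\<longrightarrow> (\<^bold>\<exists>''k'' \<^bold>: \<^bold>N. \<^bold>\<forall>''i'' \<^bold>: \<^bold>N. \<^bold>\<forall>''j'' \<^bold>: \<^bold>N.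
            V ''k'' \<^bold><\<^sub>N V ''i'' \<^bold>\<and> V ''k'' \<^bold><\<^sub>N V ''j'' \<^bold>\<longrightarrow>
            d \<^bold>\<cdot> \<langle>V ''s'' \<^bold>\<cdot> V ''i'', V ''s'' \<^bold>\<cdot> V ''j''\<rangle> \<^bold>< V ''e'')) \<^bold>\<longrightarrow>
        (\<^bold>\<exists>''z'' \<^bold>: \<sigma>. \<^bold>\<forall>''e'' \<^bold>: \<^bold>R. \<^bold>0 \<^bold>< V ''e'' \<^bold>\<longrightarrow> (\<^bold>\<exists>''k'' \<^bold>: \<^bold>N. \<^bold>\<forall>''i'' \<^bold>: \<^bold>N.
            V ''k'' \<^bold><\<^sub>N V ''i'' \<^bold>\<longrightarrow> d \<^bold>\<cdot> \<langle>V ''s'' \<^bold>\<cdot> V ''i'', V ''z''\<rangle> \<^bold>< V ''e'')))"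

text \<open>
  For every \<open>e > 0\<close> there is a finite \<open>e\<close>-approximation \<open>p 0, \<dots>, p (n - 1)\<close> consisting of
  elements of \<open>B\<close>.
\<close>

definition totally_bounded :: "ty \<Rightarrow> tm \<Rightarrow> tm \<Rightarrow> fm" where
  "totally_bounded \<sigma> d B =
    (\<^bold>\<forall>''e'' \<^bold>: \<^bold>R. \<^bold>0 \<^bold>< V ''e'' \<^bold>\<longrightarrow> (\<^bold>\<exists>''n'' \<^bold>: \<^bold>N. \<^bold>\<exists>''p'' \<^bold>: \<^bold>N \<^bold>\<rightarrow> \<sigma>.
        (\<^bold>\<forall>''k'' \<^bold>: \<^bold>N. V ''k'' \<^bold><\<^sub>N V ''n'' \<^bold>\<longrightarrow> V ''p'' \<^bold>\<cdot> V ''k'' \<^bold>\<in> B) \<^bold>\<and>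
        (\<^bold>\<forall>''y'' \<^bold>: \<sigma>. V ''y'' \<^bold>\<in> B \<^bold>\<longrightarrow>
            (\<^bold>\<exists>''k'' \<^bold>: \<^bold>N. V ''k'' \<^bold><\<^sub>N V ''n'' \<^bold>\<and> d \<^bold>\<cdot> \<langle>V ''y'', V ''p'' \<^bold>\<cdot> V ''k''\<rangle> \<^bold>< V ''e''))))"

definition balls_totally_bounded :: "ty \<Rightarrow> tm \<Rightarrow> fm" where
  "balls_totally_bounded \<sigma> d =
    (\<^bold>\<forall>''c'' \<^bold>: \<sigma>. \<^bold>\<forall>''r'' \<^bold>: \<^bold>R. \<^bold>0 \<^bold>< V ''r'' \<^bold>\<longrightarrow> (\<^bold>\<forall>''B'' \<^bold>: TPow \<sigma>.
        (\<^bold>\<forall>''y'' \<^bold>: \<sigma>. (V ''y'' \<^bold>\<in> V ''B'' \<^bold>\<longleftrightarrow> d \<^bold>\<cdot> \<langle>V ''c'', V ''y''\<rangle> \<^bold>< V ''r'')) \<^bold>\<longrightarrow>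
        totally_bounded \<sigma> d (V ''B'')))"

definition is_lower_bound :: "tm \<Rightarrow> tm \<Rightarrow> fm" where
  "is_lower_bound m T = (\<^bold>\<forall>''t'' \<^bold>: \<^bold>R. V ''t'' \<^bold>\<in> T \<^bold>\<longrightarrow> m \<^bold>\<le> V ''t'')"

definition is_inf :: "tm \<Rightarrow> tm \<Rightarrow> fm" where
  "is_inf m T =
    (is_lower_bound m T \<^bold>\<and>
     (\<^bold>\<forall>''s'' \<^bold>: \<^bold>R. m \<^bold>< V ''s'' \<^bold>\<longrightarrow> (\<^bold>\<exists>''t'' \<^bold>: \<^bold>R. V ''t'' \<^bold>\<in> T \<^bold>\<and> V ''t'' \<^bold>< V ''s'')))"

definition is_glb :: "tm \<Rightarrow> tm \<Rightarrow> fm" where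
  "is_glb m T =
    (is_lower_bound m T \<^bold>\<and>
     (\<^bold>\<forall>''b'' \<^bold>: \<^bold>R. is_lower_bound (V ''b'') T \<^bold>\<longrightarrow> V ''b'' \<^bold>\<le> m))"

definition is_distance_set :: "ty \<Rightarrow> tm \<Rightarrow> tm \<Rightarrow> tm \<Rightarrow> tm \<Rightarrow> fm" where
  "is_distance_set \<sigma> d x L T =
    (\<^bold>\<forall>''t'' \<^bold>: \<^bold>R. (V ''t'' \<^bold>\<in> T \<^bold>\<longleftrightarrow>
        (\<^bold>\<exists>''y'' \<^bold>: \<sigma>. V ''y'' \<^bold>\<in> L \<^bold>\<and> V ''t'' \<^bold>= d \<^bold>\<cdot> \<langle>x, V ''y''\<rangle>)))"

definition located :: "ty \<Rightarrow> tm \<Rightarrow> tm \<Rightarrow> fm" where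
  "located \<sigma> d L =
    (\<^bold>\<forall>''x'' \<^bold>: \<sigma>. \<^bold>\<exists>''T'' \<^bold>: TPow \<^bold>R. is_distance_set \<sigma> d (V ''x'') L (V ''T'') \<^bold>\<and>
        (\<^bold>\<exists>''m'' \<^bold>: \<^bold>R. is_inf (V ''m'') (V ''T'')))"

definition quasilocated :: "ty \<Rightarrow> tm \<Rightarrow> tm \<Rightarrow> fm" where
  "quasilocated \<sigma> d L =
    (\<^bold>\<forall>''x'' \<^bold>: \<sigma>. \<^bold>\<exists>''T'' \<^bold>: TPow \<^bold>R. is_distance_set \<sigma> d (V ''x'') L (V ''T'') \<^bold>\<and>
        (\<^bold>\<exists>''m'' \<^bold>: \<^bold>R. is_glb (V ''m'') (V ''T'')))"

text \<open>\<open>\<bar>f x - f y\<bar> < e\<close> is written as the conjunction of \<open>f x < f y + e\<close> and \<open>f y < f x + e\<close>.\<close>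

definition uniformly_continuous :: "ty \<Rightarrow> tm \<Rightarrow> tm \<Rightarrow> fm" where
  "uniformly_continuous \<sigma> d f =
    (\<^bold>\<forall>''e'' \<^bold>: \<^bold>R. \<^bold>0 \<^bold>< V ''e'' \<^bold>\<longrightarrow> (\<^bold>\<exists>''h'' \<^bold>: \<^bold>R. \<^bold>0 \<^bold>< V ''h'' \<^bold>\<and>
        (\<^bold>\<forall>''x'' \<^bold>: \<sigma>. \<^bold>\<forall>''y'' \<^bold>: \<sigma>. d \<^bold>\<cdot> \<langle>V ''x'', V ''y''\<rangle> \<^bold>< V ''h'' \<^bold>\<longrightarrow>
            f \<^bold>\<cdot> V ''x'' \<^bold>< f \<^bold>\<cdot> V ''y'' \<^bold>+ V ''e'' \<^bold>\<and> f \<^bold>\<cdot> V ''y'' \<^bold>< f \<^bold>\<cdot> V ''x'' \<^bold>+ V ''e'')))"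

definition is_zero_set :: "ty \<Rightarrow> tm \<Rightarrow> tm \<Rightarrow> fm" where
  "is_zero_set \<sigma> f L = (\<^bold>\<forall>''x'' \<^bold>: \<sigma>. (V ''x'' \<^bold>\<in> L \<^bold>\<longleftrightarrow> f \<^bold>\<cdot> V ''x'' \<^bold>= \<^bold>0))"

end

theory Submission
  imports Defs "HOL-Library.FSet"
begin

text \<open>
  Let \<open>m = \<delta>(x, L)\<close>; it suffices to find, for every \<open>s > m\<close>, a point of \<open>L\<close> at distance less than
  \<open>s\<close> from \<open>x\<close>, for then \<open>m\<close> is the infimum.  If \<open>\<delta>(x, L) < r\<close> and \<open>e > 0\<close>, then some member \<open>p\<close>
  of a finite \<open>e/2\<close>-approximation of the ball of radius \<open>r\<close> about \<open>x\<close> satisfies \<open>\<delta>(p, L) < e\<close>: one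
  can decide for each member whether \<open>\<delta>(p, L) < e\<close> or \<open>\<delta>(p, L) > e/2\<close>, and the second alternative
  cannot hold throughout, since the ball cannot fail to meet \<open>L\<close>.  Iterating this by dependent
  choice with \<open>e\<close> halved each time gives a Cauchy sequence whose limit \<open>z\<close> satisfies
  \<open>\<delta>(z, L) = 0\<close>.  By uniform continuity \<open>f z\<close> is arbitrarily small, hence \<open>f z = 0\<close> and \<open>z \<in> L\<close>.
\<close>

section \<open>Derivability over finite contexts\<close>

text \<open>A greatest lower bound never produces a point of \<open>L\<close>; it only refutes that
  all of \<open>L\<close> is far away. The proof therefore keeps what is negative to places where a
  refutation is enough. Actual points come from finite approximations, dependent choice and
  completeness, which all deliver witnesses. Membership of the limit in \<open>L\<close> is an
  equation between reals, and equations follow by antisymmetry from two statements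
  \<open>\<le>\<close>, each of which is a negated \<open><\<close>. This is what the uniformly
  continuous function contributes: \<open>f z = 0\<close> can be proved by refutation, so points of
  \<open>L\<close> that merely cannot fail to exist may be used for it. A sequence started at
  \<open>x\<close> with radius \<open>r\<close> is only known to stay within \<open>2 r\<close> of
  \<open>x\<close>, which may be well above \<open>m\<close>. One preliminary step with a large
  radius therefore leads from \<open>x\<close> to a point \<open>y\<close> that is near
  \<open>L\<close> at a small scale, and the sequence starts at \<open>y\<close>. With
  \<open>s = m + 2 h\<close> the step costs less than \<open>m + h\<close> and the whole sequence at
  most \<open>h\<close>.\<close>

lemma has_ty_closed: "has_ty t \<sigma> \<Longrightarrow> vars_tm t = {}"
  by (induction rule: has_ty.induct) auto

lemma subst_tm_fresh [simp]: "x \<notin> vars_tm t \<Longrightarrow> subst_tm x u t = t"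
  by (induction t) auto

lemma subst_fresh: "x \<notin> vars p \<Longrightarrow> subst x u p = p"
  by (induction p) auto

lemma subst_tm_commute:
  "x \<noteq> y \<Longrightarrow> vars_tm s = {} \<Longrightarrow> vars_tm t = {} \<Longrightarrow>
    subst_tm x s (subst_tm y t u) = subst_tm y t (subst_tm x s u)"
  by (induction u) auto

lemma subst_commute:
  "x \<noteq> y \<Longrightarrow> vars_tm s = {} \<Longrightarrow> vars_tm t = {} \<Longrightarrow>
    subst x s (subst y t p) = subst y t (subst x s p)"
  by (induction p) (auto simp: subst_tm_commute)

lemma finite_params_tm: "finite (params_tm t)"
  by (induction t) auto

lemma finite_params: "finite (params p)"
  by (induction p) (auto simp: finite_params_tm)

lemma fresh_parameter:
  assumes "finite F"
  obtains c where "\<forall>q\<in>F. (\<sigma>, c) \<notin> params q"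
proof -
  have "finite (snd ` (\<Union>q\<in>F. params q))"
    using assms finite_params by blast
  then obtain c where "c \<notin> snd ` (\<Union>q\<in>F. params q)"
    using ex_new_if_finite infinite_UNIV_nat by blast
  then have "\<forall>q\<in>F. (\<sigma>, c) \<notin> params q"
    by force
  then show ?thesis ..
qed

text \<open>Since contexts are finite, a fresh parameter is always available.  This yields the
  introduction and elimination rules in a Kripke style without eigenvariable conditions: the
  premises quantify over all extensions of the context and over all parameters.\<close>

definition forces :: "fm fset \<Rightarrow> fm \<Rightarrow> bool" (infix "\<tturnstile>" 49) where
  "\<Gamma> \<tturnstile> p \<longleftrightarrow> (IHOL \<union> DC; fset \<Gamma> \<turnstile> p)"

lemma mono: "\<Gamma> \<tturnstile> p \<Longrightarrow> \<Gamma> |\<subseteq>| \<Delta> \<Longrightarrow> \<Delta> \<tturnstile> p"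
  unfolding forces_def less_eq_fset.rep_eq by (rule Weaken)

lemma axiom: "p \<in> IHOL \<union> DC \<Longrightarrow> \<Gamma> \<tturnstile> p"
  unfolding forces_def by (rule Axiom)

lemma bot_elim: "\<Gamma> \<tturnstile> \<^bold>\<bottom> \<Longrightarrow> \<Gamma> \<tturnstile> p"
  unfolding forces_def by (rule BotE)

lemma and_intro: "\<Gamma> \<tturnstile> p \<Longrightarrow> \<Gamma> \<tturnstile> q \<Longrightarrow> \<Gamma> \<tturnstile> (p \<^bold>\<and> q)"
  unfolding forces_def by (rule AndI)

lemma and_elim1: "\<Gamma> \<tturnstile> (p \<^bold>\<and> q) \<Longrightarrow> \<Gamma> \<tturnstile> p"
  unfolding forces_def by (rule AndE1)

lemma and_elim2: "\<Gamma> \<tturnstile> (p \<^bold>\<and> q) \<Longrightarrow> \<Gamma> \<tturnstile> q"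
  unfolding forces_def by (rule AndE2)

lemma or_intro1: "\<Gamma> \<tturnstile> p \<Longrightarrow> \<Gamma> \<tturnstile> (p \<^bold>\<or> q)"
  unfolding forces_def by (rule OrI1)

lemma or_intro2: "\<Gamma> \<tturnstile> q \<Longrightarrow> \<Gamma> \<tturnstile> (p \<^bold>\<or> q)"
  unfolding forces_def by (rule OrI2)

lemma or_elim:
  assumes "\<Gamma> \<tturnstile> (p \<^bold>\<or> q)"
    and "\<And>\<Delta>. \<Gamma> |\<subseteq>| \<Delta> \<Longrightarrow> \<Delta> \<tturnstile> p \<Longrightarrow> \<Delta> \<tturnstile> r"
    and "\<And>\<Delta>. \<Gamma> |\<subseteq>| \<Delta> \<Longrightarrow> \<Delta> \<tturnstile> q \<Longrightarrow> \<Delta> \<tturnstile> r"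
  shows "\<Gamma> \<tturnstile> r"
proof -
  \<comment> \<open>The least extension of the context that derives \<open>p\<close> is
    \<open>finsert p \<Gamma>\<close>; the premise taken there is the premise of the ordinary
    rule.\<close>
  have "finsert p \<Gamma> \<tturnstile> r" "finsert q \<Gamma> \<tturnstile> r"
    by (rule assms(2,3); auto simp: forces_def intro: Assume)+
  then show ?thesis
    using assms(1) unfolding forces_def by (auto intro: OrE)
qed

lemma imp_intro:
  assumes "\<And>\<Delta>. \<Gamma> |\<subseteq>| \<Delta> \<Longrightarrow> \<Delta> \<tturnstile> p \<Longrightarrow> \<Delta> \<tturnstile> q"
  shows "\<Gamma> \<tturnstile> (p \<^bold>\<longrightarrow> q)"
proof -
  have "finsert p \<Gamma> \<tturnstile> q"
    by (rule assms; auto simp: forces_def intro: Assume)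
  then show ?thesis
    unfolding forces_def by (auto intro: ImpI)
qed

lemma imp_elim: "\<Gamma> \<tturnstile> (p \<^bold>\<longrightarrow> q) \<Longrightarrow> \<Gamma> \<tturnstile> p \<Longrightarrow> \<Gamma> \<tturnstile> q"
  unfolding forces_def by (rule ImpE)

text \<open>Of all the instances in the premise only one is used, at a parameter that occurs neither
  in \<open>p\<close> nor in the finite context.\<close>

lemma all_intro:
  assumes "\<And>c. \<Gamma> \<tturnstile> subst x (Par \<sigma> c) p"
  shows "\<Gamma> \<tturnstile> (\<^bold>\<forall>x \<^bold>: \<sigma>. p)"
proof -
  obtain c where "\<forall>q\<in>insert p (fset \<Gamma>). (\<sigma>, c) \<notin> params q"
    using fresh_parameter[of "insert p (fset \<Gamma>)"] by auto
  then show ?thesis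
    using assms[of c] unfolding forces_def by (auto intro: AllI)
qed

lemma all_elim: "\<Gamma> \<tturnstile> (\<^bold>\<forall>x \<^bold>: \<sigma>. p) \<Longrightarrow> has_ty t \<sigma> \<Longrightarrow> \<Gamma> \<tturnstile> subst x t p"
  unfolding forces_def by (rule AllE)

lemma all_elim2:
  assumes "\<Gamma> \<tturnstile> (\<^bold>\<forall>x \<^bold>: \<sigma>. \<^bold>\<forall>y \<^bold>: \<tau>. p)" "has_ty s \<sigma>" "has_ty t \<tau>" "x \<noteq> y"
  shows "\<Gamma> \<tturnstile> subst y t (subst x s p)"
  using all_elim[OF assms(1,2)] assms(3,4) by (auto intro: all_elim)

lemma all_elim3:
  assumes "\<Gamma> \<tturnstile> (\<^bold>\<forall>x \<^bold>: \<sigma>. \<^bold>\<forall>y \<^bold>: \<tau>. \<^bold>\<forall>z \<^bold>: \<rho>. p)" "has_ty s \<sigma>" "has_ty t \<tau>" "has_ty u \<rho>"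
    "x \<noteq> y" "x \<noteq> z" "y \<noteq> z"
  shows "\<Gamma> \<tturnstile> subst z u (subst y t (subst x s p))"
  using all_elim2[OF assms(1,2,3)] assms(4-) by (auto intro: all_elim)

lemma ex_intro: "has_ty t \<sigma> \<Longrightarrow> \<Gamma> \<tturnstile> subst x t p \<Longrightarrow> \<Gamma> \<tturnstile> (\<^bold>\<exists>x \<^bold>: \<sigma>. p)"
  unfolding forces_def by (rule ExI)

lemma ex_elim:
  assumes "\<Gamma> \<tturnstile> (\<^bold>\<exists>x \<^bold>: \<sigma>. p)"
    and "\<And>\<Delta> c. \<Gamma> |\<subseteq>| \<Delta> \<Longrightarrow> \<Delta> \<tturnstile> subst x (Par \<sigma> c) p \<Longrightarrow> \<Delta> \<tturnstile> r"
  shows "\<Gamma> \<tturnstile> r"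
proof -
  obtain c where "\<forall>q\<in>insert p (insert r (fset \<Gamma>)). (\<sigma>, c) \<notin> params q"
    using fresh_parameter[of "insert p (insert r (fset \<Gamma>))"] by auto
  moreover have "finsert (subst x (Par \<sigma> c) p) \<Gamma> \<tturnstile> r"
    by (rule assms; auto simp: forces_def intro: Assume)
  ultimately show ?thesis
    using assms(1) unfolding forces_def by (auto intro: ExE)
qed

section \<open>Equality, comprehension and induction as derived rules\<close>

lemma eq_refl: "has_ty t \<sigma> \<Longrightarrow> \<Gamma> \<tturnstile> (t \<^bold>= t)"
  unfolding forces_def by (rule EqI)

lemma eq_subst:
  "\<Gamma> \<tturnstile> (s \<^bold>= t) \<Longrightarrow> \<Gamma> \<tturnstile> subst x s p \<Longrightarrow> has_ty s \<sigma> \<Longrightarrow> has_ty t \<sigma> \<Longrightarrow> \<Gamma> \<tturnstile> subst x t p"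
  unfolding forces_def by (rule EqE)

lemma eq_sym: "\<Gamma> \<tturnstile> (s \<^bold>= t) \<Longrightarrow> has_ty s \<sigma> \<Longrightarrow> has_ty t \<sigma> \<Longrightarrow> \<Gamma> \<tturnstile> (t \<^bold>= s)"
  using eq_subst[of \<Gamma> s t "''x''" "V ''x'' \<^bold>= s" \<sigma>] eq_refl[of s \<sigma> \<Gamma>]
  by (auto simp: has_ty_closed)

lemma eq_trans:
  "\<Gamma> \<tturnstile> (s \<^bold>= t) \<Longrightarrow> \<Gamma> \<tturnstile> (t \<^bold>= u) \<Longrightarrow> has_ty s \<sigma> \<Longrightarrow> has_ty t \<sigma> \<Longrightarrow> has_ty u \<sigma> \<Longrightarrow> \<Gamma> \<tturnstile> (s \<^bold>= u)"
  using eq_subst[of \<Gamma> t u "''x''" "s \<^bold>= V ''x''" \<sigma>] by (auto simp: has_ty_closed)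

text \<open>Here \<open>u\<close> is a term context with hole \<open>x\<close>. Leibniz substitution
  is applied to the formula \<open>subst_tm x s u = u\<close>, read with object-level equality: its
  left side is typable, hence closed, so the substitution reaches the right side only.\<close>

lemma eq_cong:
  assumes "\<Gamma> \<tturnstile> (s \<^bold>= t)" "has_ty s \<sigma>" "has_ty t \<sigma>" "has_ty (subst_tm x s u) \<tau>"
    "vars_tm u \<subseteq> {x}"
  shows "\<Gamma> \<tturnstile> (subst_tm x s u \<^bold>= subst_tm x t u)"
proof -
  have "x \<notin> vars_tm (subst_tm x s u)"
    using assms(4) has_ty_closed by blast
  then show ?thesis
    using eq_subst[of \<Gamma> s t x "subst_tm x s u \<^bold>= u" \<sigma>] eq_refl[OF assms(4)] assms by auto
qed

text \<open>Turning a derivable biconditional into an equivalence at the meta level lets the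
  simplifier rewrite membership in comprehended sets and in zero sets.\<close>

lemma iff_forces: "\<Gamma> \<tturnstile> (p \<^bold>\<longleftrightarrow> q) \<Longrightarrow> \<Gamma> \<tturnstile> p \<longleftrightarrow> \<Gamma> \<tturnstile> q"
  by (blast intro: imp_elim and_elim1 and_elim2)

text \<open>Eliminating the existential of the axiom names the set by a parameter \<open>c\<close>,
  after which its defining formula is available at every typed term. The name \<open>''A''\<close>
  is excluded because the axiom binds it.\<close>

lemma comprehension_elim:
  assumes "vars p \<subseteq> {x}" "x \<noteq> ''A''"
    and "\<And>\<Delta> c. \<Gamma> |\<subseteq>| \<Delta> \<Longrightarrow>
      (\<And>t. has_ty t \<sigma> \<Longrightarrow> \<Delta> \<tturnstile> (t \<^bold>\<in> Par (TPow \<sigma>) c \<^bold>\<longleftrightarrow> subst x t p)) \<Longrightarrow> \<Delta> \<tturnstile> r"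
  shows "\<Gamma> \<tturnstile> r"
proof -
  have "\<Gamma> \<tturnstile> (\<^bold>\<exists>''A'' \<^bold>: TPow \<sigma>. \<^bold>\<forall>x \<^bold>: \<sigma>. (V x \<^bold>\<in> V ''A'' \<^bold>\<longleftrightarrow> p))"
    by (rule axiom) (simp add: IHOL_def set_axioms.comprehension assms)
  then show ?thesis
  proof (rule ex_elim, goal_cases)
    case (1 \<Delta> c)
    have "subst ''A'' (Par (TPow \<sigma>) c) p = p"
      using assms by (auto intro: subst_fresh)
    with 1 assms(2) have *: "\<Delta> \<tturnstile> (\<^bold>\<forall>x \<^bold>: \<sigma>. (V x \<^bold>\<in> Par (TPow \<sigma>) c \<^bold>\<longleftrightarrow> p))"
      by auto
    show ?case
      by (rule assms(3)[OF 1(1)]) (use all_elim[OF *] in auto)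
  qed
qed

text \<open>The induction axiom speaks of sets of numbers, so the induction formula is first made
  into a set by comprehension. Passing to an extension \<open>\<Delta>\<close> in the step supplies
  the induction hypothesis as something derivable rather than as an assumption to be
  discharged.\<close>

lemma nat_induct_forces:
  assumes p: "vars p \<subseteq> {x}" "x \<noteq> ''A''"
    and zero: "\<Gamma> \<tturnstile> subst x \<^bold>0\<^sub>N p"
    and suc: "\<And>\<Delta> c. \<Gamma> |\<subseteq>| \<Delta> \<Longrightarrow> \<Delta> \<tturnstile> subst x (Par \<^bold>N c) p \<Longrightarrow> \<Delta> \<tturnstile> subst x (Succ (Par \<^bold>N c)) p"
    and n: "has_ty n \<^bold>N"
  shows "\<Gamma> \<tturnstile> subst x n p"
proof (rule comprehension_elim[OF p, where \<sigma> = "\<^bold>N"], goal_cases)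
  case (1 \<Delta> c)
  let ?A = "Par (TPow \<^bold>N) c"
  note sub = 1(1) and iff = 1(2)
  note in_A = imp_elim[OF and_elim2[OF 1(2)]] and A_in = imp_elim[OF and_elim1[OF 1(2)]]
  have "\<Delta> \<tturnstile> (\<^bold>0\<^sub>N \<^bold>\<in> ?A \<^bold>\<and> (\<^bold>\<forall>''n'' \<^bold>: \<^bold>N. V ''n'' \<^bold>\<in> ?A \<^bold>\<longrightarrow> Succ (V ''n'') \<^bold>\<in> ?A))"
  proof (intro and_intro all_intro)
    show "\<Delta> \<tturnstile> (\<^bold>0\<^sub>N \<^bold>\<in> ?A)"
      by (rule in_A[OF _ mono[OF zero 1(1)]]) (rule has_ty.intros)
    show "\<Delta> \<tturnstile> subst ''n'' (Par \<^bold>N k) (V ''n'' \<^bold>\<in> ?A \<^bold>\<longrightarrow> Succ (V ''n'') \<^bold>\<in> ?A)" for k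
    proof (simp, rule imp_intro, goal_cases)
      case (1 \<Delta>')
      note iff' = mono[OF iff 1(1)]
      have "\<Delta>' \<tturnstile> subst x (Par \<^bold>N k) p"
        by (rule imp_elim[OF and_elim1[OF iff'] 1(2)]) (rule has_ty.intros)
      with sub 1(1) have "\<Delta>' \<tturnstile> subst x (Succ (Par \<^bold>N k)) p"
        by (intro suc) auto
      then show ?case
        by (rule imp_elim[OF and_elim2[OF iff'], rotated]) (intro has_ty.intros)
    qed
  qed
  moreover have "\<Delta> \<tturnstile> (\<^bold>\<forall>''A'' \<^bold>: TPow \<^bold>N. \<^bold>0\<^sub>N \<^bold>\<in> V ''A'' \<^bold>\<and>
        (\<^bold>\<forall>''n'' \<^bold>: \<^bold>N. V ''n'' \<^bold>\<in> V ''A'' \<^bold>\<longrightarrow> Succ (V ''n'') \<^bold>\<in> V ''A'') \<^bold>\<longrightarrow>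
        (\<^bold>\<forall>''n'' \<^bold>: \<^bold>N. V ''n'' \<^bold>\<in> V ''A''))"
    by (rule axiom) (simp add: IHOL_def nat_axioms_def)
  note all_elim[OF this has_ty.intros(1)[of _ c]]
  ultimately have "\<Delta> \<tturnstile> (\<^bold>\<forall>''n'' \<^bold>: \<^bold>N. V ''n'' \<^bold>\<in> ?A)"
    by (auto intro: imp_elim)
  from all_elim[OF this n] have "\<Delta> \<tturnstile> (n \<^bold>\<in> ?A)"
    by simp
  then show ?case
    by (rule A_in[OF n])
qed

section \<open>Arithmetic of the real line\<close>

lemmas has_ty_simps [simp] = has_ty.intros(1-10)

text \<open>The typing rules for application and projection have a type in the premise that the
  conclusion does not determine. For simplification they are stated only for terms headed by a
  parameter, which carries its type.\<close>

lemma has_ty_App_Par [simp]: "has_ty t \<sigma> \<Longrightarrow> has_ty (Par (\<sigma> \<^bold>\<rightarrow> \<tau>) c \<^bold>\<cdot> t) \<tau>"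
  by (rule has_ty.intros(13)[OF has_ty.intros(1)])

lemma has_ty_Proj_Par [simp]:
  "has_ty (Proj1 (Par (\<sigma> \<^bold>\<times> \<tau>) c)) \<sigma>" "has_ty (Proj2 (Par (\<sigma> \<^bold>\<times> \<tau>) c)) \<tau>"
  by (rule has_ty.intros(11,12), rule has_ty.intros(1))+

lemma has_ty_Proj_App_Par [simp]:
  "has_ty t \<rho> \<Longrightarrow> has_ty (Proj1 (Par (\<rho> \<^bold>\<rightarrow> \<sigma> \<^bold>\<times> \<tau>) c \<^bold>\<cdot> t)) \<sigma>"
  "has_ty t \<rho> \<Longrightarrow> has_ty (Proj2 (Par (\<rho> \<^bold>\<rightarrow> \<sigma> \<^bold>\<times> \<tau>) c \<^bold>\<cdot> t)) \<tau>"
  by (rule has_ty.intros(11,12), erule has_ty_App_Par)+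

abbreviation real_tm :: "tm \<Rightarrow> bool" where
  "real_tm t \<equiv> has_ty t \<^bold>R"

section \<open>The axioms of the real line as rules for closed terms\<close>

lemma real_axiom: "p \<in> real_axioms \<Longrightarrow> \<Gamma> \<tturnstile> p"
  by (rule axiom) (simp add: IHOL_def)

lemma add_assoc: "real_tm x \<Longrightarrow> real_tm y \<Longrightarrow> real_tm z \<Longrightarrow> \<Gamma> \<tturnstile> ((x \<^bold>+ y) \<^bold>+ z \<^bold>= x \<^bold>+ (y \<^bold>+ z))"
  using all_elim3[OF real_axiom, of "''x''" "\<^bold>R" "''y''" "\<^bold>R" "''z''" "\<^bold>R"
    "(V ''x'' \<^bold>+ V ''y'') \<^bold>+ V ''z'' \<^bold>= V ''x'' \<^bold>+ (V ''y'' \<^bold>+ V ''z'')" x y z]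
  by (simp add: real_axioms_def has_ty_closed)

lemma add_commute: "real_tm x \<Longrightarrow> real_tm y \<Longrightarrow> \<Gamma> \<tturnstile> (x \<^bold>+ y \<^bold>= y \<^bold>+ x)"
  using all_elim2[OF real_axiom, of "''x''" "\<^bold>R" "''y''" "\<^bold>R"
    "V ''x'' \<^bold>+ V ''y'' \<^bold>= V ''y'' \<^bold>+ V ''x''" x y]
  by (simp add: real_axioms_def has_ty_closed)

lemma add_zero: "real_tm x \<Longrightarrow> \<Gamma> \<tturnstile> (x \<^bold>+ \<^bold>0 \<^bold>= x)"
  using all_elim[OF real_axiom, of "''x''" "\<^bold>R" "V ''x'' \<^bold>+ \<^bold>0 \<^bold>= V ''x''" x]
  by (simp add: real_axioms_def has_ty_closed)

lemma add_neg: "real_tm x \<Longrightarrow> \<Gamma> \<tturnstile> (x \<^bold>+ RNeg x \<^bold>= \<^bold>0)"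
  using all_elim[OF real_axiom, of "''x''" "\<^bold>R" "V ''x'' \<^bold>+ RNeg (V ''x'') \<^bold>= \<^bold>0" x]
  by (simp add: real_axioms_def has_ty_closed)

lemma mult_assoc: "real_tm x \<Longrightarrow> real_tm y \<Longrightarrow> real_tm z \<Longrightarrow> \<Gamma> \<tturnstile> ((x \<^bold>* y) \<^bold>* z \<^bold>= x \<^bold>* (y \<^bold>* z))"
  using all_elim3[OF real_axiom, of "''x''" "\<^bold>R" "''y''" "\<^bold>R" "''z''" "\<^bold>R"
    "(V ''x'' \<^bold>* V ''y'') \<^bold>* V ''z'' \<^bold>= V ''x'' \<^bold>* (V ''y'' \<^bold>* V ''z'')" x y z]
  by (simp add: real_axioms_def has_ty_closed)

lemma mult_commute: "real_tm x \<Longrightarrow> real_tm y \<Longrightarrow> \<Gamma> \<tturnstile> (x \<^bold>* y \<^bold>= y \<^bold>* x)"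
  using all_elim2[OF real_axiom, of "''x''" "\<^bold>R" "''y''" "\<^bold>R"
    "V ''x'' \<^bold>* V ''y'' \<^bold>= V ''y'' \<^bold>* V ''x''" x y]
  by (simp add: real_axioms_def has_ty_closed)

lemma mult_one: "real_tm x \<Longrightarrow> \<Gamma> \<tturnstile> (x \<^bold>* \<^bold>1 \<^bold>= x)"
  using all_elim[OF real_axiom, of "''x''" "\<^bold>R" "V ''x'' \<^bold>* \<^bold>1 \<^bold>= V ''x''" x]
  by (simp add: real_axioms_def has_ty_closed)

lemma distrib: "real_tm x \<Longrightarrow> real_tm y \<Longrightarrow> real_tm z \<Longrightarrow> \<Gamma> \<tturnstile> (x \<^bold>* (y \<^bold>+ z) \<^bold>= x \<^bold>* y \<^bold>+ x \<^bold>* z)"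
  using all_elim3[OF real_axiom, of "''x''" "\<^bold>R" "''y''" "\<^bold>R" "''z''" "\<^bold>R"
    "V ''x'' \<^bold>* (V ''y'' \<^bold>+ V ''z'') \<^bold>= V ''x'' \<^bold>* V ''y'' \<^bold>+ V ''x'' \<^bold>* V ''z''" x y z]
  by (simp add: real_axioms_def has_ty_closed)

lemma inverse_exists: "real_tm x \<Longrightarrow> \<Gamma> \<tturnstile> (\<^bold>0 \<^bold>< x) \<Longrightarrow> \<Gamma> \<tturnstile> (\<^bold>\<exists>''y'' \<^bold>: \<^bold>R. x \<^bold>* V ''y'' \<^bold>= \<^bold>1)"
  using all_elim[OF real_axiom, of "''x''" "\<^bold>R"
    "V ''x'' \<^bold>< \<^bold>0 \<^bold>\<or> \<^bold>0 \<^bold>< V ''x'' \<^bold>\<longrightarrow> (\<^bold>\<exists>''y'' \<^bold>: \<^bold>R. V ''x'' \<^bold>* V ''y'' \<^bold>= \<^bold>1)" x \<Gamma>]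
  by (auto simp: real_axioms_def has_ty_closed intro: imp_elim or_intro2)

lemma zero_less_one: "\<Gamma> \<tturnstile> (\<^bold>0 \<^bold>< \<^bold>1)"
  by (rule real_axiom) (simp add: real_axioms_def)

lemma less_asym: "real_tm x \<Longrightarrow> real_tm y \<Longrightarrow> \<Gamma> \<tturnstile> (x \<^bold>< y) \<Longrightarrow> \<Gamma> \<tturnstile> (y \<^bold>< x) \<Longrightarrow> \<Gamma> \<tturnstile> \<^bold>\<bottom>"
  using all_elim2[OF real_axiom, of "''x''" "\<^bold>R" "''y''" "\<^bold>R"
    "\<^bold>\<not> (V ''x'' \<^bold>< V ''y'' \<^bold>\<and> V ''y'' \<^bold>< V ''x'')" x y \<Gamma>]
  by (auto simp: real_axioms_def has_ty_closed intro: imp_elim and_intro)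

text \<open>This is the constructive substitute for trichotomy: an unknown \<open>z\<close> can be
  compared with two reals as soon as these are strictly separated. All case distinctions on reals
  below rest on it.\<close>

lemma less_cotrans:
  "real_tm x \<Longrightarrow> real_tm y \<Longrightarrow> real_tm z \<Longrightarrow> \<Gamma> \<tturnstile> (x \<^bold>< y) \<Longrightarrow> \<Gamma> \<tturnstile> (x \<^bold>< z \<^bold>\<or> z \<^bold>< y)"
  using imp_elim[OF all_elim2[OF real_axiom, of "''x''" "\<^bold>R" "''y''" "\<^bold>R"
    "V ''x'' \<^bold>< V ''y'' \<^bold>\<longrightarrow> (\<^bold>\<forall>''z'' \<^bold>: \<^bold>R. V ''x'' \<^bold>< V ''z'' \<^bold>\<or> V ''z'' \<^bold>< V ''y'')" x y \<Gamma>, simplified]]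
    all_elim[of \<Gamma> "''z''" "\<^bold>R" "x \<^bold>< V ''z'' \<^bold>\<or> V ''z'' \<^bold>< y" z]
  by (simp add: real_axioms_def has_ty_closed)

lemma le_antisym: "real_tm x \<Longrightarrow> real_tm y \<Longrightarrow> \<Gamma> \<tturnstile> (x \<^bold>\<le> y) \<Longrightarrow> \<Gamma> \<tturnstile> (y \<^bold>\<le> x) \<Longrightarrow> \<Gamma> \<tturnstile> (x \<^bold>= y)"
  using all_elim2[OF real_axiom, of "''x''" "\<^bold>R" "''y''" "\<^bold>R"
    "V ''x'' \<^bold>\<le> V ''y'' \<^bold>\<and> V ''y'' \<^bold>\<le> V ''x'' \<^bold>\<longrightarrow> V ''x'' \<^bold>= V ''y''" x y \<Gamma>]
  by (auto simp: real_axioms_def has_ty_closed intro: imp_elim and_intro)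

lemma add_less_right:
  "real_tm x \<Longrightarrow> real_tm y \<Longrightarrow> real_tm z \<Longrightarrow> \<Gamma> \<tturnstile> (x \<^bold>< y) \<Longrightarrow> \<Gamma> \<tturnstile> (x \<^bold>+ z \<^bold>< y \<^bold>+ z)"
  using imp_elim[OF all_elim2[OF real_axiom, of "''x''" "\<^bold>R" "''y''" "\<^bold>R"
    "V ''x'' \<^bold>< V ''y'' \<^bold>\<longrightarrow> (\<^bold>\<forall>''z'' \<^bold>: \<^bold>R. V ''x'' \<^bold>+ V ''z'' \<^bold>< V ''y'' \<^bold>+ V ''z'')" x y \<Gamma>, simplified]]
    all_elim[of \<Gamma> "''z''" "\<^bold>R" "x \<^bold>+ V ''z'' \<^bold>< y \<^bold>+ V ''z''" z]
  by (simp add: real_axioms_def has_ty_closed)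

lemma mult_pos:
  "real_tm x \<Longrightarrow> real_tm y \<Longrightarrow> \<Gamma> \<tturnstile> (\<^bold>0 \<^bold>< x) \<Longrightarrow> \<Gamma> \<tturnstile> (\<^bold>0 \<^bold>< y) \<Longrightarrow> \<Gamma> \<tturnstile> (\<^bold>0 \<^bold>< x \<^bold>* y)"
  using all_elim2[OF real_axiom, of "''x''" "\<^bold>R" "''y''" "\<^bold>R"
    "\<^bold>0 \<^bold>< V ''x'' \<^bold>\<and> \<^bold>0 \<^bold>< V ''y'' \<^bold>\<longrightarrow> \<^bold>0 \<^bold>< V ''x'' \<^bold>* V ''y''" x y \<Gamma>]
  by (auto simp: real_axioms_def has_ty_closed intro: imp_elim and_intro)

lemma OfNat_zero: "\<Gamma> \<tturnstile> (OfNat \<^bold>0\<^sub>N \<^bold>= \<^bold>0)"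
  by (rule real_axiom) (simp add: real_axioms_def)

lemma OfNat_Succ: "has_ty n \<^bold>N \<Longrightarrow> \<Gamma> \<tturnstile> (OfNat (Succ n) \<^bold>= OfNat n \<^bold>+ \<^bold>1)"
  using all_elim[OF real_axiom, of "''n''" "\<^bold>N" "OfNat (Succ (V ''n'')) \<^bold>= OfNat (V ''n'') \<^bold>+ \<^bold>1" n]
  by (simp add: real_axioms_def has_ty_closed)

lemma archimedean: "real_tm x \<Longrightarrow> \<Gamma> \<tturnstile> (\<^bold>\<exists>''n'' \<^bold>: \<^bold>N. x \<^bold>< OfNat (V ''n''))"
  using all_elim[OF real_axiom, of "''x''" "\<^bold>R" "\<^bold>\<exists>''n'' \<^bold>: \<^bold>N. V ''x'' \<^bold>< OfNat (V ''n'')" x]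
  by (simp add: real_axioms_def has_ty_closed)

text \<open>Derivability is required in the empty context so that an identity can be weakened to any
  context. The typing conditions make the relation partial, since untypable terms are related to
  nothing.\<close>

definition real_eq :: "tm \<Rightarrow> tm \<Rightarrow> bool" where
  "real_eq s t \<longleftrightarrow> real_tm s \<and> real_tm t \<and> {||} \<tturnstile> (s \<^bold>= t)"

lemma real_eqI: "real_tm s \<Longrightarrow> real_tm t \<Longrightarrow> {||} \<tturnstile> (s \<^bold>= t) \<Longrightarrow> real_eq s t"
  by (simp add: real_eq_def)

lemma part_equivp_real_eq: "part_equivp real_eq"
proof (rule part_equivpI)
  show "\<exists>x. real_eq x x"
    by (rule exI[of _ "\<^bold>0"]) (auto simp: real_eq_def intro: eq_refl[of _ "\<^bold>R"])
  show "symp real_eq"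
    by (auto simp: real_eq_def intro: eq_sym intro!: sympI)
  show "transp real_eq"
    by (auto simp: real_eq_def intro: eq_trans intro!: transpI)
qed

text \<open>Closed real terms modulo provable equality form a commutative ring, so that ring identities
  between terms can be left to the simplifier.  The class of rings with a unit is not available, as
  it would require \<open>0 \<noteq> 1\<close>, that is, consistency.\<close>

quotient_type rterm = tm / partial: real_eq
  by (rule part_equivp_real_eq)

instantiation rterm :: "{comm_ring, one}"
begin

lift_definition zero_rterm :: rterm is "\<^bold>0"
  by (auto simp: real_eq_def intro: eq_refl[of _ "\<^bold>R"])

lift_definition one_rterm :: rterm is "\<^bold>1"
  by (auto simp: real_eq_def intro: eq_refl[of _ "\<^bold>R"])

lift_definition uminus_rterm :: "rterm \<Rightarrow> rterm" is RNeg
  unfolding real_eq_def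
  using eq_cong[where x = "''x''" and u = "RNeg (V ''x'')" and \<sigma> = "\<^bold>R" and \<tau> = "\<^bold>R"] by auto

lift_definition plus_rterm :: "rterm \<Rightarrow> rterm \<Rightarrow> rterm" is RAdd
proof -
  fix s s' t t' assume "real_eq s s'" "real_eq t t'"
  then show "real_eq (s \<^bold>+ t) (s' \<^bold>+ t')"
    unfolding real_eq_def
    using eq_trans[of "{||}" "s \<^bold>+ t" "s' \<^bold>+ t" "s' \<^bold>+ t'" "\<^bold>R"]
      eq_cong[where x = "''x''" and u = "V ''x'' \<^bold>+ t" and \<sigma> = "\<^bold>R" and \<tau> = "\<^bold>R"]
      eq_cong[where x = "''x''" and u = "s' \<^bold>+ V ''x''" and \<sigma> = "\<^bold>R" and \<tau> = "\<^bold>R"] by (auto simp: has_ty_closed)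
qed

lift_definition times_rterm :: "rterm \<Rightarrow> rterm \<Rightarrow> rterm" is RMul
proof -
  fix s s' t t' assume "real_eq s s'" "real_eq t t'"
  then show "real_eq (s \<^bold>* t) (s' \<^bold>* t')"
    unfolding real_eq_def
    using eq_trans[of "{||}" "s \<^bold>* t" "s' \<^bold>* t" "s' \<^bold>* t'" "\<^bold>R"]
      eq_cong[where x = "''x''" and u = "V ''x'' \<^bold>* t" and \<sigma> = "\<^bold>R" and \<tau> = "\<^bold>R"]
      eq_cong[where x = "''x''" and u = "s' \<^bold>* V ''x''" and \<sigma> = "\<^bold>R" and \<tau> = "\<^bold>R"] by (auto simp: has_ty_closed)
qed

definition minus_rterm :: "rterm \<Rightarrow> rterm \<Rightarrow> rterm" where
  "minus_rterm a b = a + - b"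

instance
proof
  fix a b c :: rterm
  show "a + b + c = a + (b + c)"
    by transfer (auto intro!: real_eqI add_assoc simp: real_eq_def)
  show comm: "a + b = b + a" for a b :: rterm
    by transfer (auto intro!: real_eqI add_commute simp: real_eq_def)
  have "a + 0 = a"
    by transfer (auto intro!: real_eqI add_zero simp: real_eq_def)
  then show "0 + a = a"
    by (simp add: comm)
  have "a + - a = 0"
    by transfer (auto intro!: real_eqI add_neg simp: real_eq_def)
  then show "- a + a = 0"
    by (simp add: comm)
  show "a - b = a + - b"
    by (simp add: minus_rterm_def)
  show "a * b * c = a * (b * c)"
    by transfer (auto intro!: real_eqI mult_assoc simp: real_eq_def)
  show comm': "a * b = b * a" for a b :: rterm
    by transfer (auto intro!: real_eqI mult_commute simp: real_eq_def)
  have "c * (a + b) = c * a + c * b"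
    by transfer (auto intro!: real_eqI distrib simp: real_eq_def)
  then show "(a + b) * c = a * c + b * c"
    by (simp add: comm')
qed

end

lemma rterm_mult_one [simp]: "a * 1 = a" "1 * a = a" for a :: rterm
proof -
  show *: "a * 1 = a"
    by transfer (auto intro!: real_eqI mult_one simp: real_eq_def)
  show "1 * a = a"
    unfolding mult.commute[of 1] by (rule *)
qed

lemma real_eq_refl: "real_tm t \<Longrightarrow> real_eq t t"
  by (simp add: real_eq_def eq_refl)

lemma abs_rterm_simps [simp]:
  "abs_rterm \<^bold>0 = 0" "abs_rterm \<^bold>1 = 1"
  "real_tm s \<Longrightarrow> abs_rterm (RNeg s) = - abs_rterm s"
  "real_tm s \<Longrightarrow> real_tm t \<Longrightarrow> abs_rterm (s \<^bold>+ t) = abs_rterm s + abs_rterm t"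
  "real_tm s \<Longrightarrow> real_tm t \<Longrightarrow> abs_rterm (s \<^bold>* t) = abs_rterm s * abs_rterm t"
  by (simp_all add: zero_rterm_def one_rterm_def uminus_rterm.abs_eq plus_rterm.abs_eq
      times_rterm.abs_eq real_eq_refl)

text \<open>The way back from the quotient: an identity checked there by ring simplification is a
  derivable equation. Distances, radii and parameters act as indeterminates under
  \<open>abs_rterm\<close>.\<close>

lemma ring_eq:
  assumes "abs_rterm s = abs_rterm t" "real_tm s" "real_tm t"
  shows "\<Gamma> \<tturnstile> (s \<^bold>= t)"
proof -
  have "real_eq s t"
    using assms Quotient3_rel[OF Quotient3_rterm, of s t] by (simp add: real_eq_refl)
  then show ?thesis
    by (auto simp: real_eq_def intro: mono)
qed

section \<open>Order reasoning and halving\<close>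

lemma less_subst:
  assumes "\<Gamma> \<tturnstile> (a \<^bold>< b)" "\<Gamma> \<tturnstile> (a \<^bold>= s)" "\<Gamma> \<tturnstile> (b \<^bold>= t)" "real_tm a" "real_tm b" "real_tm s" "real_tm t"
  shows "\<Gamma> \<tturnstile> (s \<^bold>< t)"
  using eq_subst[of \<Gamma> a s "''x''" "V ''x'' \<^bold>< b" "\<^bold>R"] eq_subst[of \<Gamma> b t "''x''" "s \<^bold>< V ''x''" "\<^bold>R"]
    assms by (simp add: has_ty_closed)

text \<open>The ring equation says that \<open>t - s\<close> and \<open>b - a\<close> coincide, so
  both inequalities express positivity of the same difference. A linear inequality is thus proved by
  adding known inequalities and leaving the rearrangement to the ring.\<close>

lemma less_shift:
  assumes "\<Gamma> \<tturnstile> (a \<^bold>< b)" "abs_rterm s + abs_rterm b = abs_rterm t + abs_rterm a"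
    "real_tm a" "real_tm b" "real_tm s" "real_tm t"
  shows "\<Gamma> \<tturnstile> (s \<^bold>< t)"
proof (rule less_subst)
  \<comment> \<open>Adding \<open>s - a\<close> to both sides turns \<open>a\<close> into
    \<open>s\<close> and \<open>b\<close> into \<open>t\<close>.\<close>
  show "\<Gamma> \<tturnstile> (a \<^bold>+ (s \<^bold>+ RNeg a) \<^bold>< b \<^bold>+ (s \<^bold>+ RNeg a))"
    by (rule add_less_right) (use assms in auto)
  show "\<Gamma> \<tturnstile> (b \<^bold>+ (s \<^bold>+ RNeg a) \<^bold>= t)"
    by (rule ring_eq) (use assms in \<open>auto simp: algebra_simps\<close>)
qed (use assms in \<open>auto intro!: ring_eq\<close>)

lemma le_shift:
  assumes "\<Gamma> \<tturnstile> (a \<^bold>\<le> b)" "abs_rterm s + abs_rterm b = abs_rterm t + abs_rterm a"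
    "real_tm a" "real_tm b" "real_tm s" "real_tm t"
  shows "\<Gamma> \<tturnstile> (s \<^bold>\<le> t)"
proof (rule imp_intro, goal_cases)
  case (1 \<Delta>)
  have "\<Delta> \<tturnstile> (b \<^bold>< a)"
    by (rule less_shift[OF 1(2)]) (use assms in \<open>auto simp: algebra_simps\<close>)
  with mono[OF assms(1) 1(1)] show ?case
    by (rule imp_elim)
qed

lemma less_irrefl: "\<Gamma> \<tturnstile> (a \<^bold>< a) \<Longrightarrow> real_tm a \<Longrightarrow> \<Gamma> \<tturnstile> \<^bold>\<bottom>"
  using less_asym by blast

lemma less_imp_le:
  assumes "\<Gamma> \<tturnstile> (a \<^bold>< b)" "real_tm a" "real_tm b"
  shows "\<Gamma> \<tturnstile> (a \<^bold>\<le> b)"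
  using assms by (auto intro: imp_intro less_asym mono)

lemma le_less_contradiction:
  "\<Gamma> \<tturnstile> (a \<^bold>\<le> b) \<Longrightarrow> \<Gamma> \<tturnstile> (b \<^bold>< a) \<Longrightarrow> \<Gamma> \<tturnstile> \<^bold>\<bottom>"
  by (rule imp_elim)

text \<open>As \<open>a \<le> b\<close> is only a negation, the strict inequality has to come from
  \<open>b < c\<close>: comparing \<open>a\<close> with that pair gives \<open>b < a\<close>, which
  is excluded, or \<open>a < c\<close>.\<close>

lemma le_less_trans:
  assumes "\<Gamma> \<tturnstile> (a \<^bold>\<le> b)" "\<Gamma> \<tturnstile> (b \<^bold>< c)" "real_tm a" "real_tm b" "real_tm c"
  shows "\<Gamma> \<tturnstile> (a \<^bold>< c)"
  by (rule or_elim[OF less_cotrans[OF assms(4,5,3,2)]])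
    (use assms(1) in \<open>blast intro: bot_elim[OF le_less_contradiction] mono\<close>)+

lemma less_le_trans:
  assumes "\<Gamma> \<tturnstile> (a \<^bold>< b)" "\<Gamma> \<tturnstile> (b \<^bold>\<le> c)" "real_tm a" "real_tm b" "real_tm c"
  shows "\<Gamma> \<tturnstile> (a \<^bold>< c)"
  by (rule or_elim[OF less_cotrans[OF assms(3,4,5,1)]])
    (use assms(2) in \<open>blast intro: bot_elim[OF le_less_contradiction] mono\<close>)+

lemma less_trans:
  assumes "\<Gamma> \<tturnstile> (a \<^bold>< b)" "\<Gamma> \<tturnstile> (b \<^bold>< c)" "real_tm a" "real_tm b" "real_tm c"
  shows "\<Gamma> \<tturnstile> (a \<^bold>< c)"
  using assms by (auto intro: le_less_trans less_imp_le)

lemma le_trans: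
  assumes "\<Gamma> \<tturnstile> (a \<^bold>\<le> b)" "\<Gamma> \<tturnstile> (b \<^bold>\<le> c)" "real_tm a" "real_tm b" "real_tm c"
  shows "\<Gamma> \<tturnstile> (a \<^bold>\<le> c)"
proof (rule imp_intro, goal_cases)
  case (1 \<Delta>)
  have "\<Delta> \<tturnstile> (b \<^bold>< a)"
    by (rule le_less_trans[OF mono[OF assms(2) 1(1)] 1(2)]) (use assms in auto)
  with mono[OF assms(1) 1(1)] show ?case
    by (rule imp_elim)
qed

lemma add_less_mono:
  assumes "\<Gamma> \<tturnstile> (a \<^bold>< b)" "\<Gamma> \<tturnstile> (c \<^bold>< d)" "real_tm a" "real_tm b" "real_tm c" "real_tm d"
  shows "\<Gamma> \<tturnstile> (a \<^bold>+ c \<^bold>< b \<^bold>+ d)"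
  by (rule less_trans[OF add_less_right[OF assms(3,4,5,1)] less_shift[OF assms(2)]])
    (use assms in \<open>auto simp: algebra_simps\<close>)

lemma add_le_less_mono:
  assumes "\<Gamma> \<tturnstile> (a \<^bold>\<le> b)" "\<Gamma> \<tturnstile> (c \<^bold>< d)" "real_tm a" "real_tm b" "real_tm c" "real_tm d"
  shows "\<Gamma> \<tturnstile> (a \<^bold>+ c \<^bold>< b \<^bold>+ d)"
  by (rule le_less_trans[OF le_shift[OF assms(1), of "a \<^bold>+ c" "b \<^bold>+ c"] less_shift[OF assms(2)]])
    (use assms in \<open>auto simp: algebra_simps\<close>)

lemma add_le_mono:
  assumes "\<Gamma> \<tturnstile> (a \<^bold>\<le> b)" "\<Gamma> \<tturnstile> (c \<^bold>\<le> d)" "real_tm a" "real_tm b" "real_tm c" "real_tm d"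
  shows "\<Gamma> \<tturnstile> (a \<^bold>+ c \<^bold>\<le> b \<^bold>+ d)"
  by (rule le_trans[OF le_shift[OF assms(1), of "a \<^bold>+ c" "b \<^bold>+ c"] le_shift[OF assms(2)]])
    (use assms in \<open>auto simp: algebra_simps\<close>)

lemma eq_le:
  assumes "\<Gamma> \<tturnstile> (a \<^bold>= b)" "real_tm a" "real_tm b"
  shows "\<Gamma> \<tturnstile> (a \<^bold>\<le> b)"
proof -
  have "\<Gamma> \<tturnstile> (a \<^bold>\<le> a)"
    using assms(2) by (auto intro: imp_intro less_irrefl)
  then show ?thesis
    using eq_subst[of \<Gamma> a b "''x''" "a \<^bold>\<le> V ''x''" "\<^bold>R"] assms by (simp add: has_ty_closed)
qed

lemma eq_ge:
  assumes "\<Gamma> \<tturnstile> (a \<^bold>= b)" "real_tm a" "real_tm b"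
  shows "\<Gamma> \<tturnstile> (b \<^bold>\<le> a)"
  using assms by (auto intro: eq_le eq_sym)

text \<open>Terms contain no division, so a half is only a witness of an existential:
  \<open>a\<close> times an inverse of \<open>1 + 1\<close>, which exists because
  \<open>1 + 1\<close> is positive.\<close>

lemma half_exists:
  assumes a: "real_tm a"
  shows "\<Gamma> \<tturnstile> (\<^bold>\<exists>''h'' \<^bold>: \<^bold>R. V ''h'' \<^bold>+ V ''h'' \<^bold>= a)"
proof -
  have "\<Gamma> \<tturnstile> (\<^bold>0 \<^bold>< \<^bold>1 \<^bold>+ \<^bold>1)"
    by (rule less_shift[OF add_less_mono[OF zero_less_one zero_less_one]])
      (simp_all add: algebra_simps)
  then have "\<Gamma> \<tturnstile> (\<^bold>\<exists>''y'' \<^bold>: \<^bold>R. (\<^bold>1 \<^bold>+ \<^bold>1) \<^bold>* V ''y'' \<^bold>= \<^bold>1)"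
    by (intro inverse_exists) auto
  then show ?thesis
  proof (rule ex_elim, goal_cases)
    case (1 \<Delta> c)
    let ?y = "Par \<^bold>R c"
    have "\<Delta> \<tturnstile> (a \<^bold>* ?y \<^bold>+ a \<^bold>* ?y \<^bold>= a \<^bold>* ((\<^bold>1 \<^bold>+ \<^bold>1) \<^bold>* ?y))"
      by (rule ring_eq) (use a in \<open>auto simp: algebra_simps\<close>)
    moreover have "\<Delta> \<tturnstile> (a \<^bold>* ((\<^bold>1 \<^bold>+ \<^bold>1) \<^bold>* ?y) \<^bold>= a \<^bold>* \<^bold>1)"
      using eq_cong[of \<Delta> "(\<^bold>1 \<^bold>+ \<^bold>1) \<^bold>* ?y" "\<^bold>1" "\<^bold>R" "''x''" "a \<^bold>* V ''x''" "\<^bold>R"] 1 a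
      by (simp add: has_ty_closed)
    ultimately have "\<Delta> \<tturnstile> (a \<^bold>* ?y \<^bold>+ a \<^bold>* ?y \<^bold>= a \<^bold>* \<^bold>1)"
      by (rule eq_trans[where \<sigma> = "\<^bold>R"]) (use a in auto)
    then have "\<Delta> \<tturnstile> (a \<^bold>* ?y \<^bold>+ a \<^bold>* ?y \<^bold>= a)"
      by (rule eq_trans[OF _ mult_one[OF a], where \<sigma> = "\<^bold>R"]) (use a in auto)
    then show ?case
      using a by (intro ex_intro[of "a \<^bold>* ?y"]) (simp_all add: has_ty_closed)
  qed
qed

text \<open>Comparing \<open>h\<close> with the pair \<open>0 < a\<close> gives either the claim or
  \<open>h < a\<close>; in the second case \<open>h < h + h\<close>, and subtracting
  \<open>h\<close> gives the claim again.\<close>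

lemma half_pos:
  assumes "\<Gamma> \<tturnstile> (h \<^bold>+ h \<^bold>= a)" "\<Gamma> \<tturnstile> (\<^bold>0 \<^bold>< a)" "real_tm h" "real_tm a"
  shows "\<Gamma> \<tturnstile> (\<^bold>0 \<^bold>< h)"
proof (rule or_elim[OF less_cotrans[OF _ _ assms(3) assms(2)]], goal_cases)
  case (4 \<Delta>)
  have "\<Delta> \<tturnstile> (h \<^bold>< h \<^bold>+ h)"
    by (rule less_le_trans[OF 4(2) mono[OF eq_ge[OF assms(1)] 4(1)]]) (use assms in auto)
  then show ?case
    by (rule less_shift) (use assms in \<open>auto simp: algebra_simps\<close>)
qed (use assms in auto)

section \<open>Natural numbers and pairs\<close>

lemma less_zero: "has_ty k \<^bold>N \<Longrightarrow> \<Gamma> \<tturnstile> (k \<^bold><\<^sub>N \<^bold>0\<^sub>N) \<Longrightarrow> \<Gamma> \<tturnstile> \<^bold>\<bottom>"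
  using all_elim[OF axiom, of "''k''" "\<^bold>N" "\<^bold>\<not> (V ''k'' \<^bold><\<^sub>N \<^bold>0\<^sub>N)" k \<Gamma>]
  by (auto simp: IHOL_def nat_axioms_def has_ty_closed intro: imp_elim)

lemma less_Succ_iff:
  "has_ty k \<^bold>N \<Longrightarrow> has_ty n \<^bold>N \<Longrightarrow> \<Gamma> \<tturnstile> (k \<^bold><\<^sub>N Succ n \<^bold>\<longleftrightarrow> k \<^bold><\<^sub>N n \<^bold>\<or> k \<^bold>= n)"
  using all_elim2[OF axiom, of "''k''" "\<^bold>N" "''n''" "\<^bold>N"
    "V ''k'' \<^bold><\<^sub>N Succ (V ''n'') \<^bold>\<longleftrightarrow> V ''k'' \<^bold><\<^sub>N V ''n'' \<^bold>\<or> V ''k'' \<^bold>= V ''n''" k n \<Gamma>]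
  by (auto simp: IHOL_def nat_axioms_def has_ty_closed)

lemma less_Succ_self: "has_ty n \<^bold>N \<Longrightarrow> \<Gamma> \<tturnstile> (n \<^bold><\<^sub>N Succ n)"
  by (rule imp_elim[OF and_elim2[OF less_Succ_iff]]) (auto intro: or_intro2 eq_refl)

lemma less_Succ_cases:
  assumes "\<Gamma> \<tturnstile> (k \<^bold><\<^sub>N Succ n)" "has_ty k \<^bold>N" "has_ty n \<^bold>N"
  shows "\<Gamma> \<tturnstile> (k \<^bold><\<^sub>N n \<^bold>\<or> k \<^bold>= n)"
  by (rule imp_elim[OF and_elim1[OF less_Succ_iff] assms(1)]) (use assms in auto)

lemma less_Succ_mono:
  assumes "\<Gamma> \<tturnstile> (k \<^bold><\<^sub>N n)" "has_ty k \<^bold>N" "has_ty n \<^bold>N"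
  shows "\<Gamma> \<tturnstile> (k \<^bold><\<^sub>N Succ n)"
  by (rule imp_elim[OF and_elim2[OF less_Succ_iff]]) (use assms in \<open>auto intro: or_intro1\<close>)

lemma proj1_pair: "has_ty s \<sigma> \<Longrightarrow> has_ty t \<tau> \<Longrightarrow> \<Gamma> \<tturnstile> (Proj1 \<langle>s, t\<rangle> \<^bold>= s)"
  using all_elim2[OF axiom, of "''x''" \<sigma> "''y''" \<tau> "Proj1 \<langle>V ''x'', V ''y''\<rangle> \<^bold>= V ''x''" s t \<Gamma>]
  by (simp add: IHOL_def set_axioms.intros has_ty_closed)

lemma proj2_pair: "has_ty s \<sigma> \<Longrightarrow> has_ty t \<tau> \<Longrightarrow> \<Gamma> \<tturnstile> (Proj2 \<langle>s, t\<rangle> \<^bold>= t)"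
  using all_elim2[OF axiom, of "''x''" \<sigma> "''y''" \<tau> "Proj2 \<langle>V ''x'', V ''y''\<rangle> \<^bold>= V ''y''" s t \<Gamma>]
  by (simp add: IHOL_def set_axioms.intros has_ty_closed)

text \<open>A set of pairs obtained by comprehension describes its elements through
  \<open>Proj1\<close> and \<open>Proj2\<close>, which compute on an explicit pair only up to
  derivable equality. Leibniz substitution rewrites the outermost substitution, so the two
  substitutions are swapped between the two rewrites; closedness permits the swap.\<close>

lemma subst_proj_pair_iff:
  assumes s: "has_ty s \<sigma>" and t: "has_ty t \<tau>" and uv: "u \<noteq> v"
  shows "\<Gamma> \<tturnstile> subst v (Proj2 \<langle>s, t\<rangle>) (subst u (Proj1 \<langle>s, t\<rangle>) p) \<longleftrightarrow> \<Gamma> \<tturnstile> subst v t (subst u s p)"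
    (is "?L \<longleftrightarrow> ?R")
proof -
  let ?s = "Proj1 \<langle>s, t\<rangle>" and ?t = "Proj2 \<langle>s, t\<rangle>"
  have ty: "has_ty ?s \<sigma>" "has_ty ?t \<tau>"
    using s t has_ty.intros(10-12) by blast+
  note closed [simp] = has_ty_closed[OF s] has_ty_closed[OF t]
  have eq: "\<Gamma> \<tturnstile> (?s \<^bold>= s)" "\<Gamma> \<tturnstile> (?t \<^bold>= t)"
    using s t proj1_pair proj2_pair by blast+
  note eq' = eq(1)[THEN eq_sym, OF ty(1) s] eq(2)[THEN eq_sym, OF ty(2) t]
  have "?L \<longleftrightarrow> \<Gamma> \<tturnstile> subst v t (subst u ?s p)"
    using eq_subst[OF eq(2) _ ty(2) t] eq_subst[OF eq'(2) _ t ty(2)] by blast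
  also have "\<dots> \<longleftrightarrow> \<Gamma> \<tturnstile> subst u ?s (subst v t p)"
    using uv by (simp add: subst_commute)
  also have "\<dots> \<longleftrightarrow> \<Gamma> \<tturnstile> subst u s (subst v t p)"
    using eq_subst[OF eq(1) _ ty(1) s] eq_subst[OF eq'(1) _ s ty(1)] by blast
  also have "\<dots> \<longleftrightarrow> ?R"
    using uv by (simp add: subst_commute)
  finally show ?thesis .
qed

lemma zero_less_Succ:
  assumes "has_ty n \<^bold>N"
  shows "\<Gamma> \<tturnstile> (\<^bold>0\<^sub>N \<^bold><\<^sub>N Succ n)"
proof -
  have "\<Gamma> \<tturnstile> subst ''n'' n (\<^bold>0\<^sub>N \<^bold><\<^sub>N Succ (V ''n''))"
    by (rule nat_induct_forces[OF _ _ _ _ assms]) (auto intro: less_Succ_self less_Succ_mono)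
  then show ?thesis
    by simp
qed

lemma Succ_less_Succ:
  assumes "\<Gamma> \<tturnstile> (k \<^bold><\<^sub>N n)" and k: "has_ty k \<^bold>N" and n: "has_ty n \<^bold>N"
  shows "\<Gamma> \<tturnstile> (Succ k \<^bold><\<^sub>N Succ n)"
proof -
  note [simp] = k[THEN has_ty_closed] n[THEN has_ty_closed]
  have "\<Gamma> \<tturnstile> subst ''n'' n (k \<^bold><\<^sub>N V ''n'' \<^bold>\<longrightarrow> Succ k \<^bold><\<^sub>N Succ (V ''n''))"
  proof (rule nat_induct_forces[OF _ _ _ _ n], simp_all, goal_cases)
    case 1
    show ?case
      by (rule imp_intro, rule bot_elim, rule less_zero[OF k])
  next
    case (2 \<Delta> c)
    let ?c = "Par \<^bold>N c"
    show ?case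
    proof (rule imp_intro)
      fix \<Delta>1 assume sub: "\<Delta> |\<subseteq>| \<Delta>1" and "\<Delta>1 \<tturnstile> (k \<^bold><\<^sub>N Succ ?c)"
      then have "\<Delta>1 \<tturnstile> (k \<^bold><\<^sub>N ?c \<^bold>\<or> k \<^bold>= ?c)"
        using k by (intro less_Succ_cases) auto
      then show "\<Delta>1 \<tturnstile> (Succ k \<^bold><\<^sub>N Succ (Succ ?c))"
      proof (rule or_elim)
        fix \<Delta>2 assume sub': "\<Delta>1 |\<subseteq>| \<Delta>2" and kc: "\<Delta>2 \<tturnstile> (k \<^bold><\<^sub>N ?c)"
        have "\<Delta> |\<subseteq>| \<Delta>2"
          using sub sub' by simp
        from imp_elim[OF mono[OF 2(2) this] kc] show "\<Delta>2 \<tturnstile> (Succ k \<^bold><\<^sub>N Succ (Succ ?c))"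
          by (rule less_Succ_mono) (use k in auto)
      next
        fix \<Delta>2 assume kc: "\<Delta>2 \<tturnstile> (k \<^bold>= ?c)"
        have "\<Delta>2 \<tturnstile> (Succ k \<^bold><\<^sub>N Succ (Succ k))"
          using k by (intro less_Succ_self) auto
        then show "\<Delta>2 \<tturnstile> (Succ k \<^bold><\<^sub>N Succ (Succ ?c))"
          using eq_subst[OF kc, of "''x''" "Succ k \<^bold><\<^sub>N Succ (Succ (V ''x''))" "\<^bold>N"] k by simp
      qed
    qed
  qed
  then show ?thesis
    using imp_elim assms(1) by simp
qed

text \<open>Induction on \<open>n\<close> avoids comparing \<open>k\<close> with \<open>n\<close>:
  \<open>Succ k\<close> works for zero, and the successor of a bound for \<open>n\<close> is a bound
  for \<open>Succ n\<close>. It supplies an index beyond both a convergence threshold and a given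
  position.\<close>

lemma common_upper_bound:
  assumes k: "has_ty k \<^bold>N" and n: "has_ty n \<^bold>N"
  shows "\<Gamma> \<tturnstile> (\<^bold>\<exists>''i'' \<^bold>: \<^bold>N. k \<^bold><\<^sub>N V ''i'' \<^bold>\<and> n \<^bold><\<^sub>N V ''i'')"
proof -
  note [simp] = k[THEN has_ty_closed] n[THEN has_ty_closed]
  have "\<Gamma> \<tturnstile> subst ''n'' n (\<^bold>\<exists>''i'' \<^bold>: \<^bold>N. k \<^bold><\<^sub>N V ''i'' \<^bold>\<and> V ''n'' \<^bold><\<^sub>N V ''i'')"
  proof (rule nat_induct_forces[OF _ _ _ _ n], simp_all add: insert_Diff_if, goal_cases)
    case 1
    show ?case
      by (rule ex_intro[of "Succ k"]) (use k in \<open>auto intro!: and_intro less_Succ_self zero_less_Succ\<close>)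
  next
    case (2 \<Delta> c)
    from 2(2) show ?case
    proof (rule ex_elim, goal_cases)
      case (1 \<Delta>' i)
      then have *: "\<Delta>' \<tturnstile> (k \<^bold><\<^sub>N Par \<^bold>N i \<^bold>\<and> Par \<^bold>N c \<^bold><\<^sub>N Par \<^bold>N i)"
        by simp
      show ?case
        by (rule ex_intro[of "Succ (Par \<^bold>N i)"])
          (use k and_elim1[OF *] and_elim2[OF *] in
            \<open>auto intro!: and_intro intro: less_Succ_mono Succ_less_Succ\<close>)
    qed
  qed
  then show ?thesis
    by simp
qed

text \<open>Completeness is about terms of type \<open>N \<rightarrow> \<sigma>\<close>, and terms
  have no abstraction. The sequence of first components is therefore obtained from its graph through
  \<open>function_of_graph\<close>.\<close>

lemma function_proj1:
  "\<Gamma> \<tturnstile> (\<^bold>\<exists>''s'' \<^bold>: \<^bold>N \<^bold>\<rightarrow> \<sigma>. \<^bold>\<forall>''n'' \<^bold>: \<^bold>N. V ''s'' \<^bold>\<cdot> V ''n'' \<^bold>= Proj1 (Par (\<^bold>N \<^bold>\<rightarrow> \<sigma> \<^bold>\<times> \<tau>) a \<^bold>\<cdot> V ''n''))"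
proof (rule comprehension_elim[where x = "''w''" and \<sigma> = "\<^bold>N \<^bold>\<times> \<sigma>" and
    p = "Proj2 (V ''w'') \<^bold>= Proj1 (Par (\<^bold>N \<^bold>\<rightarrow> \<sigma> \<^bold>\<times> \<tau>) a \<^bold>\<cdot> Proj1 (V ''w''))"], goal_cases)
  case (3 \<Delta> g)
  let ?S = "Par (\<^bold>N \<^bold>\<rightarrow> \<sigma> \<^bold>\<times> \<tau>) a" and ?G = "Par (TPow (\<^bold>N \<^bold>\<times> \<sigma>)) g"
  have G: "\<Delta>' \<tturnstile> (\<langle>n, y\<rangle> \<^bold>\<in> ?G) \<longleftrightarrow> \<Delta>' \<tturnstile> (y \<^bold>= Proj1 (?S \<^bold>\<cdot> n))"
    if "\<Delta> |\<subseteq>| \<Delta>'" and n: "has_ty n \<^bold>N" and y: "has_ty y \<sigma>" for \<Delta>' n y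
  proof -
    have "\<Delta>' \<tturnstile> (\<langle>n, y\<rangle> \<^bold>\<in> ?G) \<longleftrightarrow> \<Delta>' \<tturnstile> (Proj2 \<langle>n, y\<rangle> \<^bold>= Proj1 (?S \<^bold>\<cdot> Proj1 \<langle>n, y\<rangle>))"
      using iff_forces[OF mono[OF 3(2) that(1)], of "\<langle>n, y\<rangle>"] n y by simp
    also have "\<dots> \<longleftrightarrow> \<Delta>' \<tturnstile> (y \<^bold>= Proj1 (?S \<^bold>\<cdot> n))"
      using subst_proj_pair_iff[OF n y, of "''u''" "''v''" \<Delta>' "V ''v'' \<^bold>= Proj1 (?S \<^bold>\<cdot> V ''u'')"] n y
      by (simp add: has_ty_closed)
    finally show ?thesis .
  qed
  have "\<Delta> \<tturnstile> (\<^bold>\<forall>''G'' \<^bold>: TPow (\<^bold>N \<^bold>\<times> \<sigma>).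
        (\<^bold>\<forall>''x'' \<^bold>: \<^bold>N. \<^bold>\<exists>''y'' \<^bold>: \<sigma>. \<langle>V ''x'', V ''y''\<rangle> \<^bold>\<in> V ''G'' \<^bold>\<and>
            (\<^bold>\<forall>''z'' \<^bold>: \<sigma>. \<langle>V ''x'', V ''z''\<rangle> \<^bold>\<in> V ''G'' \<^bold>\<longrightarrow> V ''z'' \<^bold>= V ''y'')) \<^bold>\<longrightarrow>
        (\<^bold>\<exists>''f'' \<^bold>: \<^bold>N \<^bold>\<rightarrow> \<sigma>. \<^bold>\<forall>''x'' \<^bold>: \<^bold>N. \<langle>V ''x'', V ''f'' \<^bold>\<cdot> V ''x''\<rangle> \<^bold>\<in> V ''G''))"
    by (rule axiom) (simp add: IHOL_def set_axioms.function_of_graph)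
  from all_elim[OF this, of ?G]
  have "\<Delta> \<tturnstile> ((\<^bold>\<forall>''x'' \<^bold>: \<^bold>N. \<^bold>\<exists>''y'' \<^bold>: \<sigma>. \<langle>V ''x'', V ''y''\<rangle> \<^bold>\<in> ?G \<^bold>\<and>
            (\<^bold>\<forall>''z'' \<^bold>: \<sigma>. \<langle>V ''x'', V ''z''\<rangle> \<^bold>\<in> ?G \<^bold>\<longrightarrow> V ''z'' \<^bold>= V ''y'')) \<^bold>\<longrightarrow>
        (\<^bold>\<exists>''f'' \<^bold>: \<^bold>N \<^bold>\<rightarrow> \<sigma>. \<^bold>\<forall>''x'' \<^bold>: \<^bold>N. \<langle>V ''x'', V ''f'' \<^bold>\<cdot> V ''x''\<rangle> \<^bold>\<in> ?G))"
    by simp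
  then have "\<Delta> \<tturnstile> (\<^bold>\<exists>''f'' \<^bold>: \<^bold>N \<^bold>\<rightarrow> \<sigma>. \<^bold>\<forall>''x'' \<^bold>: \<^bold>N. \<langle>V ''x'', V ''f'' \<^bold>\<cdot> V ''x''\<rangle> \<^bold>\<in> ?G)"
  proof (rule imp_elim, intro all_intro, simp)
    fix n
    let ?n = "Par \<^bold>N n"
    let ?y = "Proj1 (?S \<^bold>\<cdot> ?n)"
    have "\<Delta> \<tturnstile> (\<langle>?n, ?y\<rangle> \<^bold>\<in> ?G)"
      by (subst G) (auto intro: eq_refl[where \<sigma> = \<sigma>])
    moreover have "\<Delta> \<tturnstile> (\<^bold>\<forall>''z'' \<^bold>: \<sigma>. \<langle>?n, V ''z''\<rangle> \<^bold>\<in> ?G \<^bold>\<longrightarrow> V ''z'' \<^bold>= ?y)"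
    proof (rule all_intro, simp, rule imp_intro)
      show "\<Delta>' \<tturnstile> (Par \<sigma> z \<^bold>= ?y)" if "\<Delta> |\<subseteq>| \<Delta>'" "\<Delta>' \<tturnstile> (\<langle>?n, Par \<sigma> z\<rangle> \<^bold>\<in> ?G)" for z \<Delta>'
        using that G by simp
    qed
    ultimately show "\<Delta> \<tturnstile> (\<^bold>\<exists>''y'' \<^bold>: \<sigma>. \<langle>?n, V ''y''\<rangle> \<^bold>\<in> ?G \<^bold>\<and>
            (\<^bold>\<forall>''z'' \<^bold>: \<sigma>. \<langle>?n, V ''z''\<rangle> \<^bold>\<in> ?G \<^bold>\<longrightarrow> V ''z'' \<^bold>= V ''y''))"
      by (intro ex_intro[of ?y]) (auto intro: and_intro)
  qed
  then show ?case
  proof (rule ex_elim, goal_cases)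
    case (1 \<Delta>1 s)
    let ?s = "Par (\<^bold>N \<^bold>\<rightarrow> \<sigma>) s"
    have "\<Delta>1 \<tturnstile> (?s \<^bold>\<cdot> Par \<^bold>N n \<^bold>= Proj1 (?S \<^bold>\<cdot> Par \<^bold>N n))" for n
      using all_elim[OF 1(2)[simplified], of "Par \<^bold>N n"] G[of \<Delta>1 "Par \<^bold>N n" "?s \<^bold>\<cdot> Par \<^bold>N n"] 1(1)
      by simp
    then show ?case
      by (intro ex_intro[of ?s]) (auto intro!: all_intro)
  qed
qed auto

section \<open>Approximate distance to a subset\<close>

text \<open>Only the typing of \<open>d\<close> and \<open>L\<close> is fixed here. Being a metric
  is a formula of the object logic and enters each lemma as something derivable in the
  context.\<close>

locale metric_subset =
  fixes \<sigma> :: ty and d L :: tm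
  assumes ty_d: "has_ty d ((\<sigma> \<^bold>\<times> \<sigma>) \<^bold>\<rightarrow> \<^bold>R)" and ty_L: "has_ty L (TPow \<sigma>)"
begin

lemma closed_d [simp]: "vars_tm d = {}" and closed_L [simp]: "vars_tm L = {}"
  using ty_d ty_L by (auto dest: has_ty_closed)

lemma ty_dist [simp]: "has_ty x \<sigma> \<Longrightarrow> has_ty y \<sigma> \<Longrightarrow> real_tm (d \<^bold>\<cdot> \<langle>x, y\<rangle>)"
  by (rule has_ty.intros(13)[OF ty_d]) simp

lemma metric_nonneg:
  assumes "\<Gamma> \<tturnstile> metric \<sigma> d" "has_ty x \<sigma>" "has_ty y \<sigma>"
  shows "\<Gamma> \<tturnstile> (\<^bold>0 \<^bold>\<le> d \<^bold>\<cdot> \<langle>x, y\<rangle>)"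
  using all_elim2[OF and_elim1[OF assms(1)[unfolded metric_def]] assms(2,3)] assms(2,3)
  by (simp add: has_ty_closed)

lemma metric_commute:
  assumes "\<Gamma> \<tturnstile> metric \<sigma> d" "has_ty x \<sigma>" "has_ty y \<sigma>"
  shows "\<Gamma> \<tturnstile> (d \<^bold>\<cdot> \<langle>x, y\<rangle> \<^bold>= d \<^bold>\<cdot> \<langle>y, x\<rangle>)"
  using all_elim2[OF and_elim1[OF and_elim2[OF and_elim2[OF assms(1)[unfolded metric_def]]]] assms(2,3)]
    assms(2,3)
  by (simp add: has_ty_closed)

lemma metric_triangle:
  assumes "\<Gamma> \<tturnstile> metric \<sigma> d" "has_ty x \<sigma>" "has_ty y \<sigma>" "has_ty z \<sigma>"
  shows "\<Gamma> \<tturnstile> (d \<^bold>\<cdot> \<langle>x, z\<rangle> \<^bold>\<le> d \<^bold>\<cdot> \<langle>x, y\<rangle> \<^bold>+ d \<^bold>\<cdot> \<langle>y, z\<rangle>)"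
  using all_elim3[OF and_elim2[OF and_elim2[OF and_elim2[OF assms(1)[unfolded metric_def]]]] assms(2-4)]
    assms(2-4)
  by (simp add: has_ty_closed)

text \<open>\<open>near y e\<close> is a negative substitute for \<open>\<delta>(y, L) < e\<close>: it does not mention the greatest
  lower bound, and it suffices for the construction because it is only used in refutations.\<close>

definition near :: "tm \<Rightarrow> tm \<Rightarrow> fm" where
  "near y e = (\<^bold>\<not> (\<^bold>\<forall>''z'' \<^bold>: \<sigma>. V ''z'' \<^bold>\<in> L \<^bold>\<longrightarrow> e \<^bold>\<le> d \<^bold>\<cdot> \<langle>y, V ''z''\<rangle>))"

lemma subst_near [simp]:
  "x \<noteq> ''z'' \<Longrightarrow> subst x u (near y e) = near (subst_tm x u y) (subst_tm x u e)"
  by (simp add: near_def)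

lemma vars_near [simp]: "vars (near y e) = vars_tm y \<union> vars_tm e - {''z''}"
  by (auto simp: near_def)

text \<open>As long as the goal is falsity, a negated universal is as good as an existential: a
  point \<open>c\<close> of \<open>L\<close> closer than \<open>e\<close> may be assumed to be
  given.\<close>

lemma near_elim:
  assumes "\<Gamma> \<tturnstile> near y e" "has_ty y \<sigma>" "real_tm e"
    and "\<And>\<Delta> c. \<Gamma> |\<subseteq>| \<Delta> \<Longrightarrow> \<Delta> \<tturnstile> (Par \<sigma> c \<^bold>\<in> L) \<Longrightarrow> \<Delta> \<tturnstile> (d \<^bold>\<cdot> \<langle>y, Par \<sigma> c\<rangle> \<^bold>< e) \<Longrightarrow> \<Delta> \<tturnstile> \<^bold>\<bottom>"
  shows "\<Gamma> \<tturnstile> \<^bold>\<bottom>"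
proof (rule imp_elim[OF assms(1)[unfolded near_def]], rule all_intro)
  fix c
  have "\<Gamma> \<tturnstile> (Par \<sigma> c \<^bold>\<in> L \<^bold>\<longrightarrow> e \<^bold>\<le> d \<^bold>\<cdot> \<langle>y, Par \<sigma> c\<rangle>)"
  proof (rule imp_intro, rule imp_intro)
    fix \<Delta> \<Delta>' assume "\<Gamma> |\<subseteq>| \<Delta>" "\<Delta> \<tturnstile> (Par \<sigma> c \<^bold>\<in> L)" "\<Delta> |\<subseteq>| \<Delta>'" "\<Delta>' \<tturnstile> (d \<^bold>\<cdot> \<langle>y, Par \<sigma> c\<rangle> \<^bold>< e)"
    then show "\<Delta>' \<tturnstile> \<^bold>\<bottom>"
      by (intro assms(4)) (auto intro: mono)
  qed
  with assms(2,3) show "\<Gamma> \<tturnstile> subst ''z'' (Par \<sigma> c) (V ''z'' \<^bold>\<in> L \<^bold>\<longrightarrow> e \<^bold>\<le> d \<^bold>\<cdot> \<langle>y, V ''z''\<rangle>)"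
    by (simp add: has_ty_closed)
qed

lemma near_intro:
  assumes "has_ty y \<sigma>" "real_tm e"
    and "\<And>\<Delta>. \<Gamma> |\<subseteq>| \<Delta> \<Longrightarrow>
      (\<And>\<Delta>' z. \<Delta> |\<subseteq>| \<Delta>' \<Longrightarrow> has_ty z \<sigma> \<Longrightarrow> \<Delta>' \<tturnstile> (z \<^bold>\<in> L) \<Longrightarrow> \<Delta>' \<tturnstile> (e \<^bold>\<le> d \<^bold>\<cdot> \<langle>y, z\<rangle>)) \<Longrightarrow> \<Delta> \<tturnstile> \<^bold>\<bottom>"
  shows "\<Gamma> \<tturnstile> near y e"
  unfolding near_def
proof (rule imp_intro, rule assms(3), assumption)
  fix \<Delta> \<Delta>' z
  assume *: "\<Delta> \<tturnstile> (\<^bold>\<forall>''z'' \<^bold>: \<sigma>. V ''z'' \<^bold>\<in> L \<^bold>\<longrightarrow> e \<^bold>\<le> d \<^bold>\<cdot> \<langle>y, V ''z''\<rangle>)" "\<Delta> |\<subseteq>| \<Delta>'"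
    and z: "has_ty z \<sigma>" "\<Delta>' \<tturnstile> (z \<^bold>\<in> L)"
  have "\<Delta>' \<tturnstile> (z \<^bold>\<in> L \<^bold>\<longrightarrow> e \<^bold>\<le> d \<^bold>\<cdot> \<langle>y, z\<rangle>)"
    using all_elim[OF mono[OF *] z(1)] assms(1,2) by (simp add: has_ty_closed)
  then show "\<Delta>' \<tturnstile> (e \<^bold>\<le> d \<^bold>\<cdot> \<langle>y, z\<rangle>)"
    using z(2) by (rule imp_elim)
qed

text \<open>The hidden point of \<open>L\<close> stays the same, so the inequality only has to be
  transferred at each point. This covers a change of radius as well as a change of centre.\<close>

lemma near_mono:
  assumes "\<Gamma> \<tturnstile> near x a" "has_ty x \<sigma>" "real_tm a" "has_ty y \<sigma>" "real_tm b"
    and "\<And>\<Delta> c. \<Gamma> |\<subseteq>| \<Delta> \<Longrightarrow> \<Delta> \<tturnstile> (d \<^bold>\<cdot> \<langle>x, Par \<sigma> c\<rangle> \<^bold>< a) \<Longrightarrow> \<Delta> \<tturnstile> (d \<^bold>\<cdot> \<langle>y, Par \<sigma> c\<rangle> \<^bold>< b)"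
  shows "\<Gamma> \<tturnstile> near y b"
proof (rule near_intro[OF assms(4,5)])
  fix \<Delta>
  assume sub: "\<Gamma> |\<subseteq>| \<Delta>" and
    H: "\<And>\<Delta>' z. \<Delta> |\<subseteq>| \<Delta>' \<Longrightarrow> has_ty z \<sigma> \<Longrightarrow> \<Delta>' \<tturnstile> (z \<^bold>\<in> L) \<Longrightarrow> \<Delta>' \<tturnstile> (b \<^bold>\<le> d \<^bold>\<cdot> \<langle>y, z\<rangle>)"
  show "\<Delta> \<tturnstile> \<^bold>\<bottom>"
  proof (rule near_elim[OF mono[OF assms(1) sub] assms(2,3)], goal_cases)
    case (1 \<Delta>' c)
    then show ?case
      using sub H[of \<Delta>' "Par \<sigma> c"] assms(6)[of \<Delta>' c] by (auto intro: le_less_contradiction)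
  qed
qed

section \<open>Distance sets and what their greatest lower bounds provide\<close>

lemma dist_in_distance_set:
  assumes "\<Gamma> \<tturnstile> is_distance_set \<sigma> d x L T" "has_ty x \<sigma>" "has_ty T (TPow \<^bold>R)" "has_ty z \<sigma>"
    "\<Gamma> \<tturnstile> (z \<^bold>\<in> L)"
  shows "\<Gamma> \<tturnstile> (d \<^bold>\<cdot> \<langle>x, z\<rangle> \<^bold>\<in> T)"
proof -
  have "\<Gamma> \<tturnstile> (\<^bold>\<exists>''y'' \<^bold>: \<sigma>. V ''y'' \<^bold>\<in> L \<^bold>\<and> d \<^bold>\<cdot> \<langle>x, z\<rangle> \<^bold>= d \<^bold>\<cdot> \<langle>x, V ''y''\<rangle>)"
    by (rule ex_intro[OF assms(4)])
      (use assms in \<open>auto simp: has_ty_closed intro!: and_intro eq_refl[where \<sigma> = "\<^bold>R"]\<close>)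
  moreover have "\<Gamma> \<tturnstile> (d \<^bold>\<cdot> \<langle>x, z\<rangle> \<^bold>\<in> T \<^bold>\<longleftrightarrow> (\<^bold>\<exists>''y'' \<^bold>: \<sigma>. V ''y'' \<^bold>\<in> L \<^bold>\<and> d \<^bold>\<cdot> \<langle>x, z\<rangle> \<^bold>= d \<^bold>\<cdot> \<langle>x, V ''y''\<rangle>))"
    using all_elim[OF assms(1)[unfolded is_distance_set_def] ty_dist[OF assms(2,4)]] assms
    by (simp add: has_ty_closed)
  ultimately show ?thesis
    by (auto intro: imp_elim and_elim2)
qed

lemma lower_bound_distance_set:
  assumes D: "\<Gamma> \<tturnstile> is_distance_set \<sigma> d x L T" and ty: "has_ty x \<sigma>" "has_ty T (TPow \<^bold>R)" "real_tm e"
    and "\<And>\<Delta> c. \<Gamma> |\<subseteq>| \<Delta> \<Longrightarrow> \<Delta> \<tturnstile> (Par \<sigma> c \<^bold>\<in> L) \<Longrightarrow> \<Delta> \<tturnstile> (e \<^bold>\<le> d \<^bold>\<cdot> \<langle>x, Par \<sigma> c\<rangle>)"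
  shows "\<Gamma> \<tturnstile> is_lower_bound e T"
  unfolding is_lower_bound_def
proof (rule all_intro)
  fix t
  let ?t = "Par \<^bold>R t"
  note [simp] = ty[THEN has_ty_closed]
  have "\<Gamma> \<tturnstile> (?t \<^bold>\<in> T \<^bold>\<longrightarrow> e \<^bold>\<le> ?t)"
  proof (rule imp_intro)
    fix \<Delta> assume sub: "\<Gamma> |\<subseteq>| \<Delta>" and t: "\<Delta> \<tturnstile> (?t \<^bold>\<in> T)"
    have "\<Gamma> \<tturnstile> (?t \<^bold>\<in> T \<^bold>\<longleftrightarrow> (\<^bold>\<exists>''y'' \<^bold>: \<sigma>. V ''y'' \<^bold>\<in> L \<^bold>\<and> ?t \<^bold>= d \<^bold>\<cdot> \<langle>x, V ''y''\<rangle>))"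
      using all_elim[OF D[unfolded is_distance_set_def], of ?t] by simp
    then have "\<Delta> \<tturnstile> (\<^bold>\<exists>''y'' \<^bold>: \<sigma>. V ''y'' \<^bold>\<in> L \<^bold>\<and> ?t \<^bold>= d \<^bold>\<cdot> \<langle>x, V ''y''\<rangle>)"
      using imp_elim[OF and_elim1[OF mono[OF _ sub]] t] by blast
    then show "\<Delta> \<tturnstile> (e \<^bold>\<le> ?t)"
    proof (rule ex_elim, goal_cases)
      case (1 \<Delta>' c)
      then have c: "\<Delta>' \<tturnstile> (Par \<sigma> c \<^bold>\<in> L \<^bold>\<and> ?t \<^bold>= d \<^bold>\<cdot> \<langle>x, Par \<sigma> c\<rangle>)"
        by simp
      have "\<Delta>' \<tturnstile> (e \<^bold>\<le> d \<^bold>\<cdot> \<langle>x, Par \<sigma> c\<rangle>)"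
        by (rule assms(5)[OF _ and_elim1[OF c]]) (use sub 1 in auto)
      then show ?case
        by (rule le_trans[OF _ eq_ge[OF and_elim2[OF c]]]) (use ty in auto)
    qed
  qed
  then show "\<Gamma> \<tturnstile> subst ''t'' ?t (V ''t'' \<^bold>\<in> T \<^bold>\<longrightarrow> e \<^bold>\<le> V ''t'')"
    by simp
qed

text \<open>If no point of \<open>L\<close> were closer to \<open>x\<close> than \<open>e\<close>,
  then \<open>e\<close> would be a lower bound of the distances and hence at most \<open>b\<close>;
  this refutation gives \<open>near x e\<close> for all \<open>e\<close> above \<open>b\<close>.
  Nonnegativity of \<open>b\<close> holds because zero is a lower bound as well. The set and its
  bound are also handed out, since they will be the witnesses for locatedness.\<close>

lemma quasilocated_elim:
  assumes Q: "\<Gamma> \<tturnstile> quasilocated \<sigma> d L" and M: "\<Gamma> \<tturnstile> metric \<sigma> d" and x: "has_ty x \<sigma>"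
    and R: "\<And>\<Delta> a b. \<Gamma> |\<subseteq>| \<Delta> \<Longrightarrow> \<Delta> \<tturnstile> is_distance_set \<sigma> d x L (Par (TPow \<^bold>R) a) \<Longrightarrow>
      \<Delta> \<tturnstile> is_lower_bound (Par \<^bold>R b) (Par (TPow \<^bold>R) a) \<Longrightarrow>
      (\<And>\<Delta>' z. \<Delta> |\<subseteq>| \<Delta>' \<Longrightarrow> has_ty z \<sigma> \<Longrightarrow> \<Delta>' \<tturnstile> (z \<^bold>\<in> L) \<Longrightarrow> \<Delta>' \<tturnstile> (Par \<^bold>R b \<^bold>\<le> d \<^bold>\<cdot> \<langle>x, z\<rangle>)) \<Longrightarrow>
      (\<And>\<Delta>' e. \<Delta> |\<subseteq>| \<Delta>' \<Longrightarrow> real_tm e \<Longrightarrow> \<Delta>' \<tturnstile> (Par \<^bold>R b \<^bold>< e) \<Longrightarrow> \<Delta>' \<tturnstile> near x e) \<Longrightarrow>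
      \<Delta> \<tturnstile> (\<^bold>0 \<^bold>\<le> Par \<^bold>R b) \<Longrightarrow> \<Delta> \<tturnstile> r"
  shows "\<Gamma> \<tturnstile> r"
proof -
  note [simp] = x[THEN has_ty_closed]
  have "\<Gamma> \<tturnstile> (\<^bold>\<exists>''T'' \<^bold>: TPow \<^bold>R. is_distance_set \<sigma> d x L (V ''T'') \<^bold>\<and>
        (\<^bold>\<exists>''m'' \<^bold>: \<^bold>R. is_glb (V ''m'') (V ''T'')))"
    using all_elim[OF Q[unfolded quasilocated_def] x]
    by (simp add: is_distance_set_def is_glb_def is_lower_bound_def)
  then show ?thesis
  proof (rule ex_elim, goal_cases)
    case (1 \<Delta>1 a)
    let ?T = "Par (TPow \<^bold>R) a"
    note sub1 = 1(1)
    have D: "\<Delta>1 \<tturnstile> is_distance_set \<sigma> d x L ?T" and "\<Delta>1 \<tturnstile> (\<^bold>\<exists>''m'' \<^bold>: \<^bold>R. is_glb (V ''m'') ?T)"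
      using and_elim1[OF 1(2)[simplified]] and_elim2[OF 1(2)[simplified]]
      by (simp_all add: is_distance_set_def is_glb_def is_lower_bound_def)
    from this(2) show ?case
    proof (rule ex_elim, goal_cases)
      case (1 \<Delta> b)
      let ?m = "Par \<^bold>R b"
      note sub2 = 1(1)
      note D = mono[OF D sub2]
      have lb: "\<Delta> \<tturnstile> is_lower_bound ?m ?T"
        and glb: "\<Delta> \<tturnstile> (\<^bold>\<forall>''b'' \<^bold>: \<^bold>R. is_lower_bound (V ''b'') ?T \<^bold>\<longrightarrow> V ''b'' \<^bold>\<le> ?m)"
        using and_elim1[OF 1(2)[simplified is_glb_def subst.simps]]
          and_elim2[OF 1(2)[simplified is_glb_def subst.simps]]
        by (simp_all add: is_lower_bound_def)
      have greatest: "\<Delta>' \<tturnstile> (e \<^bold>\<le> ?m)"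
        if sub: "\<Delta> |\<subseteq>| \<Delta>'" and e: "real_tm e" and "\<Delta>' \<tturnstile> is_lower_bound e ?T" for \<Delta>' e
      proof (rule imp_elim)
        show "\<Delta>' \<tturnstile> (is_lower_bound e ?T \<^bold>\<longrightarrow> e \<^bold>\<le> ?m)"
          using all_elim[OF mono[OF glb sub] e] e
          by (simp add: is_lower_bound_def)
      qed (rule that)
      show ?case
      proof (rule R[OF _ D lb])
        show "\<Gamma> |\<subseteq>| \<Delta>"
          using sub1 sub2 by simp
        show "\<Delta>' \<tturnstile> (?m \<^bold>\<le> d \<^bold>\<cdot> \<langle>x, z\<rangle>)"
          if sub: "\<Delta> |\<subseteq>| \<Delta>'" and z: "has_ty z \<sigma>" "\<Delta>' \<tturnstile> (z \<^bold>\<in> L)" for \<Delta>' z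
        proof (rule imp_elim)
          show "\<Delta>' \<tturnstile> (d \<^bold>\<cdot> \<langle>x, z\<rangle> \<^bold>\<in> ?T)"
            by (rule dist_in_distance_set[OF mono[OF D sub] x _ z]) simp
          show "\<Delta>' \<tturnstile> (d \<^bold>\<cdot> \<langle>x, z\<rangle> \<^bold>\<in> ?T \<^bold>\<longrightarrow> ?m \<^bold>\<le> d \<^bold>\<cdot> \<langle>x, z\<rangle>)"
            using all_elim[OF mono[OF lb sub, unfolded is_lower_bound_def] ty_dist[OF x z(1)]] z
            by simp
        qed
        show "\<Delta>' \<tturnstile> near x e" if sub: "\<Delta> |\<subseteq>| \<Delta>'" and e: "real_tm e" "\<Delta>' \<tturnstile> (?m \<^bold>< e)" for \<Delta>' e
        proof (rule near_intro[OF x e(1)], goal_cases)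
          case (1 \<Delta>'')
          note sub' = 1(1)
          have sub'': "\<Delta> |\<subseteq>| \<Delta>''"
            using sub sub' by simp
          have "\<Delta>'' \<tturnstile> is_lower_bound e ?T"
            by (rule lower_bound_distance_set[OF mono[OF D sub''] x _ e(1)]) (auto intro: 1(2))
          then have "\<Delta>'' \<tturnstile> (e \<^bold>\<le> ?m)"
            by (rule greatest[OF sub'' e(1)])
          then show ?case
            by (rule le_less_contradiction[OF _ mono[OF e(2) sub']])
        qed
        have "\<Delta> \<tturnstile> is_lower_bound \<^bold>0 ?T"
          by (rule lower_bound_distance_set[OF D x])
            (use mono[OF M] sub1 sub2 x in \<open>auto intro!: metric_nonneg\<close>)
        then show "\<Delta> \<tturnstile> (\<^bold>0 \<^bold>\<le> ?m)"
          by (intro greatest) auto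
      qed
    qed
  qed
qed

text \<open>Induction on \<open>n\<close> combines the alternatives for the single points into one
  alternative for the whole list: some \<open>p k\<close> is near \<open>L\<close>, or all of them
  are at distance at least \<open>h\<close> from every point of \<open>L\<close>.\<close>

lemma finite_search:
  fixes a :: nat
  defines "p \<equiv> Par (\<^bold>N \<^bold>\<rightarrow> \<sigma>) a"
  assumes Q: "\<Gamma> \<tturnstile> quasilocated \<sigma> d L" and M: "\<Gamma> \<tturnstile> metric \<sigma> d"
    and h: "real_tm h" "\<Gamma> \<tturnstile> (\<^bold>0 \<^bold>< h)" and n: "has_ty n \<^bold>N"
  shows "\<Gamma> \<tturnstile> ((\<^bold>\<exists>''k'' \<^bold>: \<^bold>N. V ''k'' \<^bold><\<^sub>N n \<^bold>\<and> near (p \<^bold>\<cdot> V ''k'') (h \<^bold>+ h)) \<^bold>\<or>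
    (\<^bold>\<forall>''k'' \<^bold>: \<^bold>N. V ''k'' \<^bold><\<^sub>N n \<^bold>\<longrightarrow> (\<^bold>\<forall>''z'' \<^bold>: \<sigma>. V ''z'' \<^bold>\<in> L \<^bold>\<longrightarrow> h \<^bold>\<le> d \<^bold>\<cdot> \<langle>p \<^bold>\<cdot> V ''k'', V ''z''\<rangle>)))"
proof -
  note [simp] = h(1)[THEN has_ty_closed] n[THEN has_ty_closed]
  define S where "S n = ((\<^bold>\<exists>''k'' \<^bold>: \<^bold>N. V ''k'' \<^bold><\<^sub>N n \<^bold>\<and> near (p \<^bold>\<cdot> V ''k'') (h \<^bold>+ h)) \<^bold>\<or>
    (\<^bold>\<forall>''k'' \<^bold>: \<^bold>N. V ''k'' \<^bold><\<^sub>N n \<^bold>\<longrightarrow> (\<^bold>\<forall>''z'' \<^bold>: \<sigma>. V ''z'' \<^bold>\<in> L \<^bold>\<longrightarrow> h \<^bold>\<le> d \<^bold>\<cdot> \<langle>p \<^bold>\<cdot> V ''k'', V ''z''\<rangle>)))"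
    for n
  have [simp]: "subst_tm x u p = p" "vars_tm p = {}" "has_ty p (\<^bold>N \<^bold>\<rightarrow> \<sigma>)" for x u
    by (simp_all add: p_def)
  have [simp]: "has_ty (p \<^bold>\<cdot> k) \<sigma>" if "has_ty k \<^bold>N" for k
    using that by (simp add: p_def)
  have subst_S: "subst ''n'' n (S (V ''n'')) = S n" for n
    by (simp add: S_def)
  have "\<Gamma> \<tturnstile> subst ''n'' n (S (V ''n''))"
  proof (rule nat_induct_forces[OF _ _ _ _ n], unfold subst_S)
    show "vars (S (V ''n'')) \<subseteq> {''n''}" "''n'' \<noteq> ''A''"
      by (auto simp: S_def)
    show "\<Gamma> \<tturnstile> S \<^bold>0\<^sub>N"
      unfolding S_def
    proof (rule or_intro2, rule all_intro, simp, rule imp_intro)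
      fix k \<Delta> assume "\<Delta> \<tturnstile> (Par \<^bold>N k \<^bold><\<^sub>N \<^bold>0\<^sub>N)"
      then show "\<Delta> \<tturnstile> (\<^bold>\<forall>''z'' \<^bold>: \<sigma>. V ''z'' \<^bold>\<in> L \<^bold>\<longrightarrow> h \<^bold>\<le> d \<^bold>\<cdot> \<langle>p \<^bold>\<cdot> Par \<^bold>N k, V ''z''\<rangle>)"
        by (rule bot_elim[OF less_zero, rotated]) simp
    qed
    fix \<Delta> c
    let ?n = "Par \<^bold>N c"
    assume sub: "\<Gamma> |\<subseteq>| \<Delta>" and IH: "\<Delta> \<tturnstile> S ?n"
    note Q = mono[OF Q sub] and M = mono[OF M sub] and hpos = mono[OF h(2) sub]
    show "\<Delta> \<tturnstile> S (Succ ?n)"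
    proof (rule or_elim[OF IH[unfolded S_def]], goal_cases)
      case (1 \<Delta>1)
      show ?case
      proof (rule ex_elim[OF 1(2)], goal_cases)
        case (1 \<Delta>2 k)
        let ?k = "Par \<^bold>N k"
        from 1 have k: "\<Delta>2 \<tturnstile> (?k \<^bold><\<^sub>N ?n \<^bold>\<and> near (p \<^bold>\<cdot> ?k) (h \<^bold>+ h))"
          by simp
        have "\<Delta>2 \<tturnstile> (?k \<^bold><\<^sub>N Succ ?n)"
          by (rule less_Succ_mono[OF and_elim1[OF k]]) auto
        with k show ?case
          unfolding S_def
          by (intro or_intro1 ex_intro[of ?k]) (auto intro: and_intro and_elim2)
      qed
    next
      case (2 \<Delta>1)
      note Q = mono[OF Q 2(1)] and M = mono[OF M 2(1)] and hpos = mono[OF hpos 2(1)] and H = 2(2)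
      show ?case
      proof (rule quasilocated_elim[OF Q M, where x = "p \<^bold>\<cdot> ?n"], goal_cases)
        case 1 show "has_ty (p \<^bold>\<cdot> ?n) \<sigma>" by simp
      next
        case (2 \<Delta>2 a b)
        let ?m = "Par \<^bold>R b"
        note H = mono[OF H 2(1)]
        \<comment> \<open>The gap between the thresholds \<open>h\<close> and \<open>h + h\<close>
          makes the distance bound \<open>m\<close> of the new point comparable:
          \<open>m < h + h\<close> gives nearness, while \<open>h < m\<close> keeps all of
          \<open>L\<close> at distance at least \<open>h\<close>.\<close>
        have "\<Delta>2 \<tturnstile> (h \<^bold>< h \<^bold>+ h)"
          by (rule less_shift[OF mono[OF hpos 2(1)]]) (use h in \<open>auto simp: algebra_simps\<close>)
        then have "\<Delta>2 \<tturnstile> (h \<^bold>< ?m \<^bold>\<or> ?m \<^bold>< h \<^bold>+ h)"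
          by (rule less_cotrans[rotated 3]) (use h in auto)
        then show ?case
        proof (rule or_elim)
          fix \<Delta>3 assume sub: "\<Delta>2 |\<subseteq>| \<Delta>3" and "\<Delta>3 \<tturnstile> (?m \<^bold>< h \<^bold>+ h)"
          then have "\<Delta>3 \<tturnstile> near (p \<^bold>\<cdot> ?n) (h \<^bold>+ h)"
            using h by (intro 2(5)) auto
          then show "\<Delta>3 \<tturnstile> S (Succ ?n)"
            unfolding S_def
            by (intro or_intro1 ex_intro[of ?n]) (auto intro!: and_intro less_Succ_self)
        next
          fix \<Delta>3 assume sub3: "\<Delta>2 |\<subseteq>| \<Delta>3" and hm: "\<Delta>3 \<tturnstile> (h \<^bold>< ?m)"
          have new: "\<Delta>3 \<tturnstile> (\<^bold>\<forall>''z'' \<^bold>: \<sigma>. V ''z'' \<^bold>\<in> L \<^bold>\<longrightarrow> h \<^bold>\<le> d \<^bold>\<cdot> \<langle>p \<^bold>\<cdot> ?n, V ''z''\<rangle>)"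
          proof (rule all_intro, simp, rule imp_intro)
            fix z \<Delta>4 assume sub4: "\<Delta>3 |\<subseteq>| \<Delta>4" and "\<Delta>4 \<tturnstile> (Par \<sigma> z \<^bold>\<in> L)"
            then have m: "\<Delta>4 \<tturnstile> (?m \<^bold>\<le> d \<^bold>\<cdot> \<langle>p \<^bold>\<cdot> ?n, Par \<sigma> z\<rangle>)"
              using sub3 by (intro 2(4)) auto
            show "\<Delta>4 \<tturnstile> (h \<^bold>\<le> d \<^bold>\<cdot> \<langle>p \<^bold>\<cdot> ?n, Par \<sigma> z\<rangle>)"
              by (intro le_trans[OF less_imp_le[OF mono[OF hm sub4]] m]) (use h in auto)
          qed
          show "\<Delta>3 \<tturnstile> S (Succ ?n)"
            unfolding S_def
          proof (rule or_intro2, rule all_intro, simp, rule imp_intro)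
            fix k \<Delta>4
            let ?k = "Par \<^bold>N k"
            assume sub4: "\<Delta>3 |\<subseteq>| \<Delta>4" and "\<Delta>4 \<tturnstile> (?k \<^bold><\<^sub>N Succ ?n)"
            then have "\<Delta>4 \<tturnstile> (?k \<^bold><\<^sub>N ?n \<^bold>\<or> ?k \<^bold>= ?n)"
              by (intro less_Succ_cases) auto
            then show "\<Delta>4 \<tturnstile> (\<^bold>\<forall>''z'' \<^bold>: \<sigma>. V ''z'' \<^bold>\<in> L \<^bold>\<longrightarrow> h \<^bold>\<le> d \<^bold>\<cdot> \<langle>p \<^bold>\<cdot> ?k, V ''z''\<rangle>)"
            proof (rule or_elim)
              fix \<Delta>5 assume sub5: "\<Delta>4 |\<subseteq>| \<Delta>5" and k: "\<Delta>5 \<tturnstile> (?k \<^bold><\<^sub>N ?n)"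
              have "\<Delta>2 |\<subseteq>| \<Delta>5"
                using sub3 sub4 sub5 by simp
              then show "\<Delta>5 \<tturnstile> (\<^bold>\<forall>''z'' \<^bold>: \<sigma>. V ''z'' \<^bold>\<in> L \<^bold>\<longrightarrow> h \<^bold>\<le> d \<^bold>\<cdot> \<langle>p \<^bold>\<cdot> ?k, V ''z''\<rangle>)"
                using imp_elim[OF all_elim[OF mono[OF H], of \<Delta>5 ?k, simplified] k] by simp
            next
              fix \<Delta>5 assume sub5: "\<Delta>4 |\<subseteq>| \<Delta>5" and k: "\<Delta>5 \<tturnstile> (?k \<^bold>= ?n)"
              have "\<Delta>5 \<tturnstile> (?n \<^bold>= ?k)"
                by (rule eq_sym[OF k, where \<sigma> = "\<^bold>N"]) auto
              moreover have "\<Delta>3 |\<subseteq>| \<Delta>5"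
                using sub4 sub5 by simp
              ultimately show "\<Delta>5 \<tturnstile> (\<^bold>\<forall>''z'' \<^bold>: \<sigma>. V ''z'' \<^bold>\<in> L \<^bold>\<longrightarrow> h \<^bold>\<le> d \<^bold>\<cdot> \<langle>p \<^bold>\<cdot> ?k, V ''z''\<rangle>)"
                using eq_subst[of \<Delta>5 ?n ?k "''k''"
                  "\<^bold>\<forall>''z'' \<^bold>: \<sigma>. V ''z'' \<^bold>\<in> L \<^bold>\<longrightarrow> h \<^bold>\<le> d \<^bold>\<cdot> \<langle>p \<^bold>\<cdot> V ''k'', V ''z''\<rangle>" "\<^bold>N"] mono[OF new]
                by simp
            qed
          qed
        qed
      qed
    qed
  qed
  then show ?thesis
    unfolding subst_S unfolding S_def .
qed

text \<open>Writing the target radius as \<open>h + h\<close> makes the mesh \<open>h\<close> of the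
  approximation available without dividing; this same \<open>h\<close> is the lower threshold of
  \<open>finite_search\<close>.\<close>

lemma near_step_double:
  assumes Q: "\<Gamma> \<tturnstile> quasilocated \<sigma> d L" and M: "\<Gamma> \<tturnstile> metric \<sigma> d" and B: "\<Gamma> \<tturnstile> balls_totally_bounded \<sigma> d"
    and x: "has_ty x \<sigma>" and r: "real_tm r" "\<Gamma> \<tturnstile> (\<^bold>0 \<^bold>< r)" and h: "real_tm h" "\<Gamma> \<tturnstile> (\<^bold>0 \<^bold>< h)"
    and near: "\<Gamma> \<tturnstile> near x r"
  shows "\<Gamma> \<tturnstile> (\<^bold>\<exists>''y'' \<^bold>: \<sigma>. d \<^bold>\<cdot> \<langle>x, V ''y''\<rangle> \<^bold>< r \<^bold>\<and> near (V ''y'') (h \<^bold>+ h))"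
proof -
  note [simp] = x[THEN has_ty_closed] h(1)[THEN has_ty_closed] r(1)[THEN has_ty_closed]
  show ?thesis
  proof (rule comprehension_elim[where p = "d \<^bold>\<cdot> \<langle>x, V ''y''\<rangle> \<^bold>< r" and x = "''y''" and \<sigma> = \<sigma>], goal_cases)
    case (3 \<Delta>1 b)
    let ?B = "Par (TPow \<sigma>) b"
    note Q = mono[OF Q 3(1)] and M = mono[OF M 3(1)] and B = mono[OF B 3(1)] and r = r(1) mono[OF r(2) 3(1)]
      and h = h(1) mono[OF h(2) 3(1)] and near = mono[OF near 3(1)]
    have ball: "\<Delta>1 \<tturnstile> (t \<^bold>\<in> ?B \<^bold>\<longleftrightarrow> d \<^bold>\<cdot> \<langle>x, t\<rangle> \<^bold>< r)" if "has_ty t \<sigma>" for t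
      using 3(2)[OF that] by simp
    have "\<Delta>1 \<tturnstile> (\<^bold>0 \<^bold>< r \<^bold>\<longrightarrow> (\<^bold>\<forall>''B'' \<^bold>: TPow \<sigma>.
        (\<^bold>\<forall>''y'' \<^bold>: \<sigma>. (V ''y'' \<^bold>\<in> V ''B'' \<^bold>\<longleftrightarrow> d \<^bold>\<cdot> \<langle>x, V ''y''\<rangle> \<^bold>< r)) \<^bold>\<longrightarrow> totally_bounded \<sigma> d (V ''B'')))"
      using all_elim2[OF B[unfolded balls_totally_bounded_def] x r(1)] by (simp add: totally_bounded_def)
    from all_elim[OF imp_elim[OF this r(2)], of ?B]
    have *: "\<Delta>1 \<tturnstile> ((\<^bold>\<forall>''y'' \<^bold>: \<sigma>. (V ''y'' \<^bold>\<in> ?B \<^bold>\<longleftrightarrow> d \<^bold>\<cdot> \<langle>x, V ''y''\<rangle> \<^bold>< r)) \<^bold>\<longrightarrow> totally_bounded \<sigma> d ?B)"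
      by (simp add: totally_bounded_def)
    have "\<Delta>1 \<tturnstile> totally_bounded \<sigma> d ?B"
      by (rule imp_elim[OF *], rule all_intro) (use ball in simp)
    from all_elim[OF this[unfolded totally_bounded_def] h(1)]
    have cover: "\<Delta>1 \<tturnstile> (\<^bold>0 \<^bold>< h \<^bold>\<longrightarrow> (\<^bold>\<exists>''n'' \<^bold>: \<^bold>N. \<^bold>\<exists>''p'' \<^bold>: \<^bold>N \<^bold>\<rightarrow> \<sigma>.
        (\<^bold>\<forall>''k'' \<^bold>: \<^bold>N. V ''k'' \<^bold><\<^sub>N V ''n'' \<^bold>\<longrightarrow> V ''p'' \<^bold>\<cdot> V ''k'' \<^bold>\<in> ?B) \<^bold>\<and>
        (\<^bold>\<forall>''y'' \<^bold>: \<sigma>. V ''y'' \<^bold>\<in> ?B \<^bold>\<longrightarrow>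
            (\<^bold>\<exists>''k'' \<^bold>: \<^bold>N. V ''k'' \<^bold><\<^sub>N V ''n'' \<^bold>\<and> d \<^bold>\<cdot> \<langle>V ''y'', V ''p'' \<^bold>\<cdot> V ''k''\<rangle> \<^bold>< h))))"
      by simp
    show ?case
    proof (rule ex_elim[OF imp_elim[OF cover h(2)]], simp, elim ex_elim, goal_cases)
      case (1 \<Delta>2 n \<Delta>3 a)
      let ?n = "Par \<^bold>N n" and ?p = "Par (\<^bold>N \<^bold>\<rightarrow> \<sigma>) a"
      have sub: "\<Delta>1 |\<subseteq>| \<Delta>3"
        using 1(1,2) by simp
      have cover: "\<Delta>3 \<tturnstile> ((\<^bold>\<forall>''k'' \<^bold>: \<^bold>N. V ''k'' \<^bold><\<^sub>N ?n \<^bold>\<longrightarrow> ?p \<^bold>\<cdot> V ''k'' \<^bold>\<in> ?B) \<^bold>\<and>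
        (\<^bold>\<forall>''y'' \<^bold>: \<sigma>. V ''y'' \<^bold>\<in> ?B \<^bold>\<longrightarrow>
            (\<^bold>\<exists>''k'' \<^bold>: \<^bold>N. V ''k'' \<^bold><\<^sub>N ?n \<^bold>\<and> d \<^bold>\<cdot> \<langle>V ''y'', ?p \<^bold>\<cdot> V ''k''\<rangle> \<^bold>< h)))"
        using 1(3) by simp
      note Q = mono[OF Q sub] and M = mono[OF M sub] and h = h(1) mono[OF h(2) sub]
        and near = mono[OF near sub]
      note ball = mono[OF ball sub]
      show ?case
      proof (rule or_elim[OF finite_search[OF Q M h, of ?n a]], goal_cases)
        case 1 show ?case by simp
      next
        case (2 \<Delta>4)
        note ball = mono[OF ball 2(1)] and cover = mono[OF cover 2(1)]
        from 2(2) show ?case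
        proof (rule ex_elim, goal_cases)
          case (1 \<Delta>5 k)
          let ?k = "Par \<^bold>N k"
          from 1(2) have k: "\<Delta>5 \<tturnstile> (?k \<^bold><\<^sub>N ?n \<^bold>\<and> near (?p \<^bold>\<cdot> ?k) (h \<^bold>+ h))"
            by simp
          have "\<Delta>5 \<tturnstile> (?k \<^bold><\<^sub>N ?n \<^bold>\<longrightarrow> ?p \<^bold>\<cdot> ?k \<^bold>\<in> ?B)"
            using all_elim[OF and_elim1[OF mono[OF cover 1(1)]], of ?k] by simp
          from imp_elim[OF this and_elim1[OF k]] have "\<Delta>5 \<tturnstile> (d \<^bold>\<cdot> \<langle>x, ?p \<^bold>\<cdot> ?k\<rangle> \<^bold>< r)"
            by (rule imp_elim[OF and_elim1[OF mono[OF ball 1(1)]], rotated]) simp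
          then show ?case
            using and_elim2[OF k] by (intro ex_intro[of "?p \<^bold>\<cdot> ?k"]) (auto intro: and_intro)
        qed
      next
        case (3 \<Delta>4)
        note ball = mono[OF ball 3(1)] and cover = mono[OF cover 3(1)] and M = mono[OF M 3(1)]
          and far = 3(2)
        \<comment> \<open>The second alternative is refuted. With falsity as goal,
          \<open>near x r\<close> may supply a point \<open>c\<close> of \<open>L\<close> inside the
          ball, and the approximation has some \<open>p k\<close> closer to \<open>c\<close> than
          \<open>h\<close>, although \<open>p k\<close> should be at distance at least
          \<open>h\<close> from \<open>c\<close>.\<close>
        show ?case
        proof (rule bot_elim, rule near_elim[OF mono[OF near 3(1)] x r(1)], goal_cases)
          case (1 \<Delta>5 c)
          let ?c = "Par \<sigma> c"
          note M = mono[OF M 1(1)] and far = mono[OF far 1(1)] and c = 1(2)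
          have "\<Delta>5 \<tturnstile> (?c \<^bold>\<in> ?B)"
            by (rule imp_elim[OF and_elim2[OF mono[OF ball 1(1)]] 1(3)]) simp
          moreover have "\<Delta>5 \<tturnstile> (?c \<^bold>\<in> ?B \<^bold>\<longrightarrow>
              (\<^bold>\<exists>''k'' \<^bold>: \<^bold>N. V ''k'' \<^bold><\<^sub>N ?n \<^bold>\<and> d \<^bold>\<cdot> \<langle>?c, ?p \<^bold>\<cdot> V ''k''\<rangle> \<^bold>< h))"
            using all_elim[OF and_elim2[OF mono[OF cover 1(1)]], of ?c] by simp
          ultimately have "\<Delta>5 \<tturnstile> (\<^bold>\<exists>''k'' \<^bold>: \<^bold>N. V ''k'' \<^bold><\<^sub>N ?n \<^bold>\<and> d \<^bold>\<cdot> \<langle>?c, ?p \<^bold>\<cdot> V ''k''\<rangle> \<^bold>< h)"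
            by (rule imp_elim[rotated])
          then show ?case
          proof (rule ex_elim, goal_cases)
            case (1 \<Delta>6 k)
            let ?k = "Par \<^bold>N k"
            from 1(2) have k: "\<Delta>6 \<tturnstile> (?k \<^bold><\<^sub>N ?n \<^bold>\<and> d \<^bold>\<cdot> \<langle>?c, ?p \<^bold>\<cdot> ?k\<rangle> \<^bold>< h)"
              by simp
            have "\<Delta>6 \<tturnstile> (?k \<^bold><\<^sub>N ?n \<^bold>\<longrightarrow> (\<^bold>\<forall>''z'' \<^bold>: \<sigma>. V ''z'' \<^bold>\<in> L \<^bold>\<longrightarrow> h \<^bold>\<le> d \<^bold>\<cdot> \<langle>?p \<^bold>\<cdot> ?k, V ''z''\<rangle>))"
              using all_elim[OF mono[OF far 1(1)], of ?k] by simp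
            from all_elim[OF imp_elim[OF this and_elim1[OF k]], of ?c]
            have "\<Delta>6 \<tturnstile> (?c \<^bold>\<in> L \<^bold>\<longrightarrow> h \<^bold>\<le> d \<^bold>\<cdot> \<langle>?p \<^bold>\<cdot> ?k, ?c\<rangle>)"
              by simp
            from imp_elim[OF this mono[OF c 1(1)]] have "\<Delta>6 \<tturnstile> (h \<^bold>\<le> d \<^bold>\<cdot> \<langle>?c, ?p \<^bold>\<cdot> ?k\<rangle>)"
              by (rule le_trans[OF _ eq_le[OF metric_commute[OF mono[OF M 1(1)]]]]) (use h in auto)
            then show ?case
              using and_elim2[OF k] by (rule le_less_contradiction)
          qed
        qed
      qed
    qed
  qed auto
qed

section \<open>Approximating sequences\<close>

abbreviation pt :: "nat \<Rightarrow> tm \<Rightarrow> tm" where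
  "pt a n \<equiv> Proj1 (Par (\<^bold>N \<^bold>\<rightarrow> \<sigma> \<^bold>\<times> \<^bold>R) a \<^bold>\<cdot> n)"

abbreviation rad :: "nat \<Rightarrow> tm \<Rightarrow> tm" where
  "rad a n \<equiv> Proj2 (Par (\<^bold>N \<^bold>\<rightarrow> \<sigma> \<^bold>\<times> \<^bold>R) a \<^bold>\<cdot> n)"

text \<open>The sequence consists of pairs, each point carrying its own radius. Halving is then a
  relation between consecutive radii, and no powers of two have to be defined.\<close>

definition approximation :: "nat \<Rightarrow> fm" where
  "approximation a = (\<^bold>\<forall>''n'' \<^bold>: \<^bold>N.
    (\<^bold>0 \<^bold>< rad a (V ''n'') \<^bold>\<and> near (pt a (V ''n'')) (rad a (V ''n''))) \<^bold>\<and>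
    (d \<^bold>\<cdot> \<langle>pt a (V ''n''), pt a (Succ (V ''n''))\<rangle> \<^bold>< rad a (V ''n'') \<^bold>\<and>
     rad a (Succ (V ''n'')) \<^bold>+ rad a (Succ (V ''n'')) \<^bold>= rad a (V ''n'')))"

lemma approximationD:
  assumes "\<Gamma> \<tturnstile> approximation a" and n: "has_ty n \<^bold>N"
  shows "\<Gamma> \<tturnstile> (\<^bold>0 \<^bold>< rad a n)" "\<Gamma> \<tturnstile> near (pt a n) (rad a n)"
    "\<Gamma> \<tturnstile> (d \<^bold>\<cdot> \<langle>pt a n, pt a (Succ n)\<rangle> \<^bold>< rad a n)"
    "\<Gamma> \<tturnstile> (rad a (Succ n) \<^bold>+ rad a (Succ n) \<^bold>= rad a n)"
proof -
  have *: "\<Gamma> \<tturnstile> ((\<^bold>0 \<^bold>< rad a n \<^bold>\<and> near (pt a n) (rad a n)) \<^bold>\<and>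
    (d \<^bold>\<cdot> \<langle>pt a n, pt a (Succ n)\<rangle> \<^bold>< rad a n \<^bold>\<and> rad a (Succ n) \<^bold>+ rad a (Succ n) \<^bold>= rad a n))"
    using all_elim[OF assms(1)[unfolded approximation_def] n] by simp
  show "\<Gamma> \<tturnstile> (\<^bold>0 \<^bold>< rad a n)" "\<Gamma> \<tturnstile> near (pt a n) (rad a n)"
    "\<Gamma> \<tturnstile> (d \<^bold>\<cdot> \<langle>pt a n, pt a (Succ n)\<rangle> \<^bold>< rad a n)"
    "\<Gamma> \<tturnstile> (rad a (Succ n) \<^bold>+ rad a (Succ n) \<^bold>= rad a n)"
    using * by (blast intro: and_elim1 and_elim2)+
qed

lemma near_step:
  assumes Q: "\<Gamma> \<tturnstile> quasilocated \<sigma> d L" and M: "\<Gamma> \<tturnstile> metric \<sigma> d" and B: "\<Gamma> \<tturnstile> balls_totally_bounded \<sigma> d"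
    and x: "has_ty x \<sigma>" and r: "real_tm r" "\<Gamma> \<tturnstile> (\<^bold>0 \<^bold>< r)" and e: "real_tm e" "\<Gamma> \<tturnstile> (\<^bold>0 \<^bold>< e)"
    and near: "\<Gamma> \<tturnstile> near x r"
  shows "\<Gamma> \<tturnstile> (\<^bold>\<exists>''y'' \<^bold>: \<sigma>. d \<^bold>\<cdot> \<langle>x, V ''y''\<rangle> \<^bold>< r \<^bold>\<and> near (V ''y'') e)"
proof (rule ex_elim[OF half_exists[OF e(1)]], goal_cases)
  case (1 \<Delta> h)
  note [simp] = x[THEN has_ty_closed] r(1)[THEN has_ty_closed] e(1)[THEN has_ty_closed]
  let ?h = "Par \<^bold>R h"
  have h: "\<Delta> \<tturnstile> (?h \<^bold>+ ?h \<^bold>= e)"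
    using 1(2) by simp
  have hpos: "\<Delta> \<tturnstile> (\<^bold>0 \<^bold>< ?h)"
    by (rule half_pos[OF h mono[OF e(2) 1(1)]]) (use e in auto)
  show ?case
  proof (rule ex_elim[OF near_step_double[OF Q[THEN mono] M[THEN mono] B[THEN mono] x r(1) r(2)[THEN mono] _ hpos near[THEN mono]]],
      goal_cases)
    case (7 \<Delta>1 y)
    let ?y = "Par \<sigma> y"
    from 7(2) have y: "\<Delta>1 \<tturnstile> (d \<^bold>\<cdot> \<langle>x, ?y\<rangle> \<^bold>< r \<^bold>\<and> near ?y (?h \<^bold>+ ?h))"
      by simp
    have "\<Delta>1 \<tturnstile> near ?y e"
    proof (rule near_mono[OF and_elim2[OF y]])
      show "\<Delta>' \<tturnstile> (d \<^bold>\<cdot> \<langle>?y, Par \<sigma> c\<rangle> \<^bold>< e)"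
        if "\<Delta>1 |\<subseteq>| \<Delta>'" "\<Delta>' \<tturnstile> (d \<^bold>\<cdot> \<langle>?y, Par \<sigma> c\<rangle> \<^bold>< ?h \<^bold>+ ?h)" for \<Delta>' c
        by (rule less_le_trans[OF that(2) eq_le[OF mono[OF mono[OF h 7(1)] that(1)]]]) (use e in auto)
    qed (use e in auto)
    then show ?case
      by (intro ex_intro[of ?y]) (auto intro!: and_intro and_elim1[OF y])
  qed (use 1 in auto)
qed

text \<open>Dependent choice is applied to the set of pairs \<open>(y, e)\<close> with
  \<open>0 < e\<close> and \<open>near y e\<close>, and to the relation asking that the next point
  lie closer than the current radius and that the radius be halved. Every such pair has a successor
  by \<open>near_step\<close>, used with half of the current radius as target.\<close>

lemma approximation_exists:
  assumes Q: "\<Gamma> \<tturnstile> quasilocated \<sigma> d L" and M: "\<Gamma> \<tturnstile> metric \<sigma> d" and B: "\<Gamma> \<tturnstile> balls_totally_bounded \<sigma> d"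
    and near: "\<Gamma> \<tturnstile> near (Par \<sigma> x) (Par \<^bold>R h)" "\<Gamma> \<tturnstile> (\<^bold>0 \<^bold>< Par \<^bold>R h)"
    and R: "\<And>\<Delta> a. \<Gamma> |\<subseteq>| \<Delta> \<Longrightarrow> \<Delta> \<tturnstile> approximation a \<Longrightarrow> \<Delta> \<tturnstile> (pt a \<^bold>0\<^sub>N \<^bold>= Par \<sigma> x) \<Longrightarrow>
      \<Delta> \<tturnstile> (rad a \<^bold>0\<^sub>N \<^bold>= Par \<^bold>R h) \<Longrightarrow> \<Delta> \<tturnstile> r"
  shows "\<Gamma> \<tturnstile> r"
proof (rule comprehension_elim[where x = "''w''" and \<sigma> = "\<sigma> \<^bold>\<times> \<^bold>R" and
    p = "\<^bold>0 \<^bold>< Proj2 (V ''w'') \<^bold>\<and> near (Proj1 (V ''w'')) (Proj2 (V ''w''))"], goal_cases)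
  case (3 \<Delta>1 a)
  note sub1 = 3(1) and A0 = 3(2)
  show ?case
  proof (rule comprehension_elim[where x = "''w''" and \<sigma> = "(\<sigma> \<^bold>\<times> \<^bold>R) \<^bold>\<times> (\<sigma> \<^bold>\<times> \<^bold>R)" and
      p = "d \<^bold>\<cdot> \<langle>Proj1 (Proj1 (V ''w'')), Proj1 (Proj2 (V ''w''))\<rangle> \<^bold>< Proj2 (Proj1 (V ''w'')) \<^bold>\<and>
        Proj2 (Proj2 (V ''w'')) \<^bold>+ Proj2 (Proj2 (V ''w'')) \<^bold>= Proj2 (Proj1 (V ''w''))"], goal_cases)
    case (3 \<Delta> q)
    let ?A = "Par (TPow (\<sigma> \<^bold>\<times> \<^bold>R)) a" and ?Q = "Par (TPow ((\<sigma> \<^bold>\<times> \<^bold>R) \<^bold>\<times> (\<sigma> \<^bold>\<times> \<^bold>R))) q"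
    let ?x = "\<langle>Par \<sigma> x, Par \<^bold>R h\<rangle>"
    have sub: "\<Gamma> |\<subseteq>| \<Delta>"
      using sub1 3(1) by simp
    have A: "\<Delta>' \<tturnstile> (w \<^bold>\<in> ?A) \<longleftrightarrow> \<Delta>' \<tturnstile> (\<^bold>0 \<^bold>< Proj2 w \<^bold>\<and> near (Proj1 w) (Proj2 w))"
      if "\<Delta> |\<subseteq>| \<Delta>'" "has_ty w (\<sigma> \<^bold>\<times> \<^bold>R)" for \<Delta>' w
      using iff_forces[OF mono[OF A0], of w \<Delta>'] that 3(1) by simp
    have A_pair: "\<Delta>' \<tturnstile> (\<langle>y, e\<rangle> \<^bold>\<in> ?A) \<longleftrightarrow> \<Delta>' \<tturnstile> (\<^bold>0 \<^bold>< e \<^bold>\<and> near y e)"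
      if "\<Delta> |\<subseteq>| \<Delta>'" and y: "has_ty y \<sigma>" and e: "real_tm e" for \<Delta>' y e
      using A[OF that(1), of "\<langle>y, e\<rangle>"] y e
        subst_proj_pair_iff[OF y e, of "''u''" "''v''" \<Delta>' "\<^bold>0 \<^bold>< V ''v'' \<^bold>\<and> near (V ''u'') (V ''v'')"]
      by (simp add: has_ty_closed)
    have Q_pair: "\<Delta>' \<tturnstile> (\<langle>v, w\<rangle> \<^bold>\<in> ?Q) \<longleftrightarrow>
        \<Delta>' \<tturnstile> (d \<^bold>\<cdot> \<langle>Proj1 v, Proj1 w\<rangle> \<^bold>< Proj2 v \<^bold>\<and> Proj2 w \<^bold>+ Proj2 w \<^bold>= Proj2 v)"
      if "\<Delta> |\<subseteq>| \<Delta>'" and v: "has_ty v (\<sigma> \<^bold>\<times> \<^bold>R)" and w: "has_ty w (\<sigma> \<^bold>\<times> \<^bold>R)" for \<Delta>' v w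
      using iff_forces[OF mono[OF 3(2) that(1)], of "\<langle>v, w\<rangle>"] v w
        subst_proj_pair_iff[OF v w, of "''u''" "''v''" \<Delta>'
          "d \<^bold>\<cdot> \<langle>Proj1 (V ''u''), Proj1 (V ''v'')\<rangle> \<^bold>< Proj2 (V ''u'') \<^bold>\<and>
           Proj2 (V ''v'') \<^bold>+ Proj2 (V ''v'') \<^bold>= Proj2 (V ''u'')"]
      by (simp add: has_ty_closed)
    have "\<Delta> \<tturnstile> (\<^bold>\<forall>''x'' \<^bold>: \<sigma> \<^bold>\<times> \<^bold>R. V ''x'' \<^bold>\<in> ?A \<^bold>\<longrightarrow>
            (\<^bold>\<exists>''y'' \<^bold>: \<sigma> \<^bold>\<times> \<^bold>R. V ''y'' \<^bold>\<in> ?A \<^bold>\<and> \<langle>V ''x'', V ''y''\<rangle> \<^bold>\<in> ?Q))"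
    proof (rule all_intro, simp, rule imp_intro)
      fix v \<Delta>2
      let ?v = "Par (\<sigma> \<^bold>\<times> \<^bold>R) v"
      assume sub2: "\<Delta> |\<subseteq>| \<Delta>2" and "\<Delta>2 \<tturnstile> (?v \<^bold>\<in> ?A)"
      then have v: "\<Delta>2 \<tturnstile> (\<^bold>0 \<^bold>< Proj2 ?v \<^bold>\<and> near (Proj1 ?v) (Proj2 ?v))"
        by (simp add: A)
      show "\<Delta>2 \<tturnstile> (\<^bold>\<exists>''y'' \<^bold>: \<sigma> \<^bold>\<times> \<^bold>R. V ''y'' \<^bold>\<in> ?A \<^bold>\<and> \<langle>?v, V ''y''\<rangle> \<^bold>\<in> ?Q)"
      proof (rule ex_elim[OF half_exists[of "Proj2 ?v"]], goal_cases)
        case (2 \<Delta>3 g)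
        let ?g = "Par \<^bold>R g"
        have g: "\<Delta>3 \<tturnstile> (?g \<^bold>+ ?g \<^bold>= Proj2 ?v)"
          using 2(2) by simp
        have gpos: "\<Delta>3 \<tturnstile> (\<^bold>0 \<^bold>< ?g)"
          by (rule half_pos[OF g mono[OF and_elim1[OF v] 2(1)]]) auto
        have sub3: "\<Gamma> |\<subseteq>| \<Delta>3"
          using sub sub2 2(1) by simp
        have "\<Delta>3 \<tturnstile> (\<^bold>\<exists>''y'' \<^bold>: \<sigma>. d \<^bold>\<cdot> \<langle>Proj1 ?v, V ''y''\<rangle> \<^bold>< Proj2 ?v \<^bold>\<and> near (V ''y'') ?g)"
          by (rule near_step[OF mono[OF Q sub3] mono[OF M sub3] mono[OF B sub3]])
            (use gpos mono[OF and_elim1[OF v] 2(1)] mono[OF and_elim2[OF v] 2(1)] in auto)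
        then show ?case
        proof (rule ex_elim, goal_cases)
          case (1 \<Delta>4 y)
          let ?y = "Par \<sigma> y"
          let ?w = "\<langle>?y, ?g\<rangle>"
          from 1(2) have y: "\<Delta>4 \<tturnstile> (d \<^bold>\<cdot> \<langle>Proj1 ?v, ?y\<rangle> \<^bold>< Proj2 ?v \<^bold>\<and> near ?y ?g)"
            by simp
          have sub4: "\<Delta> |\<subseteq>| \<Delta>4"
            using sub2 2(1) 1(1) by simp
          have "\<Delta>4 \<tturnstile> (?w \<^bold>\<in> ?A)"
            using and_intro[OF mono[OF gpos 1(1)] and_elim2[OF y]] by (simp add: A_pair sub4)
          moreover have "\<Delta>4 \<tturnstile> (\<langle>?v, ?w\<rangle> \<^bold>\<in> ?Q)"
            using and_intro[OF and_elim1[OF y] mono[OF g 1(1)]]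
              subst_proj_pair_iff[of ?y \<sigma> ?g "\<^bold>R" "''u''" "''v''" \<Delta>4
                "d \<^bold>\<cdot> \<langle>Proj1 ?v, V ''u''\<rangle> \<^bold>< Proj2 ?v \<^bold>\<and> V ''v'' \<^bold>+ V ''v'' \<^bold>= Proj2 ?v"]
            by (simp add: Q_pair sub4)
          ultimately show ?case
            by (intro ex_intro[of ?w]) (auto intro: and_intro)
        qed
      qed simp
    qed
    moreover have "\<Delta> \<tturnstile> dependent_choice (\<sigma> \<^bold>\<times> \<^bold>R)"
      by (rule axiom) (simp add: DC_def)
    note all_elim2[OF this[unfolded dependent_choice_def], of ?A ?Q]
    ultimately have "\<Delta> \<tturnstile> (\<^bold>\<forall>''a'' \<^bold>: \<sigma> \<^bold>\<times> \<^bold>R. V ''a'' \<^bold>\<in> ?A \<^bold>\<longrightarrow>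
            (\<^bold>\<exists>''s'' \<^bold>: \<^bold>N \<^bold>\<rightarrow> \<sigma> \<^bold>\<times> \<^bold>R. V ''s'' \<^bold>\<cdot> \<^bold>0\<^sub>N \<^bold>= V ''a'' \<^bold>\<and>
                (\<^bold>\<forall>''n'' \<^bold>: \<^bold>N. V ''s'' \<^bold>\<cdot> V ''n'' \<^bold>\<in> ?A \<^bold>\<and>
                    \<langle>V ''s'' \<^bold>\<cdot> V ''n'', V ''s'' \<^bold>\<cdot> Succ (V ''n'')\<rangle> \<^bold>\<in> ?Q)))"
      by (auto intro: imp_elim)
    from all_elim[OF this, of ?x]
    have "\<Delta> \<tturnstile> (?x \<^bold>\<in> ?A \<^bold>\<longrightarrow>
            (\<^bold>\<exists>''s'' \<^bold>: \<^bold>N \<^bold>\<rightarrow> \<sigma> \<^bold>\<times> \<^bold>R. V ''s'' \<^bold>\<cdot> \<^bold>0\<^sub>N \<^bold>= ?x \<^bold>\<and>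
                (\<^bold>\<forall>''n'' \<^bold>: \<^bold>N. V ''s'' \<^bold>\<cdot> V ''n'' \<^bold>\<in> ?A \<^bold>\<and>
                    \<langle>V ''s'' \<^bold>\<cdot> V ''n'', V ''s'' \<^bold>\<cdot> Succ (V ''n'')\<rangle> \<^bold>\<in> ?Q)))"
      by simp
    moreover have "\<Delta> \<tturnstile> (?x \<^bold>\<in> ?A)"
      using and_intro[OF mono[OF near(2) sub] mono[OF near(1) sub]] by (simp add: A_pair)
    ultimately have "\<Delta> \<tturnstile> (\<^bold>\<exists>''s'' \<^bold>: \<^bold>N \<^bold>\<rightarrow> \<sigma> \<^bold>\<times> \<^bold>R. V ''s'' \<^bold>\<cdot> \<^bold>0\<^sub>N \<^bold>= ?x \<^bold>\<and>
                (\<^bold>\<forall>''n'' \<^bold>: \<^bold>N. V ''s'' \<^bold>\<cdot> V ''n'' \<^bold>\<in> ?A \<^bold>\<and>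
                    \<langle>V ''s'' \<^bold>\<cdot> V ''n'', V ''s'' \<^bold>\<cdot> Succ (V ''n'')\<rangle> \<^bold>\<in> ?Q))"
      by (rule imp_elim)
    then show ?case
    proof (rule ex_elim, goal_cases)
      case (1 \<Delta>2 s)
      let ?s = "Par (\<^bold>N \<^bold>\<rightarrow> \<sigma> \<^bold>\<times> \<^bold>R) s"
      from 1(2) have s: "\<Delta>2 \<tturnstile> (?s \<^bold>\<cdot> \<^bold>0\<^sub>N \<^bold>= ?x \<^bold>\<and> (\<^bold>\<forall>''n'' \<^bold>: \<^bold>N. ?s \<^bold>\<cdot> V ''n'' \<^bold>\<in> ?A \<^bold>\<and>
                    \<langle>?s \<^bold>\<cdot> V ''n'', ?s \<^bold>\<cdot> Succ (V ''n'')\<rangle> \<^bold>\<in> ?Q))"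
        by simp
      show ?case
      proof (rule R)
        show "\<Gamma> |\<subseteq>| \<Delta>2"
          using sub 1(1) by simp
        have "\<Delta>2 \<tturnstile> (pt s \<^bold>0\<^sub>N \<^bold>= Proj1 ?x)" "\<Delta>2 \<tturnstile> (rad s \<^bold>0\<^sub>N \<^bold>= Proj2 ?x)"
          using eq_cong[OF and_elim1[OF s], of "\<sigma> \<^bold>\<times> \<^bold>R" "''x''" "Proj1 (V ''x'')" \<sigma>]
            eq_cong[OF and_elim1[OF s], of "\<sigma> \<^bold>\<times> \<^bold>R" "''x''" "Proj2 (V ''x'')" "\<^bold>R"] by simp_all
        then show "\<Delta>2 \<tturnstile> (pt s \<^bold>0\<^sub>N \<^bold>= Par \<sigma> x)" "\<Delta>2 \<tturnstile> (rad s \<^bold>0\<^sub>N \<^bold>= Par \<^bold>R h)"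
          using eq_trans[OF _ proj1_pair, of \<Delta>2 "pt s \<^bold>0\<^sub>N" "Par \<sigma> x" "Par \<^bold>R h" \<sigma> "\<^bold>R" \<sigma>]
            eq_trans[OF _ proj2_pair, of \<Delta>2 "rad s \<^bold>0\<^sub>N" "Par \<sigma> x" "Par \<^bold>R h" \<sigma> "\<^bold>R" "\<^bold>R"]
            has_ty.intros(11)[of ?x \<sigma> "\<^bold>R"] has_ty.intros(12)[of ?x \<sigma> "\<^bold>R"] by auto
        show "\<Delta>2 \<tturnstile> approximation s"
          unfolding approximation_def
        proof (rule all_intro, simp)
          fix n
          let ?n = "Par \<^bold>N n"
          have "\<Delta>2 \<tturnstile> (?s \<^bold>\<cdot> ?n \<^bold>\<in> ?A \<^bold>\<and> \<langle>?s \<^bold>\<cdot> ?n, ?s \<^bold>\<cdot> Succ ?n\<rangle> \<^bold>\<in> ?Q)"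
            using all_elim[OF and_elim2[OF s], of ?n] by simp
          from and_elim1[OF this] and_elim2[OF this]
          show "\<Delta>2 \<tturnstile> ((\<^bold>0 \<^bold>< rad s ?n \<^bold>\<and> near (pt s ?n) (rad s ?n)) \<^bold>\<and>
            d \<^bold>\<cdot> \<langle>pt s ?n, pt s (Succ ?n)\<rangle> \<^bold>< rad s ?n \<^bold>\<and>
            rad s (Succ ?n) \<^bold>+ rad s (Succ ?n) \<^bold>= rad s ?n)"
            by (simp add: A Q_pair 1(1) and_intro)
        qed
      qed
    qed
  qed auto
qed auto

text \<open>Exponential decay is replaced by a linear estimate. With \<open>h\<close> half of
  \<open>c\<close>, a halving that leaves the radius above \<open>h\<close> has lowered it by more
  than \<open>h\<close>, and this cannot go on beyond \<open>rad a 0 / h\<close> times.\<close>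

lemma rad_small:
  assumes S: "\<Gamma> \<tturnstile> approximation a" and c: "real_tm c" "\<Gamma> \<tturnstile> (\<^bold>0 \<^bold>< c)"
  shows "\<Gamma> \<tturnstile> (\<^bold>\<exists>''n'' \<^bold>: \<^bold>N. rad a (V ''n'') \<^bold>< c)"
proof (rule ex_elim[OF half_exists[OF c(1)]], goal_cases)
  case (1 \<Delta> h)
  note [simp] = c(1)[THEN has_ty_closed]
  let ?h = "Par \<^bold>R h"
  note S = mono[OF S 1(1)] and cpos = mono[OF c(2) 1(1)]
  have h: "\<Delta> \<tturnstile> (?h \<^bold>+ ?h \<^bold>\<le> c)" and hpos: "\<Delta> \<tturnstile> (\<^bold>0 \<^bold>< ?h)"
    using eq_le[of \<Delta> "?h \<^bold>+ ?h" c] half_pos[of \<Delta> ?h c] 1(2) c cpos by simp_all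
  show ?case
  proof (rule ex_elim[OF inverse_exists[OF _ hpos]], goal_cases)
    case (2 \<Delta>1 g)
    let ?g = "Par \<^bold>R g"
    have g: "\<Delta>1 \<tturnstile> (?h \<^bold>* ?g \<^bold>= \<^bold>1)"
      using 2(2) by simp
    note S = mono[OF S 2(1)] and h = mono[OF h 2(1)] and hpos = mono[OF hpos 2(1)]
    \<comment> \<open>Since \<open>g\<close> is an inverse of \<open>h\<close>, a number
      \<open>n\<close> above \<open>rad a 0 * g\<close> satisfies
      \<open>n * h > rad a 0\<close>.\<close>
    show ?case
    proof (rule ex_elim[OF archimedean[of "rad a \<^bold>0\<^sub>N \<^bold>* ?g"]], goal_cases)
      case (2 \<Delta>2 n)
      let ?n = "Par \<^bold>N n"
      have n: "\<Delta>2 \<tturnstile> (rad a \<^bold>0\<^sub>N \<^bold>* ?g \<^bold>< OfNat ?n)"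
        using 2(2) by simp
      note S = mono[OF S 2(1)] and h = mono[OF h 2(1)] and hpos = mono[OF hpos 2(1)]
        and g = mono[OF g 2(1)]
      \<comment> \<open>The invariant: up to \<open>n\<close> every halving has cost at least
        \<open>h\<close>, or the radius is already below \<open>c\<close>. The disjunction is needed
        because one cannot decide exactly when the radius passes \<open>c\<close>.\<close>
      have "\<Delta>2 \<tturnstile> subst ''n'' ?n (rad a (V ''n'') \<^bold>+ OfNat (V ''n'') \<^bold>* ?h \<^bold>\<le> rad a \<^bold>0\<^sub>N \<^bold>\<or> rad a (V ''n'') \<^bold>< c)"
      proof (rule nat_induct_forces, simp_all, goal_cases)
        case 1
        have "\<Delta>2 \<tturnstile> (OfNat \<^bold>0\<^sub>N \<^bold>* ?h \<^bold>= \<^bold>0 \<^bold>* ?h)"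
          using eq_cong[OF OfNat_zero, of "\<^bold>R" "''x''" "V ''x'' \<^bold>* ?h" "\<^bold>R"] by simp
        then have "\<Delta>2 \<tturnstile> (OfNat \<^bold>0\<^sub>N \<^bold>* ?h \<^bold>\<le> \<^bold>0 \<^bold>* ?h)"
          by (rule eq_le) auto
        then show ?case
          by (intro or_intro1) (rule le_shift, auto simp: algebra_simps)
      next
        case (2 \<Delta>3 k)
        let ?k = "Par \<^bold>N k"
        note S = mono[OF S 2(1)] and h = mono[OF h 2(1)] and hpos = mono[OF hpos 2(1)]
        have half: "\<Delta>3 \<tturnstile> (rad a (Succ ?k) \<^bold>+ rad a (Succ ?k) \<^bold>\<le> rad a ?k)"
          by (rule eq_le[OF approximationD(4)[OF S]]) auto
        from 2(2) show ?case
        proof (rule or_elim)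
          fix \<Delta>4 assume sub4: "\<Delta>3 |\<subseteq>| \<Delta>4" and IH: "\<Delta>4 \<tturnstile> (rad a ?k \<^bold>+ OfNat ?k \<^bold>* ?h \<^bold>\<le> rad a \<^bold>0\<^sub>N)"
          have "\<Delta>4 \<tturnstile> (?h \<^bold>< c)"
            by (rule mono[OF less_shift[OF add_le_less_mono[OF h hpos]] sub4])
              (use c in \<open>auto simp: algebra_simps\<close>)
          \<comment> \<open>The separation \<open>h < c\<close> allows the next radius to be
            compared with it; each outcome gives one side of the invariant.\<close>
          then have "\<Delta>4 \<tturnstile> (?h \<^bold>< rad a (Succ ?k) \<^bold>\<or> rad a (Succ ?k) \<^bold>< c)"
            by (rule less_cotrans[rotated 3]) (use c in auto)
          then show "\<Delta>4 \<tturnstile> (rad a (Succ ?k) \<^bold>+ OfNat (Succ ?k) \<^bold>* ?h \<^bold>\<le> rad a \<^bold>0\<^sub>N \<^bold>\<or> rad a (Succ ?k) \<^bold>< c)"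
          proof (rule or_elim)
            fix \<Delta>5 assume sub5: "\<Delta>4 |\<subseteq>| \<Delta>5" and "\<Delta>5 \<tturnstile> (?h \<^bold>< rad a (Succ ?k))"
            then have less: "\<Delta>5 \<tturnstile> (?h \<^bold>\<le> rad a (Succ ?k))"
              by (intro less_imp_le) auto
            have "\<Delta>5 \<tturnstile> (OfNat (Succ ?k) \<^bold>* ?h \<^bold>= (OfNat ?k \<^bold>+ \<^bold>1) \<^bold>* ?h)"
              using eq_cong[OF OfNat_Succ, of ?k "\<^bold>R" "''x''" "V ''x'' \<^bold>* ?h" "\<^bold>R"] by simp
            then have suc: "\<Delta>5 \<tturnstile> (OfNat (Succ ?k) \<^bold>* ?h \<^bold>\<le> (OfNat ?k \<^bold>+ \<^bold>1) \<^bold>* ?h)"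
              by (rule eq_le) auto
            \<comment> \<open>The new radius equals the old one minus itself, hence is at most the
              old one minus \<open>h\<close>; the lost \<open>h\<close> pays for the additional
              summand in \<open>OfNat (Succ k) * h\<close>.\<close>
            have "\<Delta>5 \<tturnstile> (rad a (Succ ?k) \<^bold>+ OfNat (Succ ?k) \<^bold>* ?h \<^bold>\<le> rad a \<^bold>0\<^sub>N)"
              by (rule le_shift[OF add_le_mono[OF add_le_mono[OF mono[OF IH sub5] less]
                      add_le_mono[OF mono[OF mono[OF half sub4] sub5] suc]]])
                (auto simp: algebra_simps)
            then show "\<Delta>5 \<tturnstile> (rad a (Succ ?k) \<^bold>+ OfNat (Succ ?k) \<^bold>* ?h \<^bold>\<le> rad a \<^bold>0\<^sub>N \<^bold>\<or> rad a (Succ ?k) \<^bold>< c)"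
              by (rule or_intro1)
          qed (rule or_intro2)
        next
          fix \<Delta>4 assume sub4: "\<Delta>3 |\<subseteq>| \<Delta>4" and less: "\<Delta>4 \<tturnstile> (rad a ?k \<^bold>< c)"
          have pos: "\<Delta>4 \<tturnstile> (\<^bold>0 \<^bold>< rad a (Succ ?k))"
            by (rule approximationD[OF mono[OF S sub4]]) simp
          have "\<Delta>4 \<tturnstile> (rad a (Succ ?k) \<^bold>< c)"
            by (rule less_shift[OF add_le_less_mono[OF mono[OF half sub4] add_less_mono[OF less pos]]])
              (use c in \<open>auto simp: algebra_simps\<close>)
          then show "\<Delta>4 \<tturnstile> (rad a (Succ ?k) \<^bold>+ OfNat (Succ ?k) \<^bold>* ?h \<^bold>\<le> rad a \<^bold>0\<^sub>N \<^bold>\<or> rad a (Succ ?k) \<^bold>< c)"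
            by (rule or_intro2)
        qed
      qed
      then have "\<Delta>2 \<tturnstile> (rad a ?n \<^bold>+ OfNat ?n \<^bold>* ?h \<^bold>\<le> rad a \<^bold>0\<^sub>N \<^bold>\<or> rad a ?n \<^bold>< c)"
        by simp
      then show ?case
      proof (rule or_elim)
        fix \<Delta>3 assume sub3: "\<Delta>2 |\<subseteq>| \<Delta>3" and le: "\<Delta>3 \<tturnstile> (rad a ?n \<^bold>+ OfNat ?n \<^bold>* ?h \<^bold>\<le> rad a \<^bold>0\<^sub>N)"
        have "\<Delta>3 \<tturnstile> (\<^bold>0 \<^bold>< OfNat ?n \<^bold>+ RNeg (rad a \<^bold>0\<^sub>N \<^bold>* ?g))"
          by (rule less_shift[OF mono[OF n sub3]]) (auto simp: algebra_simps)
        from mult_pos[OF _ _ this mono[OF hpos sub3]]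
        have pos: "\<Delta>3 \<tturnstile> (\<^bold>0 \<^bold>< (OfNat ?n \<^bold>+ RNeg (rad a \<^bold>0\<^sub>N \<^bold>* ?g)) \<^bold>* ?h)"
          by simp
        have "\<Delta>3 \<tturnstile> (rad a \<^bold>0\<^sub>N \<^bold>* (?h \<^bold>* ?g) \<^bold>= rad a \<^bold>0\<^sub>N \<^bold>* \<^bold>1)"
          using eq_cong[OF mono[OF g sub3], of "\<^bold>R" "''x''" "rad a \<^bold>0\<^sub>N \<^bold>* V ''x''" "\<^bold>R"] by simp
        then have inv: "\<Delta>3 \<tturnstile> (rad a \<^bold>0\<^sub>N \<^bold>* \<^bold>1 \<^bold>\<le> rad a \<^bold>0\<^sub>N \<^bold>* (?h \<^bold>* ?g))"
          by (rule eq_ge) auto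
        have radpos: "\<Delta>3 \<tturnstile> (\<^bold>0 \<^bold>< rad a ?n)"
          by (rule approximationD[OF mono[OF S sub3]]) simp
        \<comment> \<open>The first alternative contradicts the choice of \<open>n\<close>: it
          bounds \<open>n * h\<close> by \<open>rad a 0\<close>, while \<open>pos\<close> together
          with \<open>h * g = 1\<close> says that \<open>n * h\<close> exceeds
          \<open>rad a 0\<close>. Adding all four facts leaves \<open>0 < 0\<close>.\<close>
        have "\<Delta>3 \<tturnstile> (\<^bold>0 \<^bold>< \<^bold>0)"
          by (rule less_shift[OF add_le_less_mono[OF add_le_mono[OF le inv] add_less_mono[OF pos radpos]]])
            (auto simp: algebra_simps)
        then show "\<Delta>3 \<tturnstile> (\<^bold>\<exists>''n'' \<^bold>: \<^bold>N. rad a (V ''n'') \<^bold>< c)"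
          by (rule bot_elim[OF less_irrefl]) simp
      next
        fix \<Delta>3 assume "\<Delta>3 \<tturnstile> (rad a ?n \<^bold>< c)"
        then show "\<Delta>3 \<tturnstile> (\<^bold>\<exists>''n'' \<^bold>: \<^bold>N. rad a (V ''n'') \<^bold>< c)"
          by (intro ex_intro[of ?n]) auto
      qed
    qed simp
  qed simp
qed

section \<open>Convergence of approximating sequences\<close>

lemma rad_double_small:
  assumes S: "\<Gamma> \<tturnstile> approximation a" and c: "real_tm c" "\<Gamma> \<tturnstile> (\<^bold>0 \<^bold>< c)"
  shows "\<Gamma> \<tturnstile> (\<^bold>\<exists>''n'' \<^bold>: \<^bold>N. rad a (V ''n'') \<^bold>+ rad a (V ''n'') \<^bold>< c)"
proof (rule ex_elim[OF half_exists[OF c(1)]], goal_cases)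
  case (1 \<Delta> h)
  note [simp] = c(1)[THEN has_ty_closed]
  let ?h = "Par \<^bold>R h"
  have h: "\<Delta> \<tturnstile> (?h \<^bold>+ ?h \<^bold>= c)"
    using 1(2) by simp
  have hpos: "\<Delta> \<tturnstile> (\<^bold>0 \<^bold>< ?h)"
    by (rule half_pos[OF h mono[OF c(2) 1(1)]]) (use c in auto)
  have "\<Delta> \<tturnstile> (\<^bold>\<exists>''n'' \<^bold>: \<^bold>N. rad a (V ''n'') \<^bold>< ?h)"
    by (rule rad_small[OF mono[OF S 1(1)] _ hpos]) simp
  then show ?case
  proof (rule ex_elim, goal_cases)
    case (1 \<Delta>1 n)
    let ?n = "Par \<^bold>N n"
    have n: "\<Delta>1 \<tturnstile> (rad a ?n \<^bold>< ?h)"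
      using 1(2) by simp
    have "\<Delta>1 \<tturnstile> (rad a ?n \<^bold>+ rad a ?n \<^bold>< c)"
      by (rule less_le_trans[OF add_less_mono[OF n n] eq_le[OF mono[OF h 1(1)]]]) (use c in auto)
    then show ?case
      by (intro ex_intro[of ?n]) auto
  qed
qed

text \<open>The steps from index \<open>k\<close> on sum to less than
  \<open>rad + rad / 2 + ...\<close>, that is, twice the radius at \<open>k\<close>. Telescoping
  replaces the geometric series.\<close>

lemma dist_tail:
  assumes S: "\<Gamma> \<tturnstile> approximation a" and M: "\<Gamma> \<tturnstile> metric \<sigma> d" and k: "has_ty k \<^bold>N" and j: "has_ty j \<^bold>N"
    and kj: "\<Gamma> \<tturnstile> (k \<^bold><\<^sub>N j)"
  shows "\<Gamma> \<tturnstile> (d \<^bold>\<cdot> \<langle>pt a k, pt a j\<rangle> \<^bold>< rad a k \<^bold>+ rad a k)"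
proof -
  note [simp] = k[THEN has_ty_closed] j[THEN has_ty_closed]
  \<comment> \<open>The claim is strengthened by the reserve \<open>2 rad j\<close> for the
    remaining steps: the next step costs at most \<open>rad j\<close>, and the new reserve
    \<open>2 rad (j + 1)\<close> is exactly \<open>rad j\<close>. Strictness is recovered at the end
    from positivity of \<open>rad j\<close>.\<close>
  have "\<Gamma> \<tturnstile> subst ''j'' j (k \<^bold><\<^sub>N V ''j'' \<^bold>\<longrightarrow>
    d \<^bold>\<cdot> \<langle>pt a k, pt a (V ''j'')\<rangle> \<^bold>+ (rad a (V ''j'') \<^bold>+ rad a (V ''j'')) \<^bold>\<le> rad a k \<^bold>+ rad a k)"
  proof (rule nat_induct_forces[OF _ _ _ _ j], simp_all, goal_cases)
    case 1
    show ?case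
      by (rule imp_intro, rule bot_elim, rule less_zero[OF k])
  next
    case (2 \<Delta> j)
    let ?j = "Par \<^bold>N j"
    note S = mono[OF S 2(1)] and M = mono[OF M 2(1)] and IH = 2(2)
    have half: "\<Delta> \<tturnstile> (rad a (Succ ?j) \<^bold>+ rad a (Succ ?j) \<^bold>\<le> rad a ?j)"
      by (rule eq_le[OF approximationD(4)[OF S]]) auto
    have step: "\<Delta> \<tturnstile> (d \<^bold>\<cdot> \<langle>pt a ?j, pt a (Succ ?j)\<rangle> \<^bold>\<le> rad a ?j)"
      by (rule less_imp_le[OF approximationD(3)[OF S]]) auto
    show ?case
    proof (rule imp_intro)
      fix \<Delta>1 assume sub1: "\<Delta> |\<subseteq>| \<Delta>1" and "\<Delta>1 \<tturnstile> (k \<^bold><\<^sub>N Succ ?j)"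
      then have "\<Delta>1 \<tturnstile> (k \<^bold><\<^sub>N ?j \<^bold>\<or> k \<^bold>= ?j)"
        using k by (intro less_Succ_cases) auto
      then show "\<Delta>1 \<tturnstile> (d \<^bold>\<cdot> \<langle>pt a k, pt a (Succ ?j)\<rangle> \<^bold>+ (rad a (Succ ?j) \<^bold>+ rad a (Succ ?j))
        \<^bold>\<le> rad a k \<^bold>+ rad a k)"
      proof (rule or_elim)
        fix \<Delta>2 assume sub2: "\<Delta>1 |\<subseteq>| \<Delta>2" and kj: "\<Delta>2 \<tturnstile> (k \<^bold><\<^sub>N ?j)"
        have sub: "\<Delta> |\<subseteq>| \<Delta>2"
          using sub1 sub2 by simp
        have tri: "\<Delta>2 \<tturnstile> (d \<^bold>\<cdot> \<langle>pt a k, pt a (Succ ?j)\<rangle> \<^bold>\<le>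
          d \<^bold>\<cdot> \<langle>pt a k, pt a ?j\<rangle> \<^bold>+ d \<^bold>\<cdot> \<langle>pt a ?j, pt a (Succ ?j)\<rangle>)"
          by (rule metric_triangle[OF mono[OF M sub]]) (use k in auto)
        show "\<Delta>2 \<tturnstile> (d \<^bold>\<cdot> \<langle>pt a k, pt a (Succ ?j)\<rangle> \<^bold>+ (rad a (Succ ?j) \<^bold>+ rad a (Succ ?j))
          \<^bold>\<le> rad a k \<^bold>+ rad a k)"
          by (rule le_shift[OF add_le_mono[OF add_le_mono[OF imp_elim[OF mono[OF IH sub] kj] tri]
                  add_le_mono[OF mono[OF half sub] mono[OF step sub]]]])
            (use k in \<open>auto simp: algebra_simps\<close>)
      next
        fix \<Delta>2 assume sub2: "\<Delta>1 |\<subseteq>| \<Delta>2" and kj: "\<Delta>2 \<tturnstile> (k \<^bold>= ?j)"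
        have sub: "\<Delta> |\<subseteq>| \<Delta>2"
          using sub1 sub2 by simp
        have "\<Delta>2 \<tturnstile> (d \<^bold>\<cdot> \<langle>pt a ?j, pt a (Succ ?j)\<rangle> \<^bold>+ (rad a (Succ ?j) \<^bold>+ rad a (Succ ?j))
          \<^bold>\<le> rad a ?j \<^bold>+ rad a ?j)"
          by (rule add_le_mono[OF mono[OF step sub] mono[OF half sub]]) auto
        moreover have "\<Delta>2 \<tturnstile> (?j \<^bold>= k)"
          by (rule eq_sym[OF kj, where \<sigma> = "\<^bold>N"]) (use k in auto)
        ultimately show "\<Delta>2 \<tturnstile> (d \<^bold>\<cdot> \<langle>pt a k, pt a (Succ ?j)\<rangle> \<^bold>+ (rad a (Succ ?j) \<^bold>+ rad a (Succ ?j))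
          \<^bold>\<le> rad a k \<^bold>+ rad a k)"
          using eq_subst[of \<Delta>2 ?j k "''x''" "d \<^bold>\<cdot> \<langle>pt a (V ''x''), pt a (Succ ?j)\<rangle> \<^bold>+
            (rad a (Succ ?j) \<^bold>+ rad a (Succ ?j)) \<^bold>\<le> rad a (V ''x'') \<^bold>+ rad a (V ''x'')" "\<^bold>N"] k by simp
      qed
    qed
  qed
  then have le: "\<Gamma> \<tturnstile> (d \<^bold>\<cdot> \<langle>pt a k, pt a j\<rangle> \<^bold>+ (rad a j \<^bold>+ rad a j) \<^bold>\<le> rad a k \<^bold>+ rad a k)"
    using imp_elim kj by simp
  note pos = approximationD(1)[OF S j]
  show ?thesis
    by (rule less_shift[OF add_le_less_mono[OF le add_less_mono[OF pos pos]]])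
      (use j k in \<open>auto simp: algebra_simps\<close>)
qed

text \<open>Completeness yields a limit without a rate; the rate comes from \<open>dist_tail\<close>
  by letting its second index tend to infinity.\<close>

lemma limit_exists:
  assumes S: "\<Gamma> \<tturnstile> approximation a" and M: "\<Gamma> \<tturnstile> metric \<sigma> d" and C: "\<Gamma> \<tturnstile> complete \<sigma> d"
  shows "\<Gamma> \<tturnstile> (\<^bold>\<exists>''z'' \<^bold>: \<sigma>. \<^bold>\<forall>''n'' \<^bold>: \<^bold>N.
    d \<^bold>\<cdot> \<langle>pt a (V ''n''), V ''z''\<rangle> \<^bold>\<le> rad a (V ''n'') \<^bold>+ rad a (V ''n''))"
proof (rule ex_elim[OF function_proj1[where \<sigma> = \<sigma> and \<tau> = "\<^bold>R" and a = a]], goal_cases)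
  case (1 \<Delta> s)
  let ?s = "Par (\<^bold>N \<^bold>\<rightarrow> \<sigma>) s"
  note S = mono[OF S 1(1)] and M = mono[OF M 1(1)] and C = mono[OF C 1(1)]
  have s: "\<Delta>' \<tturnstile> (pt a n \<^bold>= ?s \<^bold>\<cdot> n)" if "\<Delta> |\<subseteq>| \<Delta>'" "has_ty n \<^bold>N" for \<Delta>' n
    using eq_sym[OF all_elim[OF mono[OF 1(2)[simplified] that(1)] that(2), simplified], where \<sigma> = \<sigma>] that(2)
    by simp
  have "\<Delta> \<tturnstile> ((\<^bold>\<forall>''e'' \<^bold>: \<^bold>R. \<^bold>0 \<^bold>< V ''e'' \<^bold>\<longrightarrow> (\<^bold>\<exists>''k'' \<^bold>: \<^bold>N. \<^bold>\<forall>''i'' \<^bold>: \<^bold>N. \<^bold>\<forall>''j'' \<^bold>: \<^bold>N.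
            V ''k'' \<^bold><\<^sub>N V ''i'' \<^bold>\<and> V ''k'' \<^bold><\<^sub>N V ''j'' \<^bold>\<longrightarrow>
            d \<^bold>\<cdot> \<langle>?s \<^bold>\<cdot> V ''i'', ?s \<^bold>\<cdot> V ''j''\<rangle> \<^bold>< V ''e'')) \<^bold>\<longrightarrow>
        (\<^bold>\<exists>''z'' \<^bold>: \<sigma>. \<^bold>\<forall>''e'' \<^bold>: \<^bold>R. \<^bold>0 \<^bold>< V ''e'' \<^bold>\<longrightarrow> (\<^bold>\<exists>''k'' \<^bold>: \<^bold>N. \<^bold>\<forall>''i'' \<^bold>: \<^bold>N.
            V ''k'' \<^bold><\<^sub>N V ''i'' \<^bold>\<longrightarrow> d \<^bold>\<cdot> \<langle>?s \<^bold>\<cdot> V ''i'', V ''z''\<rangle> \<^bold>< V ''e'')))"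
    using all_elim[OF C[unfolded complete_def], of ?s] by simp
  then have "\<Delta> \<tturnstile> (\<^bold>\<exists>''z'' \<^bold>: \<sigma>. \<^bold>\<forall>''e'' \<^bold>: \<^bold>R. \<^bold>0 \<^bold>< V ''e'' \<^bold>\<longrightarrow> (\<^bold>\<exists>''k'' \<^bold>: \<^bold>N. \<^bold>\<forall>''i'' \<^bold>: \<^bold>N.
            V ''k'' \<^bold><\<^sub>N V ''i'' \<^bold>\<longrightarrow> d \<^bold>\<cdot> \<langle>?s \<^bold>\<cdot> V ''i'', V ''z''\<rangle> \<^bold>< V ''e''))"
  proof (rule imp_elim, intro all_intro, simp, intro imp_intro)
    fix e \<Delta>1
    let ?e = "Par \<^bold>R e"
    assume sub1: "\<Delta> |\<subseteq>| \<Delta>1" and epos: "\<Delta>1 \<tturnstile> (\<^bold>0 \<^bold>< ?e)"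
    show "\<Delta>1 \<tturnstile> (\<^bold>\<exists>''k'' \<^bold>: \<^bold>N. \<^bold>\<forall>''i'' \<^bold>: \<^bold>N. \<^bold>\<forall>''j'' \<^bold>: \<^bold>N.
            V ''k'' \<^bold><\<^sub>N V ''i'' \<^bold>\<and> V ''k'' \<^bold><\<^sub>N V ''j'' \<^bold>\<longrightarrow> d \<^bold>\<cdot> \<langle>?s \<^bold>\<cdot> V ''i'', ?s \<^bold>\<cdot> V ''j''\<rangle> \<^bold>< ?e)"
    proof (rule ex_elim[OF half_exists[of ?e]], goal_cases)
      case (2 \<Delta>2 h)
      let ?h = "Par \<^bold>R h"
      have h: "\<Delta>2 \<tturnstile> (?h \<^bold>+ ?h \<^bold>= ?e)"
        using 2(2) by simp
      have hpos: "\<Delta>2 \<tturnstile> (\<^bold>0 \<^bold>< ?h)"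
        by (rule half_pos[OF h mono[OF epos 2(1)]]) auto
      have sub2: "\<Delta> |\<subseteq>| \<Delta>2"
        using sub1 2(1) by simp
      \<comment> \<open>All terms after \<open>k\<close> are closer than \<open>h\<close> to the
        term at \<open>k\<close>, hence closer than \<open>2 h = e\<close> to one another.\<close>
      show ?case
      proof (rule ex_elim[OF rad_double_small[OF mono[OF S sub2] _ hpos]], goal_cases)
        case (2 \<Delta>3 k)
        let ?k = "Par \<^bold>N k"
        from 2(2) have k: "\<Delta>3 \<tturnstile> (rad a ?k \<^bold>+ rad a ?k \<^bold>< ?h)"
          by simp
        have "\<Delta>3 \<tturnstile> (?k \<^bold><\<^sub>N Par \<^bold>N i \<^bold>\<and> ?k \<^bold><\<^sub>N Par \<^bold>N j \<^bold>\<longrightarrow> d \<^bold>\<cdot> \<langle>?s \<^bold>\<cdot> Par \<^bold>N i, ?s \<^bold>\<cdot> Par \<^bold>N j\<rangle> \<^bold>< ?e)" for i j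
        proof (rule imp_intro)
          let ?i = "Par \<^bold>N i" and ?j = "Par \<^bold>N j"
          fix \<Delta>4 assume sub4: "\<Delta>3 |\<subseteq>| \<Delta>4" and ij: "\<Delta>4 \<tturnstile> (?k \<^bold><\<^sub>N ?i \<^bold>\<and> ?k \<^bold><\<^sub>N ?j)"
          have sub: "\<Delta> |\<subseteq>| \<Delta>4"
            using sub2 2(1) sub4 by simp
          note S = mono[OF S sub] and M = mono[OF M sub]
          have close: "\<Delta>4 \<tturnstile> (d \<^bold>\<cdot> \<langle>pt a ?k, pt a (Par \<^bold>N i)\<rangle> \<^bold>< ?h)" if "\<Delta>4 \<tturnstile> (?k \<^bold><\<^sub>N Par \<^bold>N i)" for i
            by (rule less_trans[OF dist_tail[OF S M _ _ that] mono[OF k sub4]]) auto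
          have "\<Delta>4 \<tturnstile> (d \<^bold>\<cdot> \<langle>pt a ?i, pt a ?k\<rangle> \<^bold>< ?h)"
            by (rule le_less_trans[OF eq_le[OF metric_commute[OF M]] close[OF and_elim1[OF ij]]]) auto
          note less = add_less_mono[OF this close[OF and_elim2[OF ij]], simplified]
          have "\<Delta>4 \<tturnstile> (d \<^bold>\<cdot> \<langle>pt a ?i, pt a ?j\<rangle> \<^bold>< ?h \<^bold>+ ?h)"
            by (rule le_less_trans[OF metric_triangle[OF M] less]) auto
          then have "\<Delta>4 \<tturnstile> (d \<^bold>\<cdot> \<langle>pt a ?i, pt a ?j\<rangle> \<^bold>< ?e)"
            by (rule less_le_trans) (use eq_le[OF mono[OF mono[OF h 2(1)] sub4]] in auto)
          then have "\<Delta>4 \<tturnstile> (d \<^bold>\<cdot> \<langle>?s \<^bold>\<cdot> ?i, pt a ?j\<rangle> \<^bold>< ?e)"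
            using eq_subst[OF s[OF sub, of ?i], of "''x''" "d \<^bold>\<cdot> \<langle>V ''x'', pt a ?j\<rangle> \<^bold>< ?e" \<sigma>] by simp
          then show "\<Delta>4 \<tturnstile> (d \<^bold>\<cdot> \<langle>?s \<^bold>\<cdot> ?i, ?s \<^bold>\<cdot> ?j\<rangle> \<^bold>< ?e)"
            using eq_subst[OF s[OF sub, of ?j], of "''x''" "d \<^bold>\<cdot> \<langle>?s \<^bold>\<cdot> ?i, V ''x''\<rangle> \<^bold>< ?e" \<sigma>] by simp
        qed
        then show ?case
          by (intro ex_intro[of ?k]) (auto intro!: all_intro)
      qed simp
    qed simp
  qed
  then show ?case
  proof (rule ex_elim, goal_cases)
    case (1 \<Delta>1 z)
    let ?z = "Par \<sigma> z"
    have lim: "\<Delta>1 \<tturnstile> (\<^bold>\<forall>''e'' \<^bold>: \<^bold>R. \<^bold>0 \<^bold>< V ''e'' \<^bold>\<longrightarrow> (\<^bold>\<exists>''k'' \<^bold>: \<^bold>N. \<^bold>\<forall>''i'' \<^bold>: \<^bold>N.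
            V ''k'' \<^bold><\<^sub>N V ''i'' \<^bold>\<longrightarrow> d \<^bold>\<cdot> \<langle>?s \<^bold>\<cdot> V ''i'', ?z\<rangle> \<^bold>< V ''e''))"
      using 1(2) by simp
    have "\<Delta>1 \<tturnstile> (d \<^bold>\<cdot> \<langle>pt a (Par \<^bold>N n), ?z\<rangle> \<^bold>\<le> rad a (Par \<^bold>N n) \<^bold>+ rad a (Par \<^bold>N n))" for n
    proof (rule imp_intro)
      let ?n = "Par \<^bold>N n"
      let ?r = "rad a ?n \<^bold>+ rad a ?n"
      \<comment> \<open>The supposed excess of the distance over twice the radius serves as
        tolerance: a term beyond \<open>n\<close> that is closer to \<open>z\<close> than this
        excess contradicts \<open>dist_tail\<close> by the triangle inequality.\<close>
      let ?e = "d \<^bold>\<cdot> \<langle>pt a ?n, ?z\<rangle> \<^bold>+ RNeg ?r"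
      fix \<Delta>2 assume sub2: "\<Delta>1 |\<subseteq>| \<Delta>2" and far: "\<Delta>2 \<tturnstile> (?r \<^bold>< d \<^bold>\<cdot> \<langle>pt a ?n, ?z\<rangle>)"
      have epos: "\<Delta>2 \<tturnstile> (\<^bold>0 \<^bold>< ?e)"
        by (rule less_shift[OF far]) (auto simp: algebra_simps)
      have "\<Delta>2 \<tturnstile> (\<^bold>0 \<^bold>< ?e \<^bold>\<longrightarrow> (\<^bold>\<exists>''k'' \<^bold>: \<^bold>N. \<^bold>\<forall>''i'' \<^bold>: \<^bold>N.
            V ''k'' \<^bold><\<^sub>N V ''i'' \<^bold>\<longrightarrow> d \<^bold>\<cdot> \<langle>?s \<^bold>\<cdot> V ''i'', ?z\<rangle> \<^bold>< ?e))"
        using all_elim[OF mono[OF lim sub2], of ?e] by simp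
      from imp_elim[OF this epos] show "\<Delta>2 \<tturnstile> \<^bold>\<bottom>"
      proof (rule ex_elim, goal_cases)
        case k: (1 \<Delta>3 k)
        let ?k = "Par \<^bold>N k"
        show ?case
        proof (rule ex_elim[OF common_upper_bound[of ?k ?n]], goal_cases)
          case (3 \<Delta>4 i)
          let ?i = "Par \<^bold>N i"
          from 3(2) have i: "\<Delta>4 \<tturnstile> (?k \<^bold><\<^sub>N ?i \<^bold>\<and> ?n \<^bold><\<^sub>N ?i)"
            by simp
          have sub: "\<Delta> |\<subseteq>| \<Delta>4"
            using 1(1) sub2 k(1) 3(1) by simp
          have sub': "\<Delta>2 |\<subseteq>| \<Delta>4"
            using k(1) 3(1) by simp
          note S = mono[OF S sub] and M = mono[OF M sub]
          have "\<Delta>4 \<tturnstile> (?k \<^bold><\<^sub>N ?i \<^bold>\<longrightarrow> d \<^bold>\<cdot> \<langle>?s \<^bold>\<cdot> ?i, ?z\<rangle> \<^bold>< ?e)"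
            using all_elim[OF mono[OF k(2) 3(1), simplified], of ?i] by simp
          from imp_elim[OF this and_elim1[OF i]]
          have "\<Delta>4 \<tturnstile> (d \<^bold>\<cdot> \<langle>pt a ?i, ?z\<rangle> \<^bold>< ?e)"
            using eq_subst[OF eq_sym[OF s[OF sub, of ?i], of \<sigma>], of "''x''" "d \<^bold>\<cdot> \<langle>V ''x'', ?z\<rangle> \<^bold>< ?e" \<sigma>]
            by simp
          from add_less_mono[OF dist_tail[OF S M _ _ and_elim2[OF i]] this]
          have less: "\<Delta>4 \<tturnstile> (d \<^bold>\<cdot> \<langle>pt a ?n, pt a ?i\<rangle> \<^bold>+ d \<^bold>\<cdot> \<langle>pt a ?i, ?z\<rangle> \<^bold>< ?r \<^bold>+ ?e)"
            by simp
          have "\<Delta>4 \<tturnstile> (d \<^bold>\<cdot> \<langle>pt a ?n, ?z\<rangle> \<^bold>< ?r \<^bold>+ ?e)"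
            by (rule le_less_trans[OF metric_triangle[OF M] less]) auto
          then have "\<Delta>4 \<tturnstile> (\<^bold>0 \<^bold>< \<^bold>0)"
            by (rule less_shift) (auto simp: algebra_simps)
          then show ?case
            by (rule less_irrefl) simp
        qed auto
      qed
    qed
    then show ?case
      by (intro ex_intro[of ?z]) (auto intro!: all_intro)
  qed
qed

text \<open>For a late index \<open>n\<close> both the distance from \<open>z\<close> to
  \<open>pt a n\<close> and the radius at \<open>n\<close> are below half of \<open>c\<close>, so
  nearness at \<open>pt a n\<close> carries over to \<open>z\<close> by the triangle
  inequality.\<close>

lemma near_limit:
  assumes S: "\<Gamma> \<tturnstile> approximation a" and M: "\<Gamma> \<tturnstile> metric \<sigma> d" and z: "has_ty z \<sigma>"
    and lim: "\<Gamma> \<tturnstile> (\<^bold>\<forall>''n'' \<^bold>: \<^bold>N. d \<^bold>\<cdot> \<langle>pt a (V ''n''), z\<rangle> \<^bold>\<le> rad a (V ''n'') \<^bold>+ rad a (V ''n''))"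
    and c: "real_tm c" "\<Gamma> \<tturnstile> (\<^bold>0 \<^bold>< c)"
  shows "\<Gamma> \<tturnstile> near z c"
proof (rule ex_elim[OF half_exists[OF c(1)]], goal_cases)
  case (1 \<Delta> h)
  note [simp] = c(1)[THEN has_ty_closed] z[THEN has_ty_closed]
  let ?h = "Par \<^bold>R h"
  note S = mono[OF S 1(1)] and M = mono[OF M 1(1)] and lim = mono[OF lim 1(1)]
  have h: "\<Delta> \<tturnstile> (?h \<^bold>+ ?h \<^bold>= c)"
    using 1(2) by simp
  have hpos: "\<Delta> \<tturnstile> (\<^bold>0 \<^bold>< ?h)"
    by (rule half_pos[OF h mono[OF c(2) 1(1)]]) (use c in auto)
  show ?case
  proof (rule ex_elim[OF rad_double_small[OF S _ hpos]], goal_cases)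
    case (2 \<Delta>1 n)
    let ?n = "Par \<^bold>N n"
    note S = mono[OF S 2(1)] and M = mono[OF M 2(1)] and lim = mono[OF lim 2(1)] and h = mono[OF h 2(1)]
    from 2(2) have n: "\<Delta>1 \<tturnstile> (rad a ?n \<^bold>+ rad a ?n \<^bold>< ?h)"
      by simp
    have lim_n: "\<Delta>1 \<tturnstile> (d \<^bold>\<cdot> \<langle>pt a ?n, z\<rangle> \<^bold>\<le> rad a ?n \<^bold>+ rad a ?n)"
      using all_elim[OF lim, of ?n] by simp
    have "\<Delta>1 \<tturnstile> (d \<^bold>\<cdot> \<langle>pt a ?n, z\<rangle> \<^bold>< ?h)"
      by (rule le_less_trans[OF lim_n n]) (use z in auto)
    then have zn: "\<Delta>1 \<tturnstile> (d \<^bold>\<cdot> \<langle>z, pt a ?n\<rangle> \<^bold>< ?h)"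
      by (rule le_less_trans[OF eq_le[OF metric_commute[OF M]], rotated 4]) (use z in auto)
    have pos: "\<Delta>1 \<tturnstile> (\<^bold>0 \<^bold>< rad a ?n)"
      by (rule approximationD[OF S]) simp
    have rad_less: "\<Delta>1 \<tturnstile> (rad a ?n \<^bold>< ?h)"
      by (rule less_shift[OF add_less_mono[OF n pos]]) (auto simp: algebra_simps)
    show ?case
    proof (rule near_mono[OF approximationD(2)[OF S, of ?n]])
      fix \<Delta>2 y
      let ?y = "Par \<sigma> y"
      assume sub2: "\<Delta>1 |\<subseteq>| \<Delta>2" and y: "\<Delta>2 \<tturnstile> (d \<^bold>\<cdot> \<langle>pt a ?n, ?y\<rangle> \<^bold>< rad a ?n)"
      have "\<Delta>2 \<tturnstile> (d \<^bold>\<cdot> \<langle>pt a ?n, ?y\<rangle> \<^bold>< ?h)"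
        by (rule less_trans[OF y mono[OF rad_less sub2]]) auto
      note less = add_less_mono[OF mono[OF zn sub2] this]
      have "\<Delta>2 \<tturnstile> (d \<^bold>\<cdot> \<langle>z, ?y\<rangle> \<^bold>< ?h \<^bold>+ ?h)"
        by (rule le_less_trans[OF metric_triangle[OF mono[OF M sub2]] less]) (use z in auto)
      then show "\<Delta>2 \<tturnstile> (d \<^bold>\<cdot> \<langle>z, ?y\<rangle> \<^bold>< c)"
        by (rule less_le_trans) (use eq_le[OF mono[OF h sub2]] c z in auto)
    qed (use z c in auto)
  qed simp
qed

text \<open>Antisymmetry reduces \<open>f z = 0\<close> to refuting \<open>0 < f z\<close> and
  \<open>f z < 0\<close>. In a refutation \<open>near z\<close> may be treated as providing a zero
  \<open>c\<close> of \<open>f\<close> arbitrarily close to \<open>z\<close>.\<close>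

lemma zero_set_member:
  assumes U: "\<Gamma> \<tturnstile> uniformly_continuous \<sigma> d f" and Z: "\<Gamma> \<tturnstile> is_zero_set \<sigma> f L"
    and f: "has_ty f (\<sigma> \<^bold>\<rightarrow> \<^bold>R)" and z: "has_ty z \<sigma>"
    and near: "\<And>\<Delta> c. \<Gamma> |\<subseteq>| \<Delta> \<Longrightarrow> real_tm c \<Longrightarrow> \<Delta> \<tturnstile> (\<^bold>0 \<^bold>< c) \<Longrightarrow> \<Delta> \<tturnstile> near z c"
  shows "\<Gamma> \<tturnstile> (z \<^bold>\<in> L)"
proof -
  note [simp] = f[THEN has_ty_closed] z[THEN has_ty_closed]
  have ty_f [simp]: "real_tm (f \<^bold>\<cdot> x)" if "has_ty x \<sigma>" for x
    using f that by (rule has_ty.intros(13))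
  have Z': "\<Delta> \<tturnstile> (x \<^bold>\<in> L) \<longleftrightarrow> \<Delta> \<tturnstile> (f \<^bold>\<cdot> x \<^bold>= \<^bold>0)" if "\<Gamma> |\<subseteq>| \<Delta>" "has_ty x \<sigma>" for \<Delta> x
    using iff_forces[OF all_elim[OF mono[OF Z that(1), unfolded is_zero_set_def] that(2), simplified]]
      that(2) by (simp add: has_ty_closed)
  \<comment> \<open>The part common to both refutations: for any tolerance \<open>e\<close>, uniform
    continuity gives a modulus \<open>h\<close>, and \<open>near z h\<close> supplies a zero of
    \<open>f\<close> at which the value differs from \<open>f z\<close> by less than
    \<open>e\<close>.\<close>
  have absurd: "\<Delta> \<tturnstile> \<^bold>\<bottom>"
    if sub: "\<Gamma> |\<subseteq>| \<Delta>" and e: "real_tm e" "\<Delta> \<tturnstile> (\<^bold>0 \<^bold>< e)"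
      and R: "\<And>\<Delta>' c. \<Delta> |\<subseteq>| \<Delta>' \<Longrightarrow> \<Delta>' \<tturnstile> (f \<^bold>\<cdot> Par \<sigma> c \<^bold>= \<^bold>0) \<Longrightarrow>
        \<Delta>' \<tturnstile> (f \<^bold>\<cdot> z \<^bold>< f \<^bold>\<cdot> Par \<sigma> c \<^bold>+ e) \<Longrightarrow> \<Delta>' \<tturnstile> (f \<^bold>\<cdot> Par \<sigma> c \<^bold>< f \<^bold>\<cdot> z \<^bold>+ e) \<Longrightarrow> \<Delta>' \<tturnstile> \<^bold>\<bottom>"
    for \<Delta> e
  proof -
    note [simp] = e(1)[THEN has_ty_closed]
    have "\<Delta> \<tturnstile> (\<^bold>0 \<^bold>< e \<^bold>\<longrightarrow> (\<^bold>\<exists>''h'' \<^bold>: \<^bold>R. \<^bold>0 \<^bold>< V ''h'' \<^bold>\<and>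
        (\<^bold>\<forall>''x'' \<^bold>: \<sigma>. \<^bold>\<forall>''y'' \<^bold>: \<sigma>. d \<^bold>\<cdot> \<langle>V ''x'', V ''y''\<rangle> \<^bold>< V ''h'' \<^bold>\<longrightarrow>
            f \<^bold>\<cdot> V ''x'' \<^bold>< f \<^bold>\<cdot> V ''y'' \<^bold>+ e \<^bold>\<and> f \<^bold>\<cdot> V ''y'' \<^bold>< f \<^bold>\<cdot> V ''x'' \<^bold>+ e)))"
      using all_elim[OF mono[OF U sub, unfolded uniformly_continuous_def] e(1)] by simp
    from imp_elim[OF this e(2)] show ?thesis
    proof (rule ex_elim, goal_cases)
      case (1 \<Delta>1 h)
      let ?h = "Par \<^bold>R h"
      from 1(2) have h: "\<Delta>1 \<tturnstile> (\<^bold>0 \<^bold>< ?h \<^bold>\<and> (\<^bold>\<forall>''x'' \<^bold>: \<sigma>. \<^bold>\<forall>''y'' \<^bold>: \<sigma>. d \<^bold>\<cdot> \<langle>V ''x'', V ''y''\<rangle> \<^bold>< ?h \<^bold>\<longrightarrow>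
            f \<^bold>\<cdot> V ''x'' \<^bold>< f \<^bold>\<cdot> V ''y'' \<^bold>+ e \<^bold>\<and> f \<^bold>\<cdot> V ''y'' \<^bold>< f \<^bold>\<cdot> V ''x'' \<^bold>+ e))"
        by simp
      have "\<Delta>1 \<tturnstile> near z ?h"
        by (rule near[OF _ _ and_elim1[OF h]]) (use sub 1(1) in auto)
      then show ?case
      proof (rule near_elim[OF _ z], goal_cases)
        case (2 \<Delta>2 c)
        let ?c = "Par \<sigma> c"
        have "\<Delta>2 \<tturnstile> (d \<^bold>\<cdot> \<langle>z, ?c\<rangle> \<^bold>< ?h \<^bold>\<longrightarrow> f \<^bold>\<cdot> z \<^bold>< f \<^bold>\<cdot> ?c \<^bold>+ e \<^bold>\<and> f \<^bold>\<cdot> ?c \<^bold>< f \<^bold>\<cdot> z \<^bold>+ e)"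
          using all_elim2[OF and_elim2[OF mono[OF h 2(1)]] z, of ?c] by simp
        from imp_elim[OF this 2(3)] have fc: "\<Delta>2 \<tturnstile> (f \<^bold>\<cdot> z \<^bold>< f \<^bold>\<cdot> ?c \<^bold>+ e \<^bold>\<and> f \<^bold>\<cdot> ?c \<^bold>< f \<^bold>\<cdot> z \<^bold>+ e)" .
        have "\<Delta> |\<subseteq>| \<Delta>2"
          using 1(1) 2(1) by simp
        moreover have "\<Delta>2 \<tturnstile> (f \<^bold>\<cdot> ?c \<^bold>= \<^bold>0)"
          using Z'[of \<Delta>2 ?c] 2(2) sub \<open>\<Delta> |\<subseteq>| \<Delta>2\<close> by simp
        ultimately show ?case
          using and_elim1[OF fc] and_elim2[OF fc] by (rule R)
      qed simp
    qed
  qed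
  have "\<Gamma> \<tturnstile> (f \<^bold>\<cdot> z \<^bold>= \<^bold>0)"
  proof (rule le_antisym)
    \<comment> \<open>The tolerance is \<open>f z\<close> itself, assumed positive:
      \<open>f z < f c + f z\<close> contradicts \<open>f c = 0\<close>.\<close>
    show "\<Gamma> \<tturnstile> (f \<^bold>\<cdot> z \<^bold>\<le> \<^bold>0)"
    proof (rule imp_intro, rule absurd, assumption)
      fix \<Delta> \<Delta>' c
      assume "\<Delta>' \<tturnstile> (f \<^bold>\<cdot> Par \<sigma> c \<^bold>= \<^bold>0)" and less: "\<Delta>' \<tturnstile> (f \<^bold>\<cdot> z \<^bold>< f \<^bold>\<cdot> Par \<sigma> c \<^bold>+ f \<^bold>\<cdot> z)"
      then have le: "\<Delta>' \<tturnstile> (f \<^bold>\<cdot> Par \<sigma> c \<^bold>\<le> \<^bold>0)"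
        by (intro eq_le) auto
      have "\<Delta>' \<tturnstile> (\<^bold>0 \<^bold>< \<^bold>0)"
        by (rule less_shift[OF add_le_less_mono[OF le less]]) (use z in \<open>auto simp: algebra_simps\<close>)
      then show "\<Delta>' \<tturnstile> \<^bold>\<bottom>"
        by (rule less_irrefl) simp
    qed (use z in auto)
    \<comment> \<open>Now the tolerance is \<open>- f z\<close>, so that
      \<open>f c < f z - f z\<close> contradicts \<open>f c = 0\<close>.\<close>
    show "\<Gamma> \<tturnstile> (\<^bold>0 \<^bold>\<le> f \<^bold>\<cdot> z)"
    proof (rule imp_intro, rule absurd[where e = "RNeg (f \<^bold>\<cdot> z)"], assumption)
      show "\<Delta> \<tturnstile> (\<^bold>0 \<^bold>< RNeg (f \<^bold>\<cdot> z))" if "\<Delta> \<tturnstile> (f \<^bold>\<cdot> z \<^bold>< \<^bold>0)" for \<Delta>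
        by (rule less_shift[OF that]) (use z in auto)
      fix \<Delta> \<Delta>' c
      assume "\<Delta>' \<tturnstile> (f \<^bold>\<cdot> Par \<sigma> c \<^bold>= \<^bold>0)" and less: "\<Delta>' \<tturnstile> (f \<^bold>\<cdot> Par \<sigma> c \<^bold>< f \<^bold>\<cdot> z \<^bold>+ RNeg (f \<^bold>\<cdot> z))"
      then have le: "\<Delta>' \<tturnstile> (\<^bold>0 \<^bold>\<le> f \<^bold>\<cdot> Par \<sigma> c)"
        by (intro eq_ge) auto
      have "\<Delta>' \<tturnstile> (\<^bold>0 \<^bold>< \<^bold>0)"
        by (rule less_shift[OF add_le_less_mono[OF le less]]) (use z in \<open>auto simp: algebra_simps\<close>)
      then show "\<Delta>' \<tturnstile> \<^bold>\<bottom>"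
        by (rule less_irrefl) simp
    qed (use z in auto)
  qed (use z in auto)
  then show ?thesis
    using Z'[of \<Gamma> z] z by simp
qed

text \<open>Negative nearness becomes an actual point of \<open>L\<close> at the price of doubling
  the radius: the sequence started at \<open>y\<close> with radius \<open>h\<close> has its limit in
  \<open>L\<close>, and the rate at index zero bounds the total displacement by
  \<open>2 h\<close>.\<close>

lemma member_near_point:
  assumes M: "\<Gamma> \<tturnstile> metric \<sigma> d" and C: "\<Gamma> \<tturnstile> complete \<sigma> d" and B: "\<Gamma> \<tturnstile> balls_totally_bounded \<sigma> d"
    and Q: "\<Gamma> \<tturnstile> quasilocated \<sigma> d L"
    and U: "\<Gamma> \<tturnstile> uniformly_continuous \<sigma> d f" and Z: "\<Gamma> \<tturnstile> is_zero_set \<sigma> f L" and f: "has_ty f (\<sigma> \<^bold>\<rightarrow> \<^bold>R)"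
    and near: "\<Gamma> \<tturnstile> near (Par \<sigma> y) (Par \<^bold>R h)" "\<Gamma> \<tturnstile> (\<^bold>0 \<^bold>< Par \<^bold>R h)"
  shows "\<Gamma> \<tturnstile> (\<^bold>\<exists>''z'' \<^bold>: \<sigma>. V ''z'' \<^bold>\<in> L \<^bold>\<and> d \<^bold>\<cdot> \<langle>Par \<sigma> y, V ''z''\<rangle> \<^bold>\<le> Par \<^bold>R h \<^bold>+ Par \<^bold>R h)"
proof (rule approximation_exists[OF Q M B near], goal_cases)
  case (1 \<Delta> a)
  let ?y = "Par \<sigma> y" and ?h = "Par \<^bold>R h"
  note M = mono[OF M 1(1)] and C = mono[OF C 1(1)] and S = 1(2)
  from limit_exists[OF S M C] show ?case
  proof (rule ex_elim, goal_cases)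
    case z: (1 \<Delta>1 z)
    let ?z = "Par \<sigma> z"
    have lim: "\<Delta>1 \<tturnstile> (\<^bold>\<forall>''n'' \<^bold>: \<^bold>N. d \<^bold>\<cdot> \<langle>pt a (V ''n''), ?z\<rangle> \<^bold>\<le> rad a (V ''n'') \<^bold>+ rad a (V ''n''))"
      using z(2) by simp
    have sub: "\<Gamma> |\<subseteq>| \<Delta>1"
      using 1(1) z(1) by simp
    have "\<Delta>1 \<tturnstile> (?z \<^bold>\<in> L)"
    proof (rule zero_set_member[OF mono[OF U sub] mono[OF Z sub] f])
      show "\<Delta>2 \<tturnstile> near ?z c" if "\<Delta>1 |\<subseteq>| \<Delta>2" "real_tm c" "\<Delta>2 \<tturnstile> (\<^bold>0 \<^bold>< c)" for \<Delta>2 c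
        by (rule near_limit[OF S[THEN mono] M[THEN mono] _ mono[OF lim that(1)] that(2,3)])
          (use z(1) that(1) in auto)
    qed simp
    moreover have "\<Delta>1 \<tturnstile> (d \<^bold>\<cdot> \<langle>pt a \<^bold>0\<^sub>N, ?z\<rangle> \<^bold>\<le> rad a \<^bold>0\<^sub>N \<^bold>+ rad a \<^bold>0\<^sub>N)"
      using all_elim[OF lim, of "\<^bold>0\<^sub>N"] by simp
    then have "\<Delta>1 \<tturnstile> (d \<^bold>\<cdot> \<langle>?y, ?z\<rangle> \<^bold>\<le> rad a \<^bold>0\<^sub>N \<^bold>+ rad a \<^bold>0\<^sub>N)"
      using eq_subst[OF mono[OF 1(3) z(1)], of "''x''" "d \<^bold>\<cdot> \<langle>V ''x'', ?z\<rangle> \<^bold>\<le> rad a \<^bold>0\<^sub>N \<^bold>+ rad a \<^bold>0\<^sub>N" \<sigma>]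
      by simp
    then have "\<Delta>1 \<tturnstile> (d \<^bold>\<cdot> \<langle>?y, ?z\<rangle> \<^bold>\<le> ?h \<^bold>+ ?h)"
      using eq_subst[OF mono[OF 1(4) z(1)], of "''x''" "d \<^bold>\<cdot> \<langle>?y, ?z\<rangle> \<^bold>\<le> V ''x'' \<^bold>+ V ''x''" "\<^bold>R"]
      by simp
    ultimately show ?case
      by (intro ex_intro[of ?z]) (auto intro: and_intro)
  qed
qed

lemma quasilocated_imp_located:
  assumes M: "\<Gamma> \<tturnstile> metric \<sigma> d" and C: "\<Gamma> \<tturnstile> complete \<sigma> d" and B: "\<Gamma> \<tturnstile> balls_totally_bounded \<sigma> d"
    and Q: "\<Gamma> \<tturnstile> quasilocated \<sigma> d L"
    and U: "\<Gamma> \<tturnstile> uniformly_continuous \<sigma> d f" and Z: "\<Gamma> \<tturnstile> is_zero_set \<sigma> f L" and f: "has_ty f (\<sigma> \<^bold>\<rightarrow> \<^bold>R)"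
  shows "\<Gamma> \<tturnstile> located \<sigma> d L"
  unfolding located_def
proof (rule all_intro, rule quasilocated_elim[OF Q M])
  fix x \<Delta> a b
  let ?x = "Par \<sigma> x" and ?T = "Par (TPow \<^bold>R) a" and ?m = "Par \<^bold>R b"
  show "has_ty ?x \<sigma>"
    by simp
  assume sub: "\<Gamma> |\<subseteq>| \<Delta>" and D: "\<Delta> \<tturnstile> is_distance_set \<sigma> d ?x L ?T" and lb: "\<Delta> \<tturnstile> is_lower_bound ?m ?T"
    and near: "\<And>\<Delta>' e. \<Delta> |\<subseteq>| \<Delta>' \<Longrightarrow> real_tm e \<Longrightarrow> \<Delta>' \<tturnstile> (?m \<^bold>< e) \<Longrightarrow> \<Delta>' \<tturnstile> near ?x e"
    and m: "\<Delta> \<tturnstile> (\<^bold>0 \<^bold>\<le> ?m)"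
  note mono_sub = mono[OF _ sub]
  note M = mono_sub[OF M] and C = mono_sub[OF C] and B = mono_sub[OF B] and Q = mono_sub[OF Q]
    and U = mono_sub[OF U] and Z = mono_sub[OF Z]
  \<comment> \<open>Given \<open>s > m\<close>, let \<open>h\<close> be half of \<open>s - m\<close>
    and \<open>g\<close> half of \<open>h\<close>: the first \<open>h\<close> is slack for the step
    to \<open>y\<close>, the second is used up by the way \<open>2 g\<close> from \<open>y\<close>
    into \<open>L\<close>.\<close>
  have "\<Delta> \<tturnstile> (?m \<^bold>< Par \<^bold>R s \<^bold>\<longrightarrow> (\<^bold>\<exists>''t'' \<^bold>: \<^bold>R. V ''t'' \<^bold>\<in> ?T \<^bold>\<and> V ''t'' \<^bold>< Par \<^bold>R s))" for s
  proof (rule imp_intro, rule ex_elim[OF half_exists[of "Par \<^bold>R s \<^bold>+ RNeg ?m"]], goal_cases)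
    let ?s = "Par \<^bold>R s"
    case (2 \<Delta>1 \<Delta>2 h)
    let ?h = "Par \<^bold>R h"
    from 2(4) have h: "\<Delta>2 \<tturnstile> (?h \<^bold>+ ?h \<^bold>= ?s \<^bold>+ RNeg ?m)"
      by simp
    have "\<Delta>2 \<tturnstile> (\<^bold>0 \<^bold>< ?s \<^bold>+ RNeg ?m)"
      by (rule less_shift[OF mono[OF 2(2,3)]]) (auto simp: algebra_simps)
    then have hpos: "\<Delta>2 \<tturnstile> (\<^bold>0 \<^bold>< ?h)"
      by (rule half_pos[OF h]) auto
    have sub2: "\<Delta> |\<subseteq>| \<Delta>2"
      using 2(1,3) by simp
    show ?case
    proof (rule ex_elim[OF half_exists[of ?h]], goal_cases)
      case (2 \<Delta>3 g)
      let ?g = "Par \<^bold>R g"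
      from 2(2) have g: "\<Delta>3 \<tturnstile> (?g \<^bold>+ ?g \<^bold>= ?h)"
        by simp
      note h = mono[OF h 2(1)] and hpos = mono[OF hpos 2(1)]
      have gpos: "\<Delta>3 \<tturnstile> (\<^bold>0 \<^bold>< ?g)"
        by (rule half_pos[OF g hpos]) auto
      have sub3: "\<Delta> |\<subseteq>| \<Delta>3"
        using sub2 2(1) by simp
      have mh: "\<Delta>3 \<tturnstile> (?m \<^bold>< ?m \<^bold>+ ?h)"
        by (rule less_shift[OF hpos]) (auto simp: algebra_simps)
      have "\<Delta>3 \<tturnstile> (\<^bold>0 \<^bold>< ?m \<^bold>+ ?h)"
        by (rule le_less_trans[OF mono[OF m sub3] mh]) auto
      \<comment> \<open>The radius \<open>m + h\<close> is admissible at \<open>x\<close> because it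
        exceeds \<open>m\<close>; the target radius \<open>g\<close> is independent of it and can be
        as small as required.\<close>
      note near_step[OF mono[OF Q sub3] mono[OF M sub3] mono[OF B sub3] _ _ this _ gpos near[OF sub3 _ mh]]
      from this[simplified] show ?case
      proof (rule ex_elim, goal_cases)
        case (1 \<Delta>4 y)
        let ?y = "Par \<sigma> y"
        from 1(2) have y: "\<Delta>4 \<tturnstile> (d \<^bold>\<cdot> \<langle>?x, ?y\<rangle> \<^bold>< ?m \<^bold>+ ?h \<^bold>\<and> near ?y ?g)"
          by simp
        have sub4: "\<Delta> |\<subseteq>| \<Delta>4"
          using sub3 1(1) by simp
        note mono4 = mono[OF _ sub4]
        show ?case
        proof (rule ex_elim[OF member_near_point[OF mono4[OF M] mono4[OF C] mono4[OF B] mono4[OF Q]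
                mono4[OF U] mono4[OF Z] f and_elim2[OF y] mono[OF gpos 1(1)]]], goal_cases)
          case z: (1 \<Delta>5 z)
          let ?z = "Par \<sigma> z"
          from z(2) have yz: "\<Delta>5 \<tturnstile> (?z \<^bold>\<in> L \<^bold>\<and> d \<^bold>\<cdot> \<langle>?y, ?z\<rangle> \<^bold>\<le> ?g \<^bold>+ ?g)"
            by simp
          have sub5: "\<Delta> |\<subseteq>| \<Delta>5"
            using sub4 z(1) by simp
          have sub35: "\<Delta>3 |\<subseteq>| \<Delta>5"
            using 1(1) z(1) by simp
          have tri: "\<Delta>5 \<tturnstile> (d \<^bold>\<cdot> \<langle>?x, ?z\<rangle> \<^bold>\<le> d \<^bold>\<cdot> \<langle>?x, ?y\<rangle> \<^bold>+ d \<^bold>\<cdot> \<langle>?y, ?z\<rangle>)"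
            by (rule metric_triangle[OF mono[OF M sub5]]) auto
          have gh: "\<Delta>5 \<tturnstile> (?g \<^bold>+ ?g \<^bold>\<le> ?h)" and hs: "\<Delta>5 \<tturnstile> (?h \<^bold>+ ?h \<^bold>\<le> ?s \<^bold>+ RNeg ?m)"
            using mono[OF eq_le[OF g] sub35] mono[OF eq_le[OF h] sub35] by simp_all
          \<comment> \<open>The distance is less than \<open>(m + h) + 2 g\<close>, and
            \<open>2 g = h\<close> and \<open>2 h = s - m\<close> make this
            \<open>s\<close>.\<close>
          have "\<Delta>5 \<tturnstile> (d \<^bold>\<cdot> \<langle>?x, ?z\<rangle> \<^bold>< ?s)"
            by (rule less_shift[OF add_le_less_mono[OF add_le_mono[OF add_le_mono[OF tri and_elim2[OF yz]]
                    add_le_mono[OF gh hs]] mono[OF and_elim1[OF y] z(1)]]])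
              (auto simp: algebra_simps)
          moreover have "\<Delta>5 \<tturnstile> (d \<^bold>\<cdot> \<langle>?x, ?z\<rangle> \<^bold>\<in> ?T)"
            by (rule dist_in_distance_set[OF mono[OF D sub5] _ _ _ and_elim1[OF yz]]) auto
          ultimately show ?case
            by (intro ex_intro[of "d \<^bold>\<cdot> \<langle>?x, ?z\<rangle>"]) (auto intro: and_intro)
        qed
      qed
    qed simp
  qed simp
  then have "\<Delta> \<tturnstile> is_inf ?m ?T"
    using lb unfolding is_inf_def by (intro and_intro all_intro) auto
  then have "\<Delta> \<tturnstile> (\<^bold>\<exists>''m'' \<^bold>: \<^bold>R. is_inf (V ''m'') ?T)"
    by (intro ex_intro[of ?m]) (auto simp: is_inf_def is_lower_bound_def)
  \<comment> \<open>The distance set and the bound supplied by quasilocatedness are the witnesses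
    for locatedness.\<close>
  with D show "\<Delta> \<tturnstile> subst ''x'' ?x (\<^bold>\<exists>''T'' \<^bold>: TPow \<^bold>R. is_distance_set \<sigma> d (V ''x'') L (V ''T'') \<^bold>\<and>
        (\<^bold>\<exists>''m'' \<^bold>: \<^bold>R. is_inf (V ''m'') (V ''T'')))"
    by (auto simp: is_inf_def is_lower_bound_def is_distance_set_def intro!: ex_intro[of ?T] and_intro)
qed

end

section \<open>From typed parameters back to the closed formula\<close>

theorem mainTheorem9:
  fixes \<sigma> :: ty
  shows "IHOL \<union> DC; {} \<turnstile>
    (\<^bold>\<forall>''d'' \<^bold>: (\<sigma> \<^bold>\<times> \<sigma>) \<^bold>\<rightarrow> \<^bold>R.
        metric \<sigma> (V ''d'') \<^bold>\<and> complete \<sigma> (V ''d'') \<^bold>\<and> balls_totally_bounded \<sigma> (V ''d'') \<^bold>\<longrightarrow>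
        (\<^bold>\<forall>''L'' \<^bold>: TPow \<sigma>.
            quasilocated \<sigma> (V ''d'') (V ''L'') \<^bold>\<and>
            (\<^bold>\<exists>''f'' \<^bold>: \<sigma> \<^bold>\<rightarrow> \<^bold>R.
                uniformly_continuous \<sigma> (V ''d'') (V ''f'') \<^bold>\<and> is_zero_set \<sigma> (V ''f'') (V ''L'')) \<^bold>\<longrightarrow>
            located \<sigma> (V ''d'') (V ''L'')))"
proof -
  \<comment> \<open>Instantiating \<open>d\<close>, \<open>L\<close> and \<open>f\<close> commutes
    with the defined formulas, so these stay folded and match the locale lemmas. Closedness is asked
    for where a later substitution could otherwise enter a term inserted earlier.\<close>
  have subst_defs:
    "subst ''d'' u (metric \<sigma> (V ''d'')) = metric \<sigma> u"
    "subst ''d'' u (complete \<sigma> (V ''d'')) = complete \<sigma> u"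
    "subst ''d'' u (balls_totally_bounded \<sigma> (V ''d'')) = balls_totally_bounded \<sigma> u"
    "subst ''d'' u (quasilocated \<sigma> (V ''d'') (V ''L'')) = quasilocated \<sigma> u (V ''L'')"
    "subst ''d'' u (uniformly_continuous \<sigma> (V ''d'') (V ''f'')) = uniformly_continuous \<sigma> u (V ''f'')"
    "subst ''d'' u (is_zero_set \<sigma> (V ''f'') (V ''L'')) = is_zero_set \<sigma> (V ''f'') (V ''L'')"
    "subst ''d'' u (located \<sigma> (V ''d'') (V ''L'')) = located \<sigma> u (V ''L'')"
    "vars_tm u = {} \<Longrightarrow> subst ''L'' v (quasilocated \<sigma> u (V ''L'')) = quasilocated \<sigma> u v"
    "vars_tm u = {} \<Longrightarrow> subst ''L'' v (uniformly_continuous \<sigma> u (V ''f'')) = uniformly_continuous \<sigma> u (V ''f'')"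
    "subst ''L'' v (is_zero_set \<sigma> (V ''f'') (V ''L'')) = is_zero_set \<sigma> (V ''f'') v"
    "vars_tm u = {} \<Longrightarrow> subst ''L'' v (located \<sigma> u (V ''L'')) = located \<sigma> u v"
    "vars_tm u = {} \<Longrightarrow> subst ''f'' w (uniformly_continuous \<sigma> u (V ''f'')) = uniformly_continuous \<sigma> u w"
    "vars_tm v = {} \<Longrightarrow> subst ''f'' w (is_zero_set \<sigma> (V ''f'') v) = is_zero_set \<sigma> w v"
    for u v w
    by (simp_all add: metric_def complete_def balls_totally_bounded_def totally_bounded_def
        quasilocated_def located_def is_distance_set_def is_glb_def is_inf_def is_lower_bound_def
        uniformly_continuous_def is_zero_set_def)
  have "{||} \<tturnstile>
    (\<^bold>\<forall>''d'' \<^bold>: (\<sigma> \<^bold>\<times> \<sigma>) \<^bold>\<rightarrow> \<^bold>R.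
        metric \<sigma> (V ''d'') \<^bold>\<and> complete \<sigma> (V ''d'') \<^bold>\<and> balls_totally_bounded \<sigma> (V ''d'') \<^bold>\<longrightarrow>
        (\<^bold>\<forall>''L'' \<^bold>: TPow \<sigma>.
            quasilocated \<sigma> (V ''d'') (V ''L'') \<^bold>\<and>
            (\<^bold>\<exists>''f'' \<^bold>: \<sigma> \<^bold>\<rightarrow> \<^bold>R.
                uniformly_continuous \<sigma> (V ''d'') (V ''f'') \<^bold>\<and> is_zero_set \<sigma> (V ''f'') (V ''L'')) \<^bold>\<longrightarrow>
            located \<sigma> (V ''d'') (V ''L'')))"
  proof (rule all_intro, simp add: subst_defs, rule imp_intro, rule all_intro, simp add: subst_defs,
      rule imp_intro, goal_cases)
    case (1 d \<Delta> L \<Delta>1)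
    let ?d = "Par ((\<sigma> \<^bold>\<times> \<sigma>) \<^bold>\<rightarrow> \<^bold>R) d" and ?L = "Par (TPow \<sigma>) L"
    interpret metric_subset \<sigma> ?d ?L
      by standard simp_all
    note hyps = mono[OF 1(1,2)]
    show ?case
    proof (rule ex_elim[OF and_elim2[OF 1(3)]], goal_cases)
      case f: (1 \<Delta>2 f)
      then have f': "\<Delta>2 \<tturnstile> (uniformly_continuous \<sigma> ?d (Par (\<sigma> \<^bold>\<rightarrow> \<^bold>R) f) \<^bold>\<and> is_zero_set \<sigma> (Par (\<sigma> \<^bold>\<rightarrow> \<^bold>R) f) ?L)"
        by (simp add: subst_defs)
      note hyps = mono[OF hyps f(1)]
      show ?case
        by (rule quasilocated_imp_located[OF and_elim1[OF hyps] and_elim1[OF and_elim2[OF hyps]]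
              and_elim2[OF and_elim2[OF hyps]] mono[OF and_elim1[OF 1(3)] f(1)]
              and_elim1[OF f'] and_elim2[OF f']]) simp
    qed
  qed
  then show ?thesis
    by (simp add: forces_def)
qed

end
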